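(* For every fixed integer $k\ge0$, the function on $\mathbb{H}$ given by $f(\mathbf{m})=g_{\mathbf{m},k}(x;q)$ satisfies the restricted modular law. Consequently, for every fixed integer $k\ge1$, the function on $\mathbb{H}$ given by $f(\mathbf{m})=G_{\mathbf{m},k}(x;q)$ satisfies the restricted modular law.
   Context: $[n]=\{1,\dots,n\}$, $[k]_q=1+q+\cdots+q^{k-1}$. $\Lambda$ is the algebra of symmetric functions over $\mathbb{Q}(q)$; $e_\lambda,h_\lambda$ are the elementary and complete homogeneous symmetric functions; $\omega$ is the involution with $\omega(h_\lambda)=e_\lambda$. A Hessenberg function of length $n$ is a weakly increasing map $\mathbf{m}:[n]\to[n]$ with $i\le\mathbf{m}(i)$ for all $i$; $\mathbb{H}_n$ is the set of these and $\mathbb{H}=\bigcup_{n\ge1}\mathbb{H}_n$. Restricted modular law. A triple $(\mathbf{m},\mathbf{m}',\mathbf{m}'')\in\mathbb{H}_n^3$ is a modular triple of type I if there is $i\in[n-1]$ such that: (1) $\mathbf{m}(i)+1=\mathbf{m}'(i)=\mathbf{m}''(i)-1$ and $\mathbf{m}'(i-1)<\mathbf{m}'(i)<\mathbf{m}'(i+1)$, where $\mathbf{m}'(0)=0$; (2) $\mathbf{m}(j)=\mathbf{m}'(j)=\mathbf{m}''(j)$ for all $j\in[n]\setminus\{i\}$; (3) $\mathbf{m}'(\mathbf{m}'(i))=\mathbf{m}'(\mathbf{m}'(i)+1)$. It is a restricted modular triple of type II if there is $i\in[n-1]$ with $i\ne1$ such that: (1) $\mathbf{m}'(i)+1=\mathbf{m}'(i+1)$,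 $\mathbf{m}(i)=\mathbf{m}'(i)=\mathbf{m}''(i)-1$, and $\mathbf{m}(i+1)+1=\mathbf{m}'(i+1)=\mathbf{m}''(i+1)$; (2) $\mathbf{m}(j)=\mathbf{m}'(j)=\mathbf{m}''(j)$ for all $j\in[n]\setminus\{i,i+1\}$; (3) $(\mathbf{m}')^{-1}(\{i\})=\emptyset$. A function $f:\mathbb{H}\to A$, with $A$ a $\mathbb{Q}(q)$-algebra (here $A=\Lambda$), satisfies the restricted modular law if $(1+q)f(\mathbf{m}')=qf(\mathbf{m})+f(\mathbf{m}'')$ whenever $(\mathbf{m},\mathbf{m}',\mathbf{m}'')$ is a modular triple of type I or a restricted modular triple of type II. The functions $g$ and $G$. Define $\rho_0(x;q)=1$ and, recursively for $n\ge1$, $[n]_qh_n(x)=\sum_{i=1}^nh_{n-i}(x)\rho_i(x;q)$; put $\rho_{(\mu_1,\dots,\mu_s)}=\rho_{\mu_1}\cdots\rho_{\mu_s}$. Let $\mathfrak{S}_{n,\mathbf{m}}$ be the set of permutations $\sigma$ of $[n]$ with $\sigma(i)\le\mathbf{m}(i)$ for all $i$. Write $\sigma=\tau_1\tau_2\cdots\tau_j$ for the cycle decomposition (fixed points included), each cycle written with its smallest element first, cycles ordered by increasing minimal elements (so $\tau_1$ contains $1$); $|\tau_i|$ is the length of $\tau_i$; $\sigma^c$ is the word obtained by erasing parentheses; $\mathrm{wt}_{\mathbf{m}}(\sigma)=|\{(i,j): i<j\le\mathbf{m}(i),\ j\text{ precedes }i\text{ in }\sigma^c\}|$. For $\mathbf{m}\in\mathbb{H}_n$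 and $0\le k<n$, \[ g_{\mathbf{m},k}(x;q)=\sum_{\substack{\sigma=\tau_1\cdots\tau_j\in\mathfrak{S}_{n,\mathbf{m}}\\|\tau_1|\ge n-k}}(-1)^{|\tau_1|-n+k}q^{\mathrm{wt}_{\mathbf{m}}(\sigma)}h_{|\tau_1|-n+k}(x)\,\omega\big(\rho_{(|\tau_2|,\dots,|\tau_j|)}(x;q)\big), \] and $G_{\mathbf{m},k}(x;q)=e_k(x)g_{\mathbf{m},n-k}(x;q)$ for $1\le k\le n$. Convention: $g_{\mathbf{m},k}=0$ if $k\ge n$, and $G_{\mathbf{m},k}=0$ if $k>n$. *)

theory Defs
  imports
    "HOL-Library.Poly_Mapping"
    "HOL-Library.FuncSet"
    "HOL-Combinatorics.Cycles"
    "HOL-Computational_Algebra.Polynomial"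
    "HOL-Computational_Algebra.Fraction_Field"
begin

section \<open>The ring of symmetric functions\<close>

text \<open>
  Monomials in the variables \<open>x\<^sub>0, x\<^sub>1, x\<^sub>2, \<dots>\<close> are finitely supported exponent vectors.
  A symmetric function is a formal power series of bounded degree in these variables,
  given by its coefficient function, that is invariant under permuting the variables.
\<close>

type_synonym mono = "nat \<Rightarrow>\<^sub>0 nat"

definition mdeg :: "mono \<Rightarrow> nat" where
  "mdeg a = (\<Sum>i\<in>Poly_Mapping.keys a. Poly_Mapping.lookup a i)"

definition is_symmetric_function :: "(mono \<Rightarrow> 'a::zero) \<Rightarrow> bool" where
  "is_symmetric_function f \<longleftrightarrow>
     (\<exists>d. \<forall>a. f a \<noteq> 0 \<longrightarrow> mdeg a \<le> d) \<and>
     (\<forall>\<pi> a. bij \<pi> \<longrightarrow> f (Poly_Mapping.map_key \<pi> a) = f a)"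

lemma keys_map_key_bij: "bij \<pi> \<Longrightarrow> Poly_Mapping.keys (Poly_Mapping.map_key \<pi> a) = \<pi> -` Poly_Mapping.keys a"
  by (simp add: bij_is_inj keys_map_key)

lemma lookup_map_key_bij: "bij \<pi> \<Longrightarrow> Poly_Mapping.lookup (Poly_Mapping.map_key \<pi> a) i = Poly_Mapping.lookup a (\<pi> i)"
  by (simp add: bij_is_inj map_key.rep_eq)

lemma mdeg_map_key:
  assumes "bij \<pi>"
  shows "mdeg (Poly_Mapping.map_key \<pi> a) = mdeg a"
proof -
  have "bij_betw \<pi> (\<pi> -` Poly_Mapping.keys a) (Poly_Mapping.keys a)"
    using assms bij_is_inj[OF assms] bij_is_surj[OF assms]
    by (simp add: bij_betw_def inj_on_subset[OF bij_is_inj] surj_image_vimage_eq)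
  from sum.reindex_bij_betw[OF this, of "Poly_Mapping.lookup a"] show ?thesis
    by (simp only: mdeg_def keys_map_key_bij[OF assms] lookup_map_key_bij[OF assms])
qed

lemma mdeg_superset:
  "finite S \<Longrightarrow> Poly_Mapping.keys a \<subseteq> S \<Longrightarrow> mdeg a = (\<Sum>i\<in>S. Poly_Mapping.lookup a i)"
  unfolding mdeg_def by (rule sum.mono_neutral_left) (auto simp: in_keys_iff)

lemma mdeg_add: "mdeg (a + b) = mdeg a + mdeg b"
proof -
  let ?S = "Poly_Mapping.keys a \<union> Poly_Mapping.keys b"
  have "Poly_Mapping.keys (a + b) \<subseteq> ?S" by (rule Poly_Mapping.keys_add)
  then show ?thesis
    by (simp add: mdeg_superset[of ?S] lookup_add sum.distrib)
qed

lemma mdeg_zero [simp]: "mdeg 0 = 0"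
  by (simp add: mdeg_def)

lemma mdeg_eq_0_iff [simp]: "mdeg a = 0 \<longleftrightarrow> a = 0"
proof
  assume "mdeg a = 0"
  then have "\<forall>i\<in>Poly_Mapping.keys a. Poly_Mapping.lookup a i = 0"
    by (simp add: mdeg_def)
  then show "a = 0"
    by (metis in_keys_iff lookup_zero poly_mapping_eqI)
qed simp

lemma map_key_inv:
  assumes "bij \<pi>"
  shows "Poly_Mapping.map_key \<pi> (Poly_Mapping.map_key (inv \<pi>) a) = a"
    "Poly_Mapping.map_key (inv \<pi>) (Poly_Mapping.map_key \<pi> a) = a"
  using assms bij_imp_bij_inv[OF assms]
  by (auto intro!: poly_mapping_eqI simp: lookup_map_key_bij surj_f_inv_f bij_is_surj inv_f_f bij_is_inj)

lemma map_key_add_bij: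
  "bij \<pi> \<Longrightarrow> Poly_Mapping.map_key \<pi> (a + b) = Poly_Mapping.map_key \<pi> a + Poly_Mapping.map_key \<pi> b"
  by (simp add: bij_is_inj map_key_plus)

lemma map_key_zero_bij: "bij \<pi> \<Longrightarrow> Poly_Mapping.map_key \<pi> (0 :: mono) = 0"
  by (simp add: bij_is_inj)

definition splits :: "mono \<Rightarrow> (mono \<times> mono) set" where
  "splits m = {(a, b). a + b = m}"

lemma finite_divisors: "finite {a :: mono. \<exists>b. a + b = m}"
proof (rule finite_imageD)
  let ?F = "{f. \<forall>i. (i \<in> Poly_Mapping.keys m \<longrightarrow> f i \<in> {..mdeg m}) \<and>
               (i \<notin> Poly_Mapping.keys m \<longrightarrow> f i = (0::nat))}"
  have "finite ?F" by (rule finite_set_of_finite_funs) auto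
  moreover have "Poly_Mapping.lookup ` {a. \<exists>b. a + b = m} \<subseteq> ?F"
  proof (clarsimp, intro conjI impI)
    fix a b :: mono and i
    { assume i: "i \<in> Poly_Mapping.keys (a + b)"
      have "Poly_Mapping.lookup a i \<le> Poly_Mapping.lookup (a + b) i" by (simp add: lookup_add)
      also have "\<dots> \<le> mdeg (a + b)"
        unfolding mdeg_def by (rule member_le_sum[OF i]) auto
      finally show "Poly_Mapping.lookup a i \<le> mdeg (a + b)" . }
    { assume "i \<notin> Poly_Mapping.keys (a + b)"
      then show "Poly_Mapping.lookup a i = 0" by (simp add: in_keys_iff lookup_add) }
  qed
  ultimately show "finite (Poly_Mapping.lookup ` {a. \<exists>b. a + b = m})"
    by (rule finite_subset[rotated])
qed (simp add: inj_on_def)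

lemma finite_splits [simp]: "finite (splits m)"
proof (rule finite_subset)
  show "splits m \<subseteq> {a. \<exists>b. a + b = m} \<times> {a. \<exists>b. a + b = m}"
    by (auto simp: splits_def) (metis add.commute)
qed (simp add: finite_divisors)

typedef (overloaded) 'a symfun = "{f :: mono \<Rightarrow> 'a::zero. is_symmetric_function f}"
  morphisms coeff_sf Abs_symfun
  by (rule exI[of _ "\<lambda>_. 0"]) (simp add: is_symmetric_function_def)

setup_lifting type_definition_symfun

lemma symfun_eqI: "(\<And>a. coeff_sf f a = coeff_sf g a) \<Longrightarrow> f = g"
  by transfer auto

instantiation symfun :: (comm_ring_1) comm_ring_1
begin

lift_definition zero_symfun :: "'a symfun" is "\<lambda>_. 0"
  by (simp add: is_symmetric_function_def)

lift_definition one_symfun :: "'a symfun" is "\<lambda>a. if a = 0 then 1 else 0"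
  unfolding is_symmetric_function_def
  by (metis mdeg_eq_0_iff mdeg_map_key order_refl)

lift_definition plus_symfun :: "'a symfun \<Rightarrow> 'a symfun \<Rightarrow> 'a symfun" is "\<lambda>f g a. f a + g a"
proof -
  fix f g :: "mono \<Rightarrow> 'a"
  assume f: "is_symmetric_function f" and g: "is_symmetric_function g"
  from f obtain d1 where d1: "\<And>a. f a \<noteq> 0 \<Longrightarrow> mdeg a \<le> d1"
    by (auto simp: is_symmetric_function_def)
  from g obtain d2 where d2: "\<And>a. g a \<noteq> 0 \<Longrightarrow> mdeg a \<le> d2"
    by (auto simp: is_symmetric_function_def)
  have "\<forall>a. f a + g a \<noteq> 0 \<longrightarrow> mdeg a \<le> max d1 d2"
    using d1 d2 by (metis add.right_neutral le_max_iff_disj)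
  with f g show "is_symmetric_function (\<lambda>a. f a + g a)"
    unfolding is_symmetric_function_def by auto
qed

lift_definition uminus_symfun :: "'a symfun \<Rightarrow> 'a symfun" is "\<lambda>f a. - f a"
  by (simp add: is_symmetric_function_def)

definition minus_symfun :: "'a symfun \<Rightarrow> 'a symfun \<Rightarrow> 'a symfun" where
  "minus_symfun f g = f + (- g)"

lift_definition times_symfun :: "'a symfun \<Rightarrow> 'a symfun \<Rightarrow> 'a symfun"
  is "\<lambda>f g m. \<Sum>(a, b)\<in>splits m. f a * g b"
proof -
  fix f g :: "mono \<Rightarrow> 'a"
  assume f: "is_symmetric_function f" and g: "is_symmetric_function g"
  from f obtain d1 where d1: "\<And>a. f a \<noteq> 0 \<Longrightarrow> mdeg a \<le> d1"
    by (auto simp: is_symmetric_function_def)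
  from g obtain d2 where d2: "\<And>a. g a \<noteq> 0 \<Longrightarrow> mdeg a \<le> d2"
    by (auto simp: is_symmetric_function_def)
  have "mdeg m \<le> d1 + d2" if "(\<Sum>(a, b)\<in>splits m. f a * g b) \<noteq> 0" for m
  proof -
    from that obtain a b where ab: "(a, b) \<in> splits m" "f a * g b \<noteq> 0"
      by (metis (no_types, lifting) sum.neutral case_prodE2 surj_pair case_prod_conv)
    then have "f a \<noteq> 0" "g b \<noteq> 0" by auto
    with d1 d2 have "mdeg a \<le> d1" "mdeg b \<le> d2" by auto
    with ab show ?thesis by (auto simp: splits_def mdeg_add)
  qed
  moreover have "(\<Sum>(a, b)\<in>splits (Poly_Mapping.map_key \<pi> m). f a * g b) = (\<Sum>(a, b)\<in>splits m. f a * g b)"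
    if pi: "bij \<pi>" for \<pi> m
  proof (rule sum.reindex_bij_witness[where
        i = "\<lambda>(a, b). (Poly_Mapping.map_key \<pi> a, Poly_Mapping.map_key \<pi> b)" and
        j = "\<lambda>(a, b). (Poly_Mapping.map_key (inv \<pi>) a, Poly_Mapping.map_key (inv \<pi>) b)"])
    note pi' = bij_imp_bij_inv[OF pi]
    fix x assume "x \<in> splits (Poly_Mapping.map_key \<pi> m)"
    then obtain a b where x: "x = (a, b)" "a + b = Poly_Mapping.map_key \<pi> m"
      by (auto simp: splits_def)
    show "(case case x of (a, b) \<Rightarrow> (Poly_Mapping.map_key (inv \<pi>) a, Poly_Mapping.map_key (inv \<pi>) b) of
        (a, b) \<Rightarrow> (Poly_Mapping.map_key \<pi> a, Poly_Mapping.map_key \<pi> b)) = x"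
      by (simp add: x map_key_inv[OF pi])
    show "(case x of (a, b) \<Rightarrow> (Poly_Mapping.map_key (inv \<pi>) a, Poly_Mapping.map_key (inv \<pi>) b)) \<in> splits m"
      by (simp add: x splits_def map_key_add_bij[OF pi', symmetric] map_key_inv[OF pi])
    show "(case case x of (a, b) \<Rightarrow> (Poly_Mapping.map_key (inv \<pi>) a, Poly_Mapping.map_key (inv \<pi>) b) of
        (a, b) \<Rightarrow> f a * g b) = (case x of (a, b) \<Rightarrow> f a * g b)"
      using f g pi' by (simp add: x is_symmetric_function_def)
  next
    fix x assume "x \<in> splits m"
    then obtain a b where x: "x = (a, b)" "a + b = m"
      by (auto simp: splits_def)
    show "(case case x of (a, b) \<Rightarrow> (Poly_Mapping.map_key \<pi> a, Poly_Mapping.map_key \<pi> b) of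
        (a, b) \<Rightarrow> (Poly_Mapping.map_key (inv \<pi>) a, Poly_Mapping.map_key (inv \<pi>) b)) = x"
      by (simp add: x map_key_inv[OF pi])
    show "(case x of (a, b) \<Rightarrow> (Poly_Mapping.map_key \<pi> a, Poly_Mapping.map_key \<pi> b))
        \<in> splits (Poly_Mapping.map_key \<pi> m)"
      by (simp add: x splits_def map_key_add_bij[OF pi, symmetric])
  qed
  ultimately show "is_symmetric_function (\<lambda>m. \<Sum>(a, b)\<in>splits m. f a * g b)"
    unfolding is_symmetric_function_def by blast
qed

instance
proof
  fix f g h :: "'a symfun"
  show "f + g + h = f + (g + h)" by transfer (simp add: add.assoc)
  show "f + g = g + f" by transfer (simp add: add.commute)
  show "0 + f = f" by transfer simp
  show "- f + f = 0" by transfer simp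
  show "f - g = f + - g" by (simp add: minus_symfun_def)
  show "(0 :: 'a symfun) \<noteq> 1" by transfer (metis zero_neq_one)
  show "(f + g) * h = f * h + g * h"
    by transfer (simp add: distrib_right sum.distrib case_prod_unfold)
  show "f * g = g * f"
  proof (transfer, rule ext)
    fix f g :: "mono \<Rightarrow> 'a" and m
    show "(\<Sum>(a, b)\<in>splits m. f a * g b) = (\<Sum>(a, b)\<in>splits m. g a * f b)"
      by (rule sum.reindex_bij_witness[where i = "\<lambda>(a, b). (b, a)" and j = "\<lambda>(a, b). (b, a)"])
         (auto simp: splits_def ac_simps)
  qed
  show "1 * f = f"
  proof (transfer, rule ext)
    fix f :: "mono \<Rightarrow> 'a" and m
    have "(\<Sum>(a, b)\<in>splits m. (if a = 0 then 1 else 0) * f b) =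
          (\<Sum>(a, b)\<in>{(0 :: mono, m)}. (if a = 0 then 1 else 0) * f b)"
      by (rule sum.mono_neutral_right)
         (use finite_splits[of m] in \<open>auto simp: splits_def split: if_splits\<close>)
    then show "(\<Sum>(a, b)\<in>splits m. (if a = 0 then 1 else 0) * f b) = f m" by simp
  qed
  show "f * g * h = f * (g * h)"
  proof (transfer, rule ext)
    fix f g h :: "mono \<Rightarrow> 'a" and m
    have "(\<Sum>(a, b)\<in>splits m. (\<Sum>(a, b)\<in>splits a. f a * g b) * h b) =
          (\<Sum>(x, y)\<in>(SIGMA x:splits m. splits (fst x)). f (fst y) * g (snd y) * h (snd x))"
      by (simp add: case_prod_unfold sum_distrib_right sum.Sigma)
    also have "\<dots> = (\<Sum>(x, y)\<in>(SIGMA x:splits m. splits (snd x)). f (fst x) * (g (fst y) * h (snd y)))"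
      by (rule sum.reindex_bij_witness[where
            i = "\<lambda>((a, r), (b, c)). ((a + b, c), (a, b))" and
            j = "\<lambda>((r, c), (a, b)). ((a, b + c), (b, c))"])
         (auto simp: splits_def ac_simps)
    also have "\<dots> = (\<Sum>(a, b)\<in>splits m. f a * (\<Sum>(a, b)\<in>splits b. g a * h b))"
      by (simp add: case_prod_unfold sum_distrib_left sum.Sigma)
    finally show "(\<Sum>(a, b)\<in>splits m. (\<Sum>(a, b)\<in>splits a. f a * g b) * h b) =
        (\<Sum>(a, b)\<in>splits m. f a * (\<Sum>(a, b)\<in>splits b. g a * h b))" .
  qed
qed

end

lift_definition scale_sf :: "'a::comm_ring_1 \<Rightarrow> 'a symfun \<Rightarrow> 'a symfun" (infixr "\<odot>" 75)
  is "\<lambda>c f a. c * f a"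
  unfolding is_symmetric_function_def by (metis mult_zero_right)

lift_definition h_sym :: "nat \<Rightarrow> 'a::comm_ring_1 symfun"
  is "\<lambda>n a. if mdeg a = n then 1 else 0"
  unfolding is_symmetric_function_def by (metis mdeg_map_key order_refl)

lift_definition e_sym :: "nat \<Rightarrow> 'a::comm_ring_1 symfun"
  is "\<lambda>n a. if mdeg a = n \<and> (\<forall>i. Poly_Mapping.lookup a i \<le> 1) then 1 else 0"
proof -
  fix n
  have "(\<forall>i. Poly_Mapping.lookup (Poly_Mapping.map_key \<pi> a) i \<le> 1) \<longleftrightarrow>
      (\<forall>i. Poly_Mapping.lookup a i \<le> 1)" if "bij \<pi>" for \<pi> and a :: mono
    unfolding lookup_map_key_bij[OF that] using bij_is_surj[OF that] by (metis surjD)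
  then show "is_symmetric_function
      (\<lambda>a. if mdeg a = n \<and> (\<forall>i. Poly_Mapping.lookup a i \<le> 1) then 1 else (0 :: 'a))"
    unfolding is_symmetric_function_def by (auto simp: mdeg_map_key)
qed

lemma h_sym_0 [simp]: "h_sym 0 = 1"
  by transfer auto

lemma e_sym_0 [simp]: "e_sym 0 = 1"
  by transfer (auto simp: fun_eq_iff)

text \<open>
  A partition is given as the list of its parts; the order of the parts does not matter,
  and neither do zero parts, since \<open>h\<^sub>0 = e\<^sub>0 = 1\<close>.
\<close>

definition h_part :: "nat list \<Rightarrow> 'a::comm_ring_1 symfun" where
  "h_part \<mu> = prod_list (map h_sym \<mu>)"

definition e_part :: "nat list \<Rightarrow> 'a::comm_ring_1 symfun" where
  "e_part \<mu> = prod_list (map e_sym \<mu>)"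

definition is_omega_involution :: "('a::comm_ring_1 symfun \<Rightarrow> 'a symfun) \<Rightarrow> bool" where
  "is_omega_involution \<phi> \<longleftrightarrow>
     \<phi> 1 = 1 \<and>
     (\<forall>f g. \<phi> (f + g) = \<phi> f + \<phi> g) \<and>
     (\<forall>f g. \<phi> (f * g) = \<phi> f * \<phi> g) \<and>
     (\<forall>c f. \<phi> (c \<odot> f) = c \<odot> \<phi> f) \<and>
     (\<forall>f. \<phi> (\<phi> f) = f) \<and>
     (\<forall>\<mu>. \<phi> (h_part \<mu>) = e_part \<mu>)"

text \<open>
  Existence and uniqueness of \<open>\<omega>\<close> is the fundamental theorem on symmetric functions:
  the \<open>h\<^sub>\<mu>\<close>, and likewise the \<open>e\<^sub>\<mu>\<close>, form a basis of the ring.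
\<close>

definition omega :: "'a::comm_ring_1 symfun \<Rightarrow> 'a symfun" where
  "omega = (THE \<phi>. is_omega_involution \<phi>)"


section \<open>Coefficients in the field of rational functions, and the elements \<open>\<rho>\<^sub>n\<close>\<close>

type_synonym ratfun = "rat poly fract"
type_synonym Lam = "ratfun symfun"

definition q :: ratfun where
  "q = Fraction_Field.Fract [:0, 1:] 1"

definition qint :: "nat \<Rightarrow> ratfun" where
  "qint n = (\<Sum>i<n. q ^ i)"

text \<open>The defining recurrence, solved for \<open>\<rho>\<^sub>n\<close>; see \<open>rho_recurrence\<close> below.\<close>

fun rho :: "nat \<Rightarrow> Lam" where
  "rho n = (if n = 0 then 1 else qint n \<odot> h_sym n - (\<Sum>i\<in>{1..<n}. h_sym (n - i) * rho i))"

declare rho.simps [simp del]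

lemma rho_0 [simp]: "rho 0 = 1"
  by (simp add: rho.simps)

lemma rho_recurrence:
  assumes "n \<ge> 1"
  shows "qint n \<odot> h_sym n = (\<Sum>i=1..n. h_sym (n - i) * rho i)"
proof -
  have "{1..n} = insert n {1..<n}" using assms by auto
  then have "(\<Sum>i=1..n. h_sym (n - i) * rho i) = rho n + (\<Sum>i\<in>{1..<n}. h_sym (n - i) * rho i)"
    by simp
  then show ?thesis using assms by (simp add: rho.simps[of n])
qed

definition rho_part :: "nat list \<Rightarrow> Lam" where
  "rho_part \<mu> = prod_list (map rho \<mu>)"


section \<open>Hessenberg functions and the restricted modular law\<close>

definition hessenberg :: "nat \<Rightarrow> (nat \<Rightarrow> nat) set" where
  "hessenberg n = {m \<in> {1..n} \<rightarrow>\<^sub>E {1..n}. mono_on {1..n} m \<and> (\<forall>i\<in>{1..n}. i \<le> m i)}"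

definition modular_triple_I ::
    "nat \<Rightarrow> (nat \<Rightarrow> nat) \<Rightarrow> (nat \<Rightarrow> nat) \<Rightarrow> (nat \<Rightarrow> nat) \<Rightarrow> bool" where
  "modular_triple_I n m m' m'' \<longleftrightarrow>
     m \<in> hessenberg n \<and> m' \<in> hessenberg n \<and> m'' \<in> hessenberg n \<and>
     (\<exists>i\<in>{1..<n}.
        m i + 1 = m' i \<and> m'' i = m' i + 1 \<and>
        (if i = 1 then 0 else m' (i - 1)) < m' i \<and> m' i < m' (i + 1) \<and>
        (\<forall>j\<in>{1..n} - {i}. m j = m' j \<and> m' j = m'' j) \<and>
        m' (m' i) = m' (m' i + 1))"

definition restricted_modular_triple_II ::
    "nat \<Rightarrow> (nat \<Rightarrow> nat) \<Rightarrow> (nat \<Rightarrow> nat) \<Rightarrow> (nat \<Rightarrow> nat) \<Rightarrow> bool" where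
  "restricted_modular_triple_II n m m' m'' \<longleftrightarrow>
     m \<in> hessenberg n \<and> m' \<in> hessenberg n \<and> m'' \<in> hessenberg n \<and>
     (\<exists>i\<in>{1..<n}. i \<noteq> 1 \<and>
        m' i + 1 = m' (i + 1) \<and>
        m i = m' i \<and> m'' i = m' i + 1 \<and>
        m (i + 1) + 1 = m' (i + 1) \<and> m' (i + 1) = m'' (i + 1) \<and>
        (\<forall>j\<in>{1..n} - {i, i + 1}. m j = m' j \<and> m' j = m'' j) \<and>
        {j\<in>{1..n}. m' j = i} = {})"

text \<open>
  A function on the disjoint union of the sets of Hessenberg functions of all lengths
  \<open>n \<ge> 1\<close> takes the length \<open>n\<close> as an explicit first argument.
\<close>

definition restricted_modular_law :: "(nat \<Rightarrow> (nat \<Rightarrow> nat) \<Rightarrow> Lam) \<Rightarrow> bool" where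
  "restricted_modular_law f \<longleftrightarrow>
     (\<forall>n\<ge>1. \<forall>m m' m''.
        modular_triple_I n m m' m'' \<or> restricted_modular_triple_II n m m' m'' \<longrightarrow>
        (1 + q) \<odot> f n m' = q \<odot> f n m + f n m'')"


section \<open>The symmetric functions \<open>g\<close> and \<open>G\<close>\<close>

definition hess_perms :: "nat \<Rightarrow> (nat \<Rightarrow> nat) \<Rightarrow> (nat \<Rightarrow> nat) set" where
  "hess_perms n m = {\<sigma>. \<sigma> permutes {1..n} \<and> (\<forall>i\<in>{1..n}. \<sigma> i \<le> m i)}"

text \<open>
  \<^term>\<open>support \<sigma> i\<close> is the cycle \<open>[i, \<sigma> i, \<sigma> (\<sigma> i), \<dots>]\<close> written from \<open>i\<close>; one
  such list is taken for each \<open>i\<close> that is minimal in its cycle, in increasing order of \<open>i\<close>.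
\<close>

definition cycles_of :: "nat \<Rightarrow> (nat \<Rightarrow> nat) \<Rightarrow> nat list list" where
  "cycles_of n \<sigma> = map (support \<sigma>) (filter (\<lambda>i. \<forall>j\<in>set (support \<sigma> i). i \<le> j) [1..<n + 1])"

definition cycle_word :: "nat \<Rightarrow> (nat \<Rightarrow> nat) \<Rightarrow> nat list" where
  "cycle_word n \<sigma> = concat (cycles_of n \<sigma>)"

definition precedes_in :: "'a \<Rightarrow> 'a \<Rightarrow> 'a list \<Rightarrow> bool" where
  "precedes_in x y w \<longleftrightarrow> (\<exists>a b. a < b \<and> b < length w \<and> w ! a = x \<and> w ! b = y)"

definition wt :: "nat \<Rightarrow> (nat \<Rightarrow> nat) \<Rightarrow> (nat \<Rightarrow> nat) \<Rightarrow> nat" where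
  "wt n m \<sigma> = card {(i, j). i \<in> {1..n} \<and> j \<in> {1..n} \<and> i < j \<and> j \<le> m i \<and>
                            precedes_in j i (cycle_word n \<sigma>)}"

definition first_cycle_length :: "nat \<Rightarrow> (nat \<Rightarrow> nat) \<Rightarrow> nat" where
  "first_cycle_length n \<sigma> = length (hd (cycles_of n \<sigma>))"

text \<open>
  The exponent and index \<open>|\<tau>\<^sub>1| - n + k\<close> is written \<open>|\<tau>\<^sub>1| + k - n\<close>, so that natural-number
  subtraction does not truncate in the range of summation.
\<close>

definition g_fun :: "nat \<Rightarrow> nat \<Rightarrow> (nat \<Rightarrow> nat) \<Rightarrow> Lam" where
  "g_fun k n m =
     (if k < n then
        (\<Sum>\<sigma> | \<sigma> \<in> hess_perms n m \<and> first_cycle_length n \<sigma> \<ge> n - k.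
           ((-1) ^ (first_cycle_length n \<sigma> + k - n) * q ^ wt n m \<sigma>) \<odot>
             (h_sym (first_cycle_length n \<sigma> + k - n) *
              omega (rho_part (map length (tl (cycles_of n \<sigma>))))))
      else 0)"

text \<open>Only the values for \<open>k \<ge> 1\<close> are meaningful.\<close>

definition G_fun :: "nat \<Rightarrow> nat \<Rightarrow> (nat \<Rightarrow> nat) \<Rightarrow> Lam" where
  "G_fun k n m = (if 1 \<le> k \<and> k \<le> n then e_sym k * g_fun (n - k) n m else 0)"

end

theory Submission
  imports Defs "HOL-Library.Multiset"
begin

text \<open>
  Both laws are linear relations, and \<open>G\<close> is \<open>g\<close> times a factor that does not depend on \<open>m\<close>, so it
  suffices to compare the coefficients of one monomial in \<open>g\<close>. Such a coefficient is a scalar sum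
  \<open>\<Sum>\<sigma>. q ^ wt n m \<sigma> * \<Phi> (cycle lengths of \<sigma>)\<close>, and since \<open>\<rho>\<close> of a partition is a product, \<open>\<Phi>\<close> does
  not change when the lengths of the cycles other than the first are permuted. The law holds for
  every such \<open>\<Phi>\<close> (\<open>cycle_sums_modular\<close>).

  Permutations are built by inserting the letters \<open>1, 2, \<dots>, n\<close>: the letter \<open>h\<close> is put behind a
  smaller letter \<open>x\<close> with \<open>h \<le> m x\<close>, a neighbour of \<open>h\<close>, or it opens a new cycle at the end. The
  weight grows by the number of neighbours to the right of \<open>h\<close>. Only the cycle of each letter,
  called its colour, matters for \<open>\<Phi>\<close>, and summing over the places inside one cycle gives \<open>q\<close> to the
  number of neighbours in later cycles times the \<open>q\<close>-number of the neighbours in this cycle. The sum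
  thus becomes a sum over colour sequences of products of step weights
  (\<open>sum_hess_perms_colourings\<close>).

  In a triple of the first type the step weights of the three functions differ at the two letters
  \<open>a\<close> and \<open>a + 1\<close> with \<open>a = m' i\<close>, and everything after them is symmetric in their two colours.
  Adding the contributions of a pair of colours in both orders gives zero (\<open>type_I\<close>).

  In a triple of the second type the weights differ at the letter \<open>a + 1\<close>. Exchanging the colours of
  \<open>i\<close> and \<open>i + 1\<close> multiplies the defect of the law by \<open>- q\<close> or its inverse, which cancels all terms
  (\<open>reduce_to_new_pair\<close>) except the one where \<open>i\<close> and \<open>i + 1\<close> open two consecutive new cycles. As
  \<open>i \<noteq> 1\<close>, neither of them is the first cycle, so \<open>\<Phi>\<close> is symmetric in their lengths. For fixed
  colours of all letters outside these two cycles, the defect is a sum over the ways to split a set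
  \<open>S\<close> of letters into \<open>U\<close> and \<open>V\<close> with a weight \<open>split_wt U V\<close>, and the claim is that the generating
  function \<open>\<Sum> split_wt U V * s ^ card U * t ^ card V\<close> is antisymmetric in \<open>s\<close> and \<open>t\<close>.

  This is shown in an associative convolution algebra of set functions on the interval graph of the
  neighbour relation. The generating function \<open>stab t\<close> of the stable sets is inverse to the function
  \<open>wrd t\<close>, a product of \<open>q\<close>-numbers, and \<open>stab s\<close> commutes with \<open>stab t\<close>, as the two-colour case of
  the symmetry of chromatic quasisymmetric functions. Hence \<open>wrd s\<close> and \<open>wrd t\<close> commute. The
  generating function above can be written with these functions as
  \<open>(tau t \<star> kap s - tau s \<star> kap t) \<star> free s \<star> free t\<close>, whose last two factors commute, so that it is
  antisymmetric (\<open>swap_defect_antisym\<close>). The passage to this form is \<open>key_identity\<close>; both of its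
  sides satisfy recursions along the vertices above the root, and the identity holds because of a
  system of relations between these recursions (\<open>relations_hold\<close>).
\<close>

section \<open>The convolution algebra of an interval graph\<close>

text \<open>
  The ring is arbitrary because these numbers are also needed over polynomials in an auxiliary
  variable that marks the sizes of sets.
\<close>

definition qnum :: "'a::comm_ring_1 \<Rightarrow> nat \<Rightarrow> 'a" where
  "qnum z n = (\<Sum>i<n. z ^ i)"

lemma qnum_0 [simp]: "qnum z 0 = 0"
  by (simp add: qnum_def)

lemma qnum_Suc: "qnum z (Suc n) = qnum z n + z ^ n"
  by (simp add: qnum_def)

lemma qnum_Suc': "qnum z (Suc n) = 1 + z * qnum z n"
  by (simp add: qnum_def sum.lessThan_Suc_shift sum_distrib_left del: sum.lessThan_Suc)

lemma qnum_1 [simp]: "qnum z (Suc 0) = 1"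
  by (simp add: qnum_Suc)


text \<open>
  The graph on the natural numbers in which \<open>x < h\<close> are adjacent if \<open>h \<le> m x\<close>. As \<open>m\<close> is increasing,
  the neighbours below \<open>h\<close> are the vertices of an interval and form a clique.
\<close>

locale interval_graph =
  fixes m :: "nat \<Rightarrow> nat" and q :: "'a::comm_ring_1"
  assumes mono_m: "x \<le> y \<Longrightarrow> m x \<le> m y"
begin

definition nb :: "nat set \<Rightarrow> nat \<Rightarrow> nat set" where
  "nb A h = {x\<in>A. x < h \<and> h \<le> m x}"

lemma finite_nb [simp]: "finite (nb A h)"
  by (rule finite_subset[of _ "{..<h}"]) (auto simp: nb_def)

lemma nb_subset: "nb A h \<subseteq> A" by (auto simp: nb_def)

lemma nb_empty [simp]: "nb {} h = {}" by (simp add: nb_def)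

lemma nb_Un: "nb (A \<union> B) h = nb A h \<union> nb B h" by (auto simp: nb_def)

lemma card_nb_Un: "A \<inter> B = {} \<Longrightarrow> card (nb (A \<union> B) h) = card (nb A h) + card (nb B h)"
  unfolding nb_Un by (rule card_Un_disjoint) (auto simp: nb_def)

lemma nb_insert_ge: "h \<le> x \<Longrightarrow> nb (insert x A) h = nb A h"
  by (auto simp: nb_def)

text \<open>
  This is \<open>q\<close> to the number of edges from a vertex in \<open>V\<close> up to a vertex in \<open>U\<close>. If the vertices of
  \<open>U\<close> get the first colour and those of \<open>V\<close> the second, these are the edges on which the colour
  descends.
\<close>

definition cross :: "nat set \<Rightarrow> nat set \<Rightarrow> 'a" where
  "cross U V = (\<Prod>h\<in>U. q ^ card (nb V h))"

definition conv :: "(nat set \<Rightarrow> 'a) \<Rightarrow> (nat set \<Rightarrow> 'a) \<Rightarrow> nat set \<Rightarrow> 'a" (infixr "\<star>" 70) where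
  "(f \<star> g) S = (\<Sum>U\<in>Pow S. cross U (S - U) * f U * g (S - U))"

definition unit_fun :: "nat set \<Rightarrow> 'a" where
  "unit_fun S = (if S = {} then 1 else 0)"

lemma cross_empty [simp]: "cross {} V = 1" "cross U {} = 1"
  by (simp_all add: cross_def nb_def)

lemma cross_Un_left:
  "finite U \<Longrightarrow> finite V \<Longrightarrow> U \<inter> V = {} \<Longrightarrow> cross (U \<union> V) W = cross U W * cross V W"
  unfolding cross_def by (rule prod.union_disjoint)

lemma cross_Un_right: "V \<inter> W = {} \<Longrightarrow> cross U (V \<union> W) = cross U V * cross U W"
  by (simp add: cross_def card_nb_Un power_add prod.distrib)

lemma conv_infinite: "infinite S \<Longrightarrow> (f \<star> g) S = 0"
  by (simp add: conv_def)

text \<open>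
  Both sides are sums over ordered partitions of \<open>S\<close> into three parts, and the edges counted are
  those between any two of the parts on which the colour descends.
\<close>

lemma conv_assoc: "(f \<star> g) \<star> k = f \<star> (g \<star> k)"
proof
  fix S
  show "((f \<star> g) \<star> k) S = (f \<star> (g \<star> k)) S"
  proof (cases "finite S")
    case True
    have finP: "\<forall>X\<in>Pow S. finite (Pow X)"
      using True by (auto intro: finite_subset)
    have "((f \<star> g) \<star> k) S =
      (\<Sum>(X, U)\<in>(SIGMA X:Pow S. Pow X).
         cross X (S - X) * (cross U (X - U) * f U * g (X - U)) * k (S - X))"
      using True finP unfolding conv_def
      by (subst sum.Sigma[symmetric]) (simp_all add: sum_distrib_left sum_distrib_right)
    also have "\<dots> = (\<Sum>(U, V)\<in>(SIGMA U:Pow S. Pow (S - U)).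
         cross U (S - U) * f U * (cross V (S - U - V) * g V * k (S - U - V)))"
    proof (rule sum.reindex_bij_witness[where
          i = "\<lambda>(U, V). (U \<union> V, U)" and j = "\<lambda>(X, U). (U, X - U)"])
      fix p assume "p \<in> (SIGMA X:Pow S. Pow X)"
      then obtain X U where p: "p = (X, U)" "X \<subseteq> S" "U \<subseteq> X" by auto
      have fin: "finite X" "finite U"
        using finite_subset[OF p(2) True] finite_subset[OF p(3)] by simp_all
      have eq: "S - U - (X - U) = S - X" "S - U = (X - U) \<union> (S - X)" "X = U \<union> (X - U)"
        using p by auto
      have c1: "cross U (S - U) = cross U (X - U) * cross U (S - X)"
        by (subst eq(2), rule cross_Un_right) auto
      have c2: "cross X (S - X) = cross U (S - X) * cross (X - U) (S - X)"
        by (subst (1) eq(3), rule cross_Un_left) (use fin in auto)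
      show "(case case p of (X, U) \<Rightarrow> (U, X - U) of (U, V) \<Rightarrow>
             cross U (S - U) * f U * (cross V (S - U - V) * g V * k (S - U - V))) =
         (case p of (X, U) \<Rightarrow> cross X (S - X) * (cross U (X - U) * f U * g (X - U)) * k (S - X))"
        by (simp add: p(1) eq(1) c1 c2 mult_ac)
    qed (auto simp: Un_absorb1)
    also have "\<dots> = (f \<star> (g \<star> k)) S"
      using True unfolding conv_def
      by (subst sum.Sigma[symmetric]) (simp_all add: sum_distrib_left)
    finally show ?thesis .
  qed (simp add: conv_infinite)
qed

lemma conv_unit_left:
  assumes "\<And>S. infinite S \<Longrightarrow> f S = 0"
  shows "unit_fun \<star> f = f"
proof
  fix S
  show "(unit_fun \<star> f) S = f S"
  proof (cases "finite S")
    case True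
    have "(unit_fun \<star> f) S = (\<Sum>U\<in>{{}}. cross U (S - U) * unit_fun U * f (S - U))"
      unfolding conv_def
      by (rule sum.mono_neutral_right) (use True in \<open>auto simp: unit_fun_def\<close>)
    then show ?thesis by (simp add: unit_fun_def)
  qed (simp add: assms conv_infinite)
qed

lemma conv_unit_right:
  assumes "\<And>S. infinite S \<Longrightarrow> f S = 0"
  shows "f \<star> unit_fun = f"
proof
  fix S
  show "(f \<star> unit_fun) S = f S"
  proof (cases "finite S")
    case True
    have "(f \<star> unit_fun) S = (\<Sum>U\<in>{S}. cross U (S - U) * f U * unit_fun (S - U))"
      unfolding conv_def
      by (rule sum.mono_neutral_right) (use True in \<open>auto simp: unit_fun_def\<close>)
    then show ?thesis by (simp add: unit_fun_def)
  qed (simp add: assms conv_infinite)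
qed

lemma conv_add_left: "(\<lambda>S. f S + g S) \<star> k = (\<lambda>S. (f \<star> k) S + (g \<star> k) S)"
  by (rule ext) (simp add: conv_def algebra_simps sum.distrib)

lemma conv_diff_left: "(\<lambda>S. f S - g S) \<star> k = (\<lambda>S. (f \<star> k) S - (g \<star> k) S)"
  by (rule ext) (simp add: conv_def algebra_simps sum_subtractf)

lemma conv_uminus_left: "(\<lambda>S. - f S) \<star> k = (\<lambda>S. - (f \<star> k) S)"
  by (rule ext) (simp add: conv_def sum_negf)

lemma conv_uminus_right: "f \<star> (\<lambda>S. - g S) = (\<lambda>S. - (f \<star> g) S)"
  by (rule ext) (simp add: conv_def sum_negf)

lemma sum_Pow_insert:
  assumes "finite S" "h \<notin> S"
  shows "(\<Sum>U\<in>Pow (insert h S). F U) = (\<Sum>U\<in>Pow S. F (insert h U) + F U)"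
proof -
  have inj: "inj_on (insert h) (Pow S)" using assms(2) by (auto simp: inj_on_def)
  have "(\<Sum>U\<in>Pow (insert h S). F U) = sum F (Pow S) + sum F (insert h ` Pow S)"
    unfolding Pow_insert by (rule sum.union_disjoint) (use assms in auto)
  also have "sum F (insert h ` Pow S) = (\<Sum>U\<in>Pow S. F (insert h U))"
    by (simp add: sum.reindex[OF inj])
  finally show ?thesis by (simp add: sum.distrib add.commute)
qed

lemma cross_insert_left:
  "finite U \<Longrightarrow> h \<notin> U \<Longrightarrow> cross (insert h U) V = q ^ card (nb V h) * cross U V"
  by (simp add: cross_def)

lemma cross_insert_right:
  "(\<forall>x\<in>U. x < h) \<Longrightarrow> cross U (insert h V) = cross U V"
  unfolding cross_def by (rule prod.cong) (auto simp: nb_insert_ge less_imp_le)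

lemma conv_insert_max:
  assumes fin: "finite S" and h: "\<forall>x\<in>S. x < h"
  shows "(f \<star> g) (insert h S) =
    (\<Sum>U\<in>Pow S. cross U (S - U) *
       (q ^ card (nb (S - U) h) * f (insert h U) * g (S - U) + f U * g (insert h (S - U))))"
proof -
  have hS: "h \<notin> S" using h by blast
  show ?thesis
    unfolding conv_def sum_Pow_insert[OF fin hS]
  proof (rule sum.cong[OF refl], goal_cases)
    case (1 U)
    then have U: "U \<subseteq> S" "h \<notin> U" "finite U" using hS fin finite_subset by auto
    have "insert h S - insert h U = S - U" "insert h S - U = insert h (S - U)"
      using U hS by auto
    moreover have "cross U (insert h (S - U)) = cross U (S - U)"
      by (rule cross_insert_right) (use U h in auto)
    ultimately show ?case
      using U by (simp add: cross_insert_left algebra_simps)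
  qed
qed

text \<open>
  Many products are computed one vertex at a time: if adding a largest vertex \<open>h\<close> to either part
  multiplies every summand by a factor that is the same for all splittings, then it multiplies the
  whole product by this factor.
\<close>

lemma conv_rec:
  assumes "finite S" "\<forall>x\<in>S. x < h"
    and "\<And>U V. U \<inter> V = {} \<Longrightarrow> U \<union> V = S \<Longrightarrow>
      q ^ card (nb V h) * f (insert h U) * g V + f U * g (insert h V) = c * (f U * g V)"
  shows "(f \<star> g) (insert h S) = c * (f \<star> g) S"
proof -
  have "q ^ card (nb (S - U) h) * f (insert h U) * g (S - U) + f U * g (insert h (S - U))
      = c * (f U * g (S - U))" if "U \<in> Pow S" for U
    by (rule assms(3)) (use that in auto)
  then show ?thesis
    unfolding conv_insert_max[OF assms(1,2)] unfolding conv_def[of f g S] sum_distrib_left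
    by (intro sum.cong refl) (simp add: mult_ac)
qed

definition prodw :: "(nat \<Rightarrow> nat \<Rightarrow> 'a) \<Rightarrow> nat set \<Rightarrow> 'a" where
  "prodw \<psi> U = (if finite U then \<Prod>h\<in>U. \<psi> h (card (nb U h)) else 0)"

lemma prodw_infinite: "infinite S \<Longrightarrow> prodw \<psi> S = 0"
  by (simp add: prodw_def)

lemma prodw_empty [simp]: "prodw \<psi> {} = 1"
  by (simp add: prodw_def)

lemma prodw_insert_max:
  assumes "finite U" "\<forall>x\<in>U. x < h"
  shows "prodw \<psi> (insert h U) = prodw \<psi> U * \<psi> h (card (nb U h))"
proof -
  have "h \<notin> U" using assms(2) by blast
  moreover have "(\<Prod>x\<in>U. \<psi> x (card (nb (insert h U) x))) = (\<Prod>x\<in>U. \<psi> x (card (nb U x)))"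
    by (rule prod.cong) (use assms(2) in \<open>auto simp: nb_insert_ge less_imp_le\<close>)
  ultimately show ?thesis using assms(1) by (simp add: prodw_def nb_insert_ge mult.commute)
qed

text \<open>
  Up to signs, \<open>stab G t\<close> is the generating function of the stable subsets of \<open>G\<close> by size. In
  \<open>wrd G t\<close> every vertex is weighted like a letter that is inserted behind one of its neighbours or
  at one extra position. In the convolution algebra the two play the parts of
  \<open>\<Sum> (- t) ^ k * e\<^sub>k\<close> and \<open>\<Sum> t ^ k * h\<^sub>k\<close>.
\<close>

definition stab :: "nat set \<Rightarrow> 'a \<Rightarrow> nat set \<Rightarrow> 'a" where
  "stab G t = prodw (\<lambda>h k. if h \<in> G \<and> k = 0 then - t else 0)"

definition wrd :: "nat set \<Rightarrow> 'a \<Rightarrow> nat set \<Rightarrow> 'a" where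
  "wrd G t = prodw (\<lambda>h k. if h \<in> G then t * qnum q (Suc k) else 0)"

lemma stab_insert_max:
  assumes "finite U" "\<forall>x\<in>U. x < h"
  shows "stab G t (insert h U) = (if h \<in> G \<and> nb U h = {} then - t * stab G t U else 0)"
  using prodw_insert_max[OF assms] by (auto simp: stab_def)

lemma wrd_insert_max:
  assumes "finite U" "\<forall>x\<in>U. x < h"
  shows "wrd G t (insert h U) = (if h \<in> G then t * qnum q (Suc (card (nb U h))) * wrd G t U else 0)"
  using prodw_insert_max[OF assms] by (auto simp: wrd_def mult_ac)

lemma stab_nonzeroD:
  assumes "stab G t U \<noteq> 0"
  shows "finite U" "U \<subseteq> G" "h \<in> U \<Longrightarrow> nb U h = {}"
proof -
  show fin: "finite U" using assms prodw_infinite[of U] by (auto simp: stab_def)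
  have *: "h \<in> G \<and> nb U h = {}" if "h \<in> U" for h
  proof (rule ccontr)
    assume "\<not> ?thesis"
    then have "(\<Prod>h\<in>U. if h \<in> G \<and> card (nb U h) = 0 then - t else 0) = 0"
      by (intro prod_zero fin bexI[OF _ that]) auto
    with assms fin show False by (simp add: stab_def prodw_def)
  qed
  show "U \<subseteq> G" using * by auto
  show "h \<in> U \<Longrightarrow> nb U h = {}" using * by auto
qed

lemma clique_nb:
  assumes "x \<in> nb A h" "y \<in> nb A h" "x < y"
  shows "x \<in> nb A y"
  using assms by (auto simp: nb_def)

text \<open>
  The neighbours below a vertex form a clique, and a stable set meets a clique in at most one
  vertex.
\<close>

lemma stab_card_nb_le_1:
  assumes "stab G t U \<noteq> 0"
  shows "card (nb U h) \<le> 1"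
proof (rule ccontr)
  assume "\<not> card (nb U h) \<le> 1"
  then obtain x y where xy: "x \<in> nb U h" "y \<in> nb U h" "x \<noteq> y"
    using card_le_Suc0_iff_eq[OF finite_nb[of U h]] by auto
  have F: False if "x \<in> nb U h" "y \<in> nb U h" "x < y" for x y
    using clique_nb[OF that] stab_nonzeroD(3)[OF assms, of y] that nb_subset by blast
  show False using F[of x y] F[of y x] xy by (cases "x < y") auto
qed

text \<open>
  The first vertex has no smaller neighbour, so a factor that vanishes without neighbours
  annihilates everything but the empty set.
\<close>

lemma zero_of_max_recursion:
  fixes F :: "nat set \<Rightarrow> 'a"
  assumes rec: "\<And>S h. finite S \<Longrightarrow> \<forall>x\<in>S. x < h \<Longrightarrow> F (insert h S) = c h (card (nb S h)) * F S"
    and c: "\<And>h. c h 0 = 0" and fin: "finite S" and ne: "S \<noteq> {}"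
  shows "F S = 0"
  using fin ne
proof (induction S rule: finite_linorder_max_induct)
  case (insert h S)
  show ?case
  proof (cases "S = {}")
    case True
    then show ?thesis using rec[of S h] c by (simp add: nb_def)
  next
    case False
    then show ?thesis using rec[of S h] insert by simp
  qed
qed simp

text \<open>
  For a new largest vertex \<open>h\<close>, the stable part contains at most one neighbour of \<open>h\<close>. If it
  contains none, \<open>h\<close> may join either part, otherwise it joins the other part; in both cases the
  factors combine to \<open>t * qnum q (card (nb S h))\<close>, which vanishes for the first vertex.
\<close>

lemma stab_conv_wrd: "stab G t \<star> wrd G t = unit_fun"
proof
  fix S
  have rec: "(stab G t \<star> wrd G t) (insert h S) =
      (if h \<in> G then t * qnum q (card (nb S h)) else 0) * (stab G t \<star> wrd G t) S"
    if S: "finite S" "\<forall>x\<in>S. x < h" for S h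
  proof (rule conv_rec[OF S], goal_cases)
    case (1 U V)
    then have U: "finite U" "finite V"
      "\<forall>x\<in>U. x < h" "\<forall>x\<in>V. x < h"
      using S by auto
    show ?case
    proof (cases "stab G t U = 0")
      case True
      then show ?thesis
        by (simp add: stab_insert_max[OF U(1,3)])
    next
      case False
      have c: "card (nb S h) = card (nb U h) + card (nb V h)"
        using card_nb_Un[of U V h] 1 by auto
      have "card (nb U h) = 0 \<or> card (nb U h) = Suc 0"
        using stab_card_nb_le_1[OF False, of h] by linarith
      then show ?thesis
        unfolding c stab_insert_max[OF U(1,3)] wrd_insert_max[OF U(2,4)]
        by (auto simp: qnum_Suc algebra_simps)
    qed
  qed
  show "(stab G t \<star> wrd G t) S = unit_fun S"
  proof (cases "finite S \<and> S \<noteq> {}")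
    case True
    then have "(stab G t \<star> wrd G t) S = 0"
      using zero_of_max_recursion[of "stab G t \<star> wrd G t" "\<lambda>h k. if h \<in> G then t * qnum q k else 0" S]
        rec by auto
    then show ?thesis using True by (simp add: unit_fun_def)
  next
    case False
    then show ?thesis
      by (auto simp: unit_fun_def conv_infinite) (simp add: conv_def stab_def wrd_def)
  qed
qed

lemma wrd_conv_stab: "wrd G t \<star> stab G t = unit_fun"
proof
  fix S
  have rec: "(wrd G t \<star> stab G t) (insert h S) =
      (if h \<in> G then t * q * qnum q (card (nb S h)) else 0) * (wrd G t \<star> stab G t) S"
    if S: "finite S" "\<forall>x\<in>S. x < h" for S h
  proof (rule conv_rec[OF S], goal_cases)
    case (1 U V)
    then have U: "finite U" "finite V"
      "\<forall>x\<in>U. x < h" "\<forall>x\<in>V. x < h"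
      using S by auto
    show ?case
    proof (cases "stab G t V = 0")
      case True
      then show ?thesis
        by (simp add: stab_insert_max[OF U(2,4)])
    next
      case False
      have c: "card (nb S h) = card (nb U h) + card (nb V h)"
        using card_nb_Un[of U V h] 1 by auto
      have "card (nb V h) = 0 \<or> card (nb V h) = Suc 0"
        using stab_card_nb_le_1[OF False, of h] by linarith
      then show ?thesis
        unfolding c stab_insert_max[OF U(2,4)] wrd_insert_max[OF U(1,3)]
        by (auto simp: qnum_Suc' algebra_simps)
    qed
  qed
  show "(wrd G t \<star> stab G t) S = unit_fun S"
  proof (cases "finite S \<and> S \<noteq> {}")
    case True
    then have "(wrd G t \<star> stab G t) S = 0"
      using zero_of_max_recursion[of "wrd G t \<star> stab G t" "\<lambda>h k. if h \<in> G then t * q * qnum q k else 0" S]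
        rec by auto
    then show ?thesis using True by (simp add: unit_fun_def)
  next
    case False
    then show ?thesis
      by (auto simp: unit_fun_def conv_infinite) (simp add: conv_def stab_def wrd_def)
  qed
qed

end

section \<open>The stable functions commute\<close>

context interval_graph
begin

text \<open>
  The graph induced on the union of two stable sets is a disjoint union of paths. The functions \<open>A\<close>
  and \<open>B\<close> stand for the parts of \<open>stab t \<star> stab u\<close> in which the largest vertex has the first or the
  second colour. The first alternative describes a last path with an odd number of vertices, where
  recolouring exchanges \<open>t\<close> and \<open>u\<close> in one place; the second one a last path with an even number,
  whose two colourings differ by one descent.
\<close>

definition balanced :: "('a \<Rightarrow> 'a \<Rightarrow> 'a) \<Rightarrow> ('a \<Rightarrow> 'a \<Rightarrow> 'a) \<Rightarrow> bool" where
  "balanced A B \<longleftrightarrow>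
     (\<forall>t u. u * A t u = t * B t u \<and> A t u = B u t) \<or>
     (\<forall>t u. A t u = q * B t u \<and> A t u = A u t \<and> B t u = B u t)"

lemma balanced_sum_sym: "balanced A B \<Longrightarrow> A t u + B t u = A u t + B u t"
  unfolding balanced_def by (metis add.commute)

lemma balanced_new: "(\<And>t u. C t u = C u t) \<Longrightarrow> balanced (\<lambda>t u. - t * C t u) (\<lambda>t u. - u * C t u)"
  unfolding balanced_def by (intro disjI1) (auto simp: mult_ac)

lemma balanced_step:
  assumes "balanced A B"
  shows "balanced (\<lambda>t u. - t * (q * B t u)) (\<lambda>t u. - u * A t u)"
  using assms unfolding balanced_def
proof (elim disjE, goal_cases)
  case 1
  then have 1: "u * A t u = t * B t u" "A t u = B u t" for t u by blast+
  have "- t * (q * B t u) = q * (- u * A t u)" for t u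
    using 1(1)[of u t] by (simp add: algebra_simps)
  moreover have "- t * (q * B t u) = - u * (q * B u t)" for t u
    using 1(1)[of u t] 1(2)[of t u] by (simp add: algebra_simps)
  moreover have "- u * A t u = - t * A u t" for t u
    using 1(1)[of u t] 1(2)[of u t] by (simp add: algebra_simps)
  ultimately show ?case by blast
next
  case 2
  then have 2: "A t u = q * B t u" "A t u = A u t" "B t u = B u t" for t u by blast+
  have "u * (- t * (q * B t u)) = t * (- u * A t u)" for t u
    by (simp add: 2(1) algebra_simps)
  moreover have "- t * (q * B t u) = - t * A u t" for t u
    using 2(1)[of t u] 2(2)[of t u] by (simp add: algebra_simps)
  ultimately show ?case by blast
qed

definition stab_left :: "nat \<Rightarrow> nat set \<Rightarrow> nat set \<Rightarrow> 'a \<Rightarrow> 'a \<Rightarrow> 'a" where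
  "stab_left l G S t u = ((\<lambda>U. of_bool (l \<in> U) * stab G t U) \<star> stab G u) S"

definition stab_right :: "nat \<Rightarrow> nat set \<Rightarrow> nat set \<Rightarrow> 'a \<Rightarrow> 'a \<Rightarrow> 'a" where
  "stab_right l G S t u = (stab G t \<star> (\<lambda>V. of_bool (l \<in> V) * stab G u V)) S"

lemma stab_conv_split:
  assumes "l \<in> S"
  shows "(stab G t \<star> stab G u) S = stab_left l G S t u + stab_right l G S t u"
  unfolding stab_left_def stab_right_def conv_def sum.distrib[symmetric]
  by (rule sum.cong) (use assms in auto)

lemma stab_left_insert_max:
  assumes S: "finite S" "\<forall>x\<in>S. x < h"
  shows "stab_left h G (insert h S) t u = (if h \<in> G then - t *
    (\<Sum>U\<in>Pow S. cross U (S - U) * (if nb U h = {} then q ^ card (nb S h) * (stab G t U * stab G u (S - U)) else 0)) else 0)"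
proof -
  have "h \<notin> S" using S by auto
  have "cross U (S - U) * (q ^ card (nb (S - U) h) * (of_bool (h \<in> insert h U) * stab G t (insert h U)) * stab G u (S - U) +
           of_bool (h \<in> U) * stab G t U * stab G u (insert h (S - U)))
     = (if h \<in> G then - t * (cross U (S - U) * (if nb U h = {} then q ^ card (nb S h) * (stab G t U * stab G u (S - U)) else 0)) else 0)"
    if "U \<in> Pow S" for U
  proof -
    have U: "finite U" "\<forall>x\<in>U. x < h" "h \<notin> U" using that S \<open>h \<notin> S\<close> finite_subset by auto
    have "nb (S - U) h = nb S h" if "nb U h = {}" using that by (auto simp: nb_def)
    then show ?thesis using U by (simp add: stab_insert_max mult_ac)
  qed
  then show ?thesis
    unfolding stab_left_def conv_insert_max[OF S]
    by (auto simp: sum_distrib_left intro!: sum.cong)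
qed

lemma stab_right_insert_max:
  assumes S: "finite S" "\<forall>x\<in>S. x < h"
  shows "stab_right h G (insert h S) t u = (if h \<in> G then - u *
    (\<Sum>U\<in>Pow S. cross U (S - U) * (if nb (S - U) h = {} then stab G t U * stab G u (S - U) else 0)) else 0)"
proof -
  have "h \<notin> S" using S by auto
  have "cross U (S - U) * (q ^ card (nb (S - U) h) * stab G t (insert h U) * (of_bool (h \<in> S - U) * stab G u (S - U)) +
           stab G t U * (of_bool (h \<in> insert h (S - U)) * stab G u (insert h (S - U))))
     = (if h \<in> G then - u * (cross U (S - U) * (if nb (S - U) h = {} then stab G t U * stab G u (S - U) else 0)) else 0)"
    if "U \<in> Pow S" for U
  proof -
    have U: "finite (S - U)" "\<forall>x\<in>S - U. x < h" "h \<notin> S - U" using that S \<open>h \<notin> S\<close> by auto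
    then show ?thesis using \<open>h \<notin> S\<close> by (simp add: stab_insert_max mult_ac)
  qed
  then show ?thesis
    unfolding stab_right_def conv_insert_max[OF S]
    by (auto simp: sum_distrib_left intro!: sum.cong)
qed

text \<open>
  By induction on the largest vertex \<open>h\<close>. Without smaller neighbours it starts a new path; with one
  neighbour, which is then the largest of the other vertices, it prolongs the last path; two
  neighbours form a triangle with \<open>h\<close>, which is not the union of two stable sets.
\<close>

lemma balanced_stab:
  assumes "finite S" "S \<noteq> {}"
  shows "balanced (stab_left (Max S) G S) (stab_right (Max S) G S)"
  using assms
proof (induction S rule: finite_linorder_max_induct)
  case empty
  then show ?case by simp
next
  case (insert h S)
  have S: "finite S" "\<forall>x\<in>S. x < h" using insert by auto
  have Max: "Max (insert h S) = h"
    using S by (intro Max_eqI) (auto intro: less_imp_le)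
  show ?case
  proof (cases "h \<in> G")
    case False
    then show ?thesis
      unfolding Max stab_left_insert_max[OF S, abs_def] stab_right_insert_max[OF S, abs_def]
      by (simp add: balanced_def)
  next
    case G: True
    consider (0) "nb S h = {}" | (1) l where "nb S h = {l}" | (2) "card (nb S h) \<ge> 2"
      by (metis One_nat_def Suc_1 card_0_eq card_1_singletonE finite_nb le_antisym not_less_eq_eq le0)
    then show ?thesis
    proof cases
      case 0
      have e: "nb U h = {}" if "U \<in> Pow S" for U using that 0 by (auto simp: nb_def)
      have "stab_left h G (insert h S) t u = - t * (stab G t \<star> stab G u) S"
        "stab_right h G (insert h S) t u = - u * (stab G t \<star> stab G u) S" for t u
        unfolding stab_left_insert_max[OF S] stab_right_insert_max[OF S]
        using G 0 e by (auto simp: conv_def mult_ac intro!: sum.cong)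
      moreover have "(stab G t \<star> stab G u) S = (stab G u \<star> stab G t) S" for t u
      proof (cases "S = {}")
        case True
        then show ?thesis by (simp add: conv_def mult_ac)
      next
        case False
        then have "Max S \<in> S" using S by simp
        then show ?thesis using insert.IH[OF False]
          by (simp add: stab_conv_split balanced_sum_sym)
      qed
      ultimately show ?thesis unfolding Max
        using balanced_new[of "\<lambda>t u. (stab G t \<star> stab G u) S"]
        by (simp only: balanced_def)
    next
      case (1 l)
      then have l: "l \<in> S" "l < h" "h \<le> m l" by (auto simp: nb_def)
      have "x \<le> l" if "x \<in> S" for x
      proof (rule ccontr)
        assume "\<not> x \<le> l"
        then have "x \<in> nb S h" using that l S mono_m[of l x] by (auto simp: nb_def)
        then show False using 1 \<open>\<not> x \<le> l\<close> by auto
      qed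
      then have Ml: "Max S = l" using l S by (intro Max_eqI) auto
      have e: "nb U h = (if l \<in> U then {l} else {})" if "U \<subseteq> S" for U
        using that 1 by (auto simp: nb_def)
      have "stab_left h G (insert h S) t u = - t * (q * stab_right l G S t u)"
        "stab_right h G (insert h S) t u = - u * stab_left l G S t u" for t u
        unfolding stab_left_insert_max[OF S] stab_right_insert_max[OF S]
        using G 1 e l
        by (auto simp: conv_def sum_distrib_left stab_left_def stab_right_def mult_ac intro!: sum.cong)
      then show ?thesis unfolding Max
        using balanced_step[OF insert.IH[unfolded Ml]] l by (auto simp only: balanced_def)
    next
      case 2
      have "(if nb U h = {} then q ^ card (nb S h) * (stab G t U * stab G u (S - U)) else 0) = 0"
        "(if nb (S - U) h = {} then stab G t U * stab G u (S - U) else 0) = 0" if "U \<in> Pow S" for t u U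
      proof -
        have "stab G u (S - U) = 0" if "nb U h = {}"
        proof (rule ccontr)
          assume "stab G u (S - U) \<noteq> 0"
          moreover have "nb (S - U) h = nb S h" using that by (auto simp: nb_def)
          ultimately show False using stab_card_nb_le_1[of G u "S - U" h] 2 by simp
        qed
        then show "(if nb U h = {} then q ^ card (nb S h) * (stab G t U * stab G u (S - U)) else 0) = 0"
          by simp
        have "stab G t U = 0" if "nb (S - U) h = {}"
        proof (rule ccontr)
          assume "stab G t U \<noteq> 0"
          moreover have "nb U h = nb S h" using that \<open>U \<in> Pow S\<close> by (auto simp: nb_def)
          ultimately show False using stab_card_nb_le_1[of G t U h] 2 by simp
        qed
        then show "(if nb (S - U) h = {} then stab G t U * stab G u (S - U) else 0) = 0"
          by simp
      qed
      then have "stab_left h G (insert h S) t u = 0"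
        "stab_right h G (insert h S) t u = 0" for t u
        unfolding stab_left_insert_max[OF S] stab_right_insert_max[OF S] by simp_all
      then show ?thesis unfolding Max by (simp add: balanced_def)
    qed
  qed
qed

text \<open>
  Each of the two alternatives of balancedness makes the sum of both parts symmetric in \<open>t\<close> and \<open>u\<close>.
\<close>

lemma stab_commute: "stab G t \<star> stab G u = stab G u \<star> stab G t"
proof
  fix S
  show "(stab G t \<star> stab G u) S = (stab G u \<star> stab G t) S"
  proof (cases "finite S \<and> S \<noteq> {}")
    case True
    then show ?thesis using balanced_stab[of S G] Max_in[of S]
      by (simp add: stab_conv_split[of "Max S"] balanced_sum_sym)
  next
    case False
    then show ?thesis by (auto simp: conv_infinite) (simp add: conv_def mult_ac)
  qed
qed

text \<open>
  Inverses of commuting elements commute.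
\<close>

lemma wrd_commute: "wrd G t \<star> wrd G u = wrd G u \<star> wrd G t"
proof -
  let ?T = "stab G t" and ?U = "stab G u" and ?v = "wrd G t" and ?w = "wrd G u"
  have z: "unit_fun \<star> wrd G s = wrd G s" "wrd G s \<star> unit_fun = wrd G s"
    "unit_fun \<star> stab G s = stab G s" for s
    by (rule conv_unit_left conv_unit_right; simp add: wrd_def stab_def prodw_infinite)+
  have "?w \<star> ((?v \<star> ?T) \<star> ?U) \<star> ?v \<star> ?w = ?w \<star> ?U \<star> ?v \<star> ?w"
    by (simp only: wrd_conv_stab z)
  also have "\<dots> = (?w \<star> ?U) \<star> ?v \<star> ?w"
    by (simp only: conv_assoc)
  also have "\<dots> = unit_fun \<star> ?v \<star> ?w"
    by (simp only: wrd_conv_stab)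
  also have "\<dots> = ?v \<star> ?w"
    by (rule conv_unit_left, rule conv_infinite)
  finally have "?v \<star> ?w = ?w \<star> ((?v \<star> ?T) \<star> ?U) \<star> ?v \<star> ?w" ..
  also have "\<dots> = ?w \<star> ?v \<star> (?T \<star> ?U) \<star> ?v \<star> ?w"
    by (simp add: conv_assoc)
  also have "\<dots> = ?w \<star> ?v \<star> (?U \<star> ?T) \<star> ?v \<star> ?w"
    by (simp add: stab_commute)
  also have "\<dots> = ?w \<star> ?v \<star> ?U \<star> ((?T \<star> ?v) \<star> ?w)"
    by (simp add: conv_assoc)
  also have "\<dots> = ?w \<star> ?v \<star> unit_fun"
    by (simp only: stab_conv_wrd z)
  also have "\<dots> = ?w \<star> ?v"
    by (simp only: stab_conv_wrd z)
  finally show ?thesis .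
qed

end

section \<open>Three recursions along the vertices above a root\<close>

context interval_graph
begin

text \<open>
  Three factors that collect the contributions of the vertices \<open>hs\<close>, processed in increasing order
  on top of a set \<open>A\<close>. Each is attached to a product of set functions: \<open>R1\<close> to a product whose
  second factor is a stable function in \<open>t\<close>, \<open>R2\<close> to the product in the opposite order, and \<open>R3\<close> to
  a product of stable functions in \<open>s\<close> and in \<open>t\<close> and a third function. A stable part influences the
  later vertices through its one vertex that may still be adjacent to them; this is \<open>v\<close>, or \<open>i\<close> and
  \<open>j\<close> for the two stable parts of \<open>R3\<close>. The vertex \<open>0\<close> means that there is no such vertex.
\<close>

primrec R1 :: "nat list \<Rightarrow> 'a \<Rightarrow> 'a \<Rightarrow> nat set \<Rightarrow> nat \<Rightarrow> 'a" where
  "R1 [] s t A v = 1"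
| "R1 (h # hs) s t A v =
     (if v \<in> nb A h then s * q * qnum q (card (nb A h) - 1) * R1 hs s t (insert h A) v
      else s * qnum q (card (nb A h)) * R1 hs s t (insert h A) v - t * R1 hs s t (insert h A) h)"

primrec R2 :: "nat list \<Rightarrow> 'a \<Rightarrow> 'a \<Rightarrow> nat set \<Rightarrow> nat \<Rightarrow> 'a" where
  "R2 [] s t A v = 1"
| "R2 (h # hs) s t A v =
     (if v \<in> nb A h then s * qnum q (card (nb A h) - 1) * R2 hs s t (insert h A) v
      else s * qnum q (card (nb A h)) * R2 hs s t (insert h A) v
         - t * q ^ card (nb A h) * R2 hs s t (insert h A) h)"

primrec R3 :: "nat list \<Rightarrow> 'a \<Rightarrow> 'a \<Rightarrow> nat set \<Rightarrow> nat \<Rightarrow> nat \<Rightarrow> 'a" where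
  "R3 [] s t A i j = 1"
| "R3 (h # hs) s t A i j =
     (if i \<in> nb A h then
        if j \<in> nb A h then s * qnum q (card (nb A h) - 1) * R3 hs s t (insert h A) i j
        else s * qnum q (card (nb A h)) * R3 hs s t (insert h A) i j
           - t * q ^ (card (nb A h) - 1) * R3 hs s t (insert h A) i h
      else
        if j \<in> nb A h then s * qnum q (card (nb A h)) * R3 hs s t (insert h A) i j
           - s * q ^ card (nb A h) * R3 hs s t (insert h A) h j
        else s * qnum q (Suc (card (nb A h))) * R3 hs s t (insert h A) i j
           - s * q ^ card (nb A h) * R3 hs s t (insert h A) h j
           - t * q ^ card (nb A h) * R3 hs s t (insert h A) i h)"

definition admissible :: "nat list \<Rightarrow> nat set \<Rightarrow> bool" where
  "admissible hs A \<longleftrightarrow> finite A \<and> 0 \<notin> A \<and> 0 \<notin> set hs \<and> sorted_wrt (<) hs \<and> (\<forall>x\<in>A. \<forall>h\<in>set hs. x < h)"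

lemma admissible_step: "admissible (h # hs) A \<Longrightarrow> admissible hs (insert h A)"
  by (auto simp: admissible_def)

text \<open>
  An inactive vertex has no neighbours among the vertices still to come, so it may be replaced by
  the dummy vertex \<open>0\<close> or any other inactive vertex.
\<close>

definition inactive :: "nat list \<Rightarrow> nat set \<Rightarrow> nat \<Rightarrow> bool" where
  "inactive hs A v \<longleftrightarrow> v \<notin> set hs \<and> (\<forall>h\<in>set hs. v \<notin> nb A h)"

lemma inactive_step: "inactive (h # hs) A v \<Longrightarrow> inactive hs (insert h A) v"
  by (auto simp: inactive_def nb_def)

lemma R1_inactive: "inactive hs A v \<Longrightarrow> inactive hs A w \<Longrightarrow> R1 hs s t A v = R1 hs s t A w"
proof (induction hs arbitrary: A)
  case (Cons h hs)
  then show ?case using Cons.IH[OF inactive_step inactive_step] by (auto simp: inactive_def)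
qed simp

lemma R2_inactive: "inactive hs A v \<Longrightarrow> inactive hs A w \<Longrightarrow> R2 hs s t A v = R2 hs s t A w"
proof (induction hs arbitrary: A)
  case (Cons h hs)
  then show ?case using Cons.IH[OF inactive_step inactive_step] by (auto simp: inactive_def)
qed simp

lemma R3_inactive_left:
  "inactive hs A i \<Longrightarrow> inactive hs A i' \<Longrightarrow> R3 hs s t A i j = R3 hs s t A i' j"
proof (induction hs arbitrary: A j)
  case (Cons h hs)
  have "R3 hs s t (insert h A) i x = R3 hs s t (insert h A) i' x" for x
    by (rule Cons.IH) (use Cons.prems inactive_step in auto)
  moreover have "i \<notin> nb A h" "i' \<notin> nb A h" using Cons.prems by (auto simp: inactive_def)
  ultimately show ?case by simp
qed simp

lemma R3_inactive_right:
  "inactive hs A j \<Longrightarrow> inactive hs A j' \<Longrightarrow> R3 hs s t A i j = R3 hs s t A i j'"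
proof (induction hs arbitrary: A i)
  case (Cons h hs)
  have "R3 hs s t (insert h A) x j = R3 hs s t (insert h A) x j'" for x
    by (rule Cons.IH) (use Cons.prems inactive_step in auto)
  moreover have "j \<notin> nb A h" "j' \<notin> nb A h" using Cons.prems by (auto simp: inactive_def)
  ultimately show ?case by simp
qed simp

lemma inactive_0: "admissible hs A \<Longrightarrow> inactive hs A 0"
  by (auto simp: admissible_def inactive_def nb_def)

lemma inactive_below:
  assumes "admissible (h # hs) A" "v \<in> insert 0 A" "v \<notin> nb A h"
  shows "inactive hs (insert h A) v"
proof -
  have "v \<notin> set (h # hs)" using assms(1,2) by (auto simp: admissible_def)
  moreover have "v \<notin> nb (insert h A) k" if "k \<in> set hs" for k
    using assms that by (auto simp: admissible_def nb_def)
  ultimately show ?thesis by (auto simp: inactive_def)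
qed

text \<open>
  At each step either \<open>h\<close> has no smaller neighbour, so that the power of \<open>q\<close> that distinguishes the
  two recursions is trivial, or \<open>v\<close> is its one neighbour, and both factors vanish.
\<close>

lemma R1_eq_R2:
  assumes "admissible hs A" "\<forall>h\<in>set hs. nb A h \<subseteq> {v}"
  shows "R1 hs s t A v = R2 hs s t A v"
  using assms
proof (induction hs arbitrary: A v)
  case (Cons h hs)
  have h: "\<forall>x\<in>A. x < h" "\<forall>k\<in>set hs. h < k" using Cons.prems(1) by (auto simp: admissible_def)
  have sub: "nb A h \<subseteq> {v}" using Cons.prems(2) by simp
  show ?case
  proof (cases "v \<in> nb A h")
    case True
    then have "nb A h = {v}" using sub by blast
    then show ?thesis by simp
  next
    case False
    then have e: "nb A h = {}" using sub by blast
    have "nb (insert h A) k \<subseteq> {h}" if k: "k \<in> set hs" for k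
    proof
      fix x assume x: "x \<in> nb (insert h A) k"
      show "x \<in> {h}"
      proof (rule ccontr)
        assume "x \<notin> {h}"
        then have "x \<in> nb A h" using x h k by (auto simp: nb_def)
        then show False using e by simp
      qed
    qed
    then have "R1 hs s t (insert h A) h = R2 hs s t (insert h A) h"
      by (intro Cons.IH admissible_step[OF Cons.prems(1)]) auto
    then show ?thesis using e by simp
  qed
qed simp

text \<open>
  Two disjoint stable parts cannot have the same last vertex, so the diagonal of the matrix \<open>R3\<close> has
  no meaning of its own. The entries of \<open>R2\<close> are the values for which the relations below hold
  without exceptions.
\<close>

definition R3d :: "nat list \<Rightarrow> 'a \<Rightarrow> 'a \<Rightarrow> nat set \<Rightarrow> nat \<Rightarrow> nat \<Rightarrow> 'a" where
  "R3d hs s t A i j = (if i = j \<and> i \<noteq> 0 then R2 hs s t A i else R3 hs s t A i j)"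

text \<open>
  The goal is the second relation for \<open>i = 0\<close>, combined with the first one. To carry them through
  the recursion, all rows \<open>i\<close> are needed together with the third relation: the difference of two
  consecutive columns of the matrix is, up to a power of \<open>q\<close>, the same for all rows.
\<close>

definition relations :: "'a \<Rightarrow> 'a \<Rightarrow> nat list \<Rightarrow> nat set \<Rightarrow> bool" where
  "relations s t hs A \<longleftrightarrow>
     R3 hs s t A 0 0 = R2 hs s t A 0 \<and>
     (\<forall>i\<in>insert 0 A. t * (R1 hs s t A (Max (insert 0 A)) - R3d hs s t A i (Max (insert 0 A)))
        = s * (R1 hs s t A 0 - R3d hs s t A i 0)) \<and>
     (\<forall>i\<in>insert 0 A. \<forall>j\<in>insert 0 A. \<forall>k\<in>A. j < k \<longrightarrow> (\<forall>x\<in>A. x \<le> j \<or> k \<le> x) \<longrightarrow>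
        R3d hs s t A i j - R3d hs s t A i k =
          q ^ (card {x\<in>A. j < x} - of_bool (j < i)) * (R1 hs s t A j - R1 hs s t A k))"

lemma relations_Nil: "relations s t [] A"
  by (auto simp: relations_def R3d_def)

text \<open>
  Write \<open>a\<close> and \<open>p\<close> for the values at \<open>hs\<close> on top of \<open>insert h A\<close>, and \<open>a0\<close> and \<open>p0\<close> for those at
  \<open>h # hs\<close>. A vertex of \<open>A\<close> that is not adjacent to \<open>h\<close> is inactive for the vertices above \<open>h\<close>, so
  its row and column agree with those of \<open>0\<close>. Each new value is therefore a combination of values at
  \<open>0\<close>, at \<open>h\<close> and at neighbours of \<open>h\<close>, and each relation reduces to the old ones and to
  \<open>qnum q (Suc d) = 1 + q * qnum q d\<close>.
\<close>

lemma relations_step: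
  assumes adm: "admissible (h # hs) A" and rel: "relations s t hs (insert h A)"
  shows "relations s t (h # hs) A"
proof -
  let ?A = "insert h A"
  let ?W = "nb A h"
  define a where "a = R1 hs s t ?A"
  define p where "p = R3d hs s t ?A"
  define a0 where "a0 = R1 (h # hs) s t A"
  define p0 where "p0 = R3d (h # hs) s t A"
  define c where "c = card ?W"
  define l where "l = Max (insert 0 A)"
  have fin: "finite A" and A0: "0 \<notin> A" and h0: "h \<noteq> 0" and hA: "\<forall>x\<in>A. x < h" and hnA: "h \<notin> A"
    using adm by (auto simp: admissible_def)
  have adm': "admissible hs ?A" by (rule admissible_step[OF adm])
  have W: "?W \<subseteq> A" "h \<notin> ?W" "0 \<notin> ?W" using A0 by (auto simp: nb_def)
  have Max: "Max (insert 0 ?A) = h" using fin hA h0 by (intro Max_eqI) (auto intro: less_imp_le)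
  have l: "l \<in> insert 0 A" "\<forall>x\<in>A. x \<le> l" "l < h"
    using fin hA h0 Max_in[of "insert 0 A"] by (auto simp: l_def)
  have dead: "inactive hs ?A v" if "v \<in> insert 0 A" "v \<notin> ?W" for v
    by (rule inactive_below[OF adm that])
  have dead0: "inactive hs ?A 0" by (rule inactive_0[OF adm'])
  have rel0: "R3 hs s t ?A 0 0 = R2 hs s t ?A 0"
    using rel[unfolded relations_def] by blast
  have relE: "t * (a h - p i h) = s * (a 0 - p i 0)" if "i \<in> insert 0 ?A" for i
    using rel[unfolded relations_def Max] that unfolding a_def p_def by blast
  have relI: "p i j - p i k = q ^ (Suc (card {x\<in>A. j < x}) - of_bool (j < i)) * (a j - a k)"
    if "i \<in> insert 0 ?A" "j \<in> insert 0 A" "k \<in> ?A" "j < k" "\<forall>x\<in>?A. x \<le> j \<or> k \<le> x" for i j k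
  proof -
    have "{x\<in>?A. j < x} = insert h {x\<in>A. j < x}" using that hA h0 by auto
    then have "card {x\<in>?A. j < x} = Suc (card {x\<in>A. j < x})" using fin hnA by simp
    moreover have "p i j - p i k = q ^ (card {x\<in>?A. j < x} - of_bool (j < i)) * (a j - a k)"
      unfolding a_def p_def
      using rel[unfolded relations_def, THEN conjunct2, THEN conjunct2, rule_format, of i j k] that
      by blast
    ultimately show ?thesis by simp
  qed
  have a_dead: "a v = a 0" if "v \<in> insert 0 A" "v \<notin> ?W" for v
    unfolding a_def by (rule R1_inactive[OF dead[OF that] dead0])
  have p_dead_right: "p i j = p i 0" if "j \<in> insert 0 A" "j \<notin> ?W" "i \<noteq> j" "i \<noteq> 0" for i j
    unfolding p_def R3d_def using that R3_inactive_right[OF dead[OF that(1,2)] dead0] by auto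
  have p_dead_left: "p i j = p 0 j" if "i \<in> insert 0 A" "i \<notin> ?W" "i \<noteq> j" for i j
    unfolding p_def R3d_def using that R3_inactive_left[OF dead[OF that(1,2)] dead0] by auto
  have p_dead: "p i j = p 0 0" if "i \<in> insert 0 A" "i \<notin> ?W" "j \<in> insert 0 A" "j \<notin> ?W" for i j
    unfolding p_def R3d_def
    using R3_inactive_left[OF dead[OF that(1,2)] dead0, of s t j]
      R3_inactive_right[OF dead[OF that(3,4)] dead0, of s t 0]
      R2_inactive[OF dead[OF that(1,2)] dead0, of s t] rel0 by auto
  have p00: "p 0 0 = R2 hs s t ?A 0" using rel0 by (simp add: p_def R3d_def)
  have phh: "p h h = R2 hs s t ?A h" using h0 by (simp add: p_def R3d_def)
  \<comment> \<open>The recursion in terms of the values one step later.\<close>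
  have a0_in: "a0 j = s * q * qnum q (c - 1) * a j" if "j \<in> ?W" for j
    using that by (simp add: a0_def a_def c_def)
  have a0_out: "a0 j = s * qnum q c * a 0 - t * a h" if "j \<in> insert 0 A" "j \<notin> ?W" for j
    using that a_dead[OF that] by (simp add: a0_def a_def c_def)
  have p0_in_in: "p0 i j = s * qnum q (c - 1) * p i j" if "i \<in> ?W" "j \<in> ?W" for i j
    using that by (simp add: p0_def p_def R3d_def c_def)
  have p0_in_out: "p0 i j = s * qnum q c * p i 0 - t * q ^ (c - 1) * p i h"
    if "i \<in> ?W" "j \<in> insert 0 A" "j \<notin> ?W" for i j
  proof -
    have ne: "i \<noteq> j" "i \<noteq> 0" "i \<noteq> h" using that W by metis+
    then show ?thesis using that p_dead_right[OF that(2,3)]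
      by (simp add: p0_def p_def R3d_def c_def)
  qed
  have p0_out_in: "p0 i j = s * qnum q c * p 0 j - s * q ^ c * p h j"
    if "i \<in> insert 0 A" "i \<notin> ?W" "j \<in> ?W" for i j
  proof -
    have ne: "i \<noteq> j" "j \<noteq> 0" "j \<noteq> h" using that W by metis+
    then show ?thesis using that p_dead_left[OF that(1,2)]
      by (auto simp: p0_def p_def R3d_def c_def)
  qed
  have p0_00: "p0 0 0 = s * qnum q (Suc c) * p 0 0 - s * q ^ c * p h 0 - t * q ^ c * p 0 h"
    using W h0 by (simp add: p0_def p_def R3d_def c_def)
  have E0: "t * (a h - p 0 h) = s * (a 0 - p 0 0)" and Eh: "t * (a h - p h h) = s * (a 0 - p h 0)"
    by (rule relE; simp)+
  have R20: "R2 (h # hs) s t A 0 = s * qnum q c * p 0 0 - t * q ^ c * p h h"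
    using W by (simp add: p00 phh c_def)
  \<comment> \<open>The second relation for the rows \<open>0\<close> and \<open>h\<close>, subtracted from each other.\<close>
  have diff0h: "s * p 0 0 - s * p h 0 - t * p 0 h + t * p h h = 0"
  proof -
    have "s * p 0 0 - s * p h 0 - t * p 0 h + t * p h h
        = (t * (a h - p 0 h) - s * (a 0 - p 0 0)) - (t * (a h - p h h) - s * (a 0 - p h 0))"
      by (simp add: algebra_simps)
    then show ?thesis by (simp add: E0 Eh)
  qed
  have rel0_new: "R3 (h # hs) s t A 0 0 = R2 (h # hs) s t A 0"
  proof -
    have "p0 0 0 - R2 (h # hs) s t A 0 = q ^ c * (s * p 0 0 - s * p h 0 - t * p 0 h + t * p h h)"
      unfolding p0_00 R20 by (simp add: qnum_Suc algebra_simps)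
    then show ?thesis by (simp add: diff0h p0_def R3d_def del: R3.simps R2.simps)
  qed
  have p0_out_out: "p0 i j = p0 0 0" if "i \<in> insert 0 A" "i \<notin> ?W" "j \<in> insert 0 A" "j \<notin> ?W" for i j
  proof (cases "i = j \<and> i \<noteq> 0")
    case True
    then have "p0 i j = s * qnum q c * R2 hs s t ?A 0 - t * q ^ c * R2 hs s t ?A h"
      using that R2_inactive[OF dead[OF that(1,2)] dead0, of s t]
      by (simp add: p0_def R3d_def c_def)
    then have "p0 i j = R2 (h # hs) s t A 0" unfolding R20 p00 phh .
    then show ?thesis using rel0_new by (simp add: p0_def R3d_def)
  next
    case False
    have "i \<noteq> h" "j \<noteq> h" using that hnA h0 by auto
    have "R3 hs s t ?A i j = R3 hs s t ?A 0 0"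
      using R3_inactive_left[OF dead[OF that(1,2)] dead0, of s t j]
        R3_inactive_right[OF dead[OF that(3,4)] dead0, of s t 0] by simp
    moreover have "R3 hs s t ?A h j = R3 hs s t ?A h 0"
      by (rule R3_inactive_right[OF dead[OF that(3,4)] dead0])
    moreover have "R3 hs s t ?A i h = R3 hs s t ?A 0 h"
      by (rule R3_inactive_left[OF dead[OF that(1,2)] dead0])
    ultimately show ?thesis using False that W by (auto simp: p0_def R3d_def)
  qed
  have I_new: "p0 i j - p0 i k = q ^ (card {x\<in>A. j < x} - of_bool (j < i)) * (a0 j - a0 k)"
    if i: "i \<in> insert 0 A" and j: "j \<in> insert 0 A" and k: "k \<in> A" and jk: "j < k"
      and cons: "\<forall>x\<in>A. x \<le> j \<or> k \<le> x" for i j k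
  proof -
    have i': "i \<in> insert 0 ?A" using i by blast
    define \<kappa> where "\<kappa> = card {x\<in>A. j < x}"
    have kpos: "\<kappa> \<noteq> 0" using k jk fin by (auto simp: \<kappa>_def)
    have I: "p i' j - p i' k = q ^ (Suc \<kappa> - of_bool (j < i')) * (a j - a k)"
      if "i' \<in> insert 0 ?A" for i'
      unfolding \<kappa>_def using that j k jk cons hA h0 by (intro relI) (auto intro: less_imp_le)
    have Ih: "p h j - p h k = q ^ \<kappa> * (a j - a k)" using I[of h] jk k hA by auto
    have I0: "p 0 j - p 0 k = q * q ^ \<kappa> * (a j - a k)" using I[of 0] by simp
    have jW_kW: "k \<in> ?W" if "j \<in> ?W" using that k jk hA mono_m[of j k] by (auto simp: nb_def)
    \<comment> \<open>The neighbours of \<open>h\<close> are the topmost vertices of \<open>A\<close>, so if just one of \<open>j\<close> and \<open>k\<close> is a neighbour, it is \<open>k\<close>.\<close>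
    consider (1) "j \<in> ?W" "k \<in> ?W" | (2) "j \<notin> ?W" "k \<in> ?W" | (3) "j \<notin> ?W" "k \<notin> ?W"
      using jW_kW by blast
    then have "p0 i j - p0 i k = q ^ (\<kappa> - of_bool (j < i)) * (a0 j - a0 k)"
    proof cases
      case 1
      have c: "c \<noteq> 0" using 1 by (auto simp: c_def)
      then obtain d where d: "c = Suc d" using not0_implies_Suc by blast
      show ?thesis
      proof (cases "i \<in> ?W")
        case True
        define e where "e = \<kappa> - of_bool (j < i)"
        have se: "Suc \<kappa> - of_bool (j < i) = Suc e" using kpos by (simp add: e_def)
        have "p i j - p i k = q * q ^ e * (a j - a k)"
          using I[OF i', unfolded se] by simp
        then have "s * qnum q d * (p i j - p i k) = s * qnum q d * (q * q ^ e * (a j - a k))" by simp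
        then show ?thesis unfolding e_def[symmetric]
          by (simp add: p0_in_in[OF True] a0_in 1 d algebra_simps)
      next
        case False
        have ij: "\<not> j < i"
        proof
          assume "j < i"
          then have "i \<in> ?W" using 1(1) i hA mono_m[of j i] by (auto simp: nb_def)
          then show False using False by simp
        qed
        have "s * qnum q c * (p 0 j - p 0 k) - s * q ^ c * (p h j - p h k)
            = s * q ^ \<kappa> * (q * qnum q c - q ^ c) * (a j - a k)"
          unfolding I0 Ih by (simp add: algebra_simps)
        also have "q * qnum q c - q ^ c = q * qnum q d"
          by (simp add: d qnum_Suc algebra_simps)
        finally show ?thesis
          using ij by (simp add: p0_out_in[OF i False] a0_in 1 d algebra_simps)
      qed
    next
      case 2
      have c: "c \<noteq> 0" using 2 by (auto simp: c_def)
      then obtain d where d: "c = Suc d" using not0_implies_Suc by blast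
      have "{x\<in>A. j < x} = ?W"
      proof (intro equalityI subsetI)
        fix x assume "x \<in> {x\<in>A. j < x}"
        then have "k \<le> x" "x \<in> A" using cons by auto
        then show "x \<in> ?W" using 2(2) hA mono_m[of k x] by (auto simp: nb_def)
      next
        fix x assume x: "x \<in> ?W"
        have "\<not> x \<le> j"
        proof
          assume "x \<le> j"
          then have "j \<in> ?W" using x j hA mono_m[of x j] by (auto simp: nb_def)
          then show False using 2 by simp
        qed
        then show "x \<in> {x\<in>A. j < x}" using x by (auto simp: nb_def)
      qed
      then have kc: "\<kappa> = c" by (simp add: \<kappa>_def c_def)
      have qc: "q * qnum q d + 1 = qnum q c" by (simp add: d qnum_Suc')
      show ?thesis
      proof (cases "i \<in> ?W")
        case True
        have ji: "j < i"
        proof (rule ccontr)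
          assume "\<not> j < i"
          then have "j \<in> ?W" using True j hA mono_m[of i j] by (auto simp: nb_def)
          then show False using 2 by simp
        qed
        have "i \<noteq> 0" using True W by metis
        have pij: "p i j = p i 0" by (rule p_dead_right[OF j 2(1)]) (use ji \<open>i \<noteq> 0\<close> in simp_all)
        have 1: "p i 0 - p i k = q * q ^ d * (a 0 - a k)"
          using I[OF i'] ji kc d pij a_dead[OF j 2(1)] by simp
        have 2: "s * p i 0 - t * p i h = s * a 0 - t * a h"
          using relE[OF i'] by (simp add: algebra_simps)
        have "p0 i j - p0 i k = s * qnum q d * (p i 0 - p i k) + q ^ d * (s * p i 0 - t * p i h)"
          by (simp add: p0_in_out[OF True j \<open>j \<notin> ?W\<close>] p0_in_in[OF True \<open>k \<in> ?W\<close>] d qnum_Suc algebra_simps)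
        also have "\<dots> = q ^ d * (s * (q * qnum q d + 1) * a 0 - t * a h - s * q * qnum q d * a k)"
          unfolding 1 2 by (simp add: algebra_simps)
        also have "\<dots> = q ^ d * (a0 j - a0 k)"
          unfolding qc by (simp add: a0_out[OF j \<open>j \<notin> ?W\<close>] a0_in[OF \<open>k \<in> ?W\<close>] d)
        finally show ?thesis using ji kc d by simp
      next
        case False
        have ij: "\<not> j < i"
        proof
          assume "j < i"
          then have "k \<le> i" "i \<in> A" using cons i by auto
          then have "i \<in> ?W" using 2(2) hA mono_m[of k i] by (auto simp: nb_def)
          then show False using False by simp
        qed
        have ph: "p h j = p h 0" by (rule p_dead_right[OF j 2(1)]) (use j hnA h0 in auto)
        have pz: "p 0 j = p 0 0" using p_dead[of 0 j] j 2 W by auto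
        have 1: "p 0 0 - p 0 k = q * q ^ c * (a 0 - a k)"
          using I0 pz kc a_dead[OF j 2(1)] by simp
        have 3: "p h 0 - p h k = q ^ c * (a 0 - a k)"
          using Ih ph kc a_dead[OF j 2(1)] by simp
        have 4: "s * p 0 0 - t * p 0 h = s * a 0 - t * a h"
          using E0 by (simp add: algebra_simps)
        have "p0 i j - p0 i k = s * qnum q c * (p 0 0 - p 0 k) - s * q ^ c * (p h 0 - p h k)
             + q ^ c * (s * p 0 0 - t * p 0 h)"
          by (simp add: p0_out_out[OF i False j 2(1)] p0_00 p0_out_in[OF i False 2(2)] qnum_Suc algebra_simps)
        also have "\<dots> = q ^ c * (s * (q * qnum q c - q ^ c) * (a 0 - a k) + s * a 0 - t * a h)"
          unfolding 1 3 4 by (simp add: algebra_simps)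
        also have "q * qnum q c - q ^ c = q * qnum q d"
          by (simp add: d qnum_Suc algebra_simps)
        also have "s * (q * qnum q d) * (a 0 - a k) + s * a 0 - t * a h
            = s * (q * qnum q d + 1) * a 0 - t * a h - s * q * qnum q d * a k"
          by (simp add: algebra_simps)
        also have "\<dots> = a0 j - a0 k"
          unfolding qc by (simp add: a0_out[OF j 2(1)] a0_in[OF 2(2)] d)
        finally show ?thesis using ij kc by simp
      qed
    next
      case 3
      have "p0 i j = p0 i k"
      proof (cases "i \<in> ?W")
        case True
        then show ?thesis using p0_in_out[OF True j 3(1)] p0_in_out[OF True _ 3(2)] k by simp
      next
        case False
        then show ?thesis using p0_out_out[OF i False j 3(1)] p0_out_out[OF i False _ 3(2)] k by simp
      qed
      moreover have "a0 j = a0 k" using a0_out[OF j 3(1)] a0_out[OF _ 3(2)] k by simp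
      ultimately show ?thesis by simp
    qed
    then show ?thesis by (simp add: \<kappa>_def)
  qed
  \<comment> \<open>Here \<open>l\<close> is the largest vertex of \<open>A\<close>, or \<open>0\<close>; it is a neighbour of \<open>h\<close> as soon as \<open>h\<close> has one.\<close>
  have E_new: "t * (a0 l - p0 i l) = s * (a0 0 - p0 i 0)" if i: "i \<in> insert 0 A" for i
  proof (cases "c = 0")
    case True
    then have W0: "?W = {}" by (simp add: c_def)
    have "p0 i l = p0 0 0" "p0 i 0 = p0 0 0"
      by (rule p0_out_out; use i l W0 in auto)+
    moreover have "a0 l = a0 0" using a0_out[OF l(1)] a0_out[of 0] W0 by simp
    moreover have "a0 0 = p0 0 0"
    proof -
      have "nb ?A k \<subseteq> {h}" if k: "k \<in> set hs" for k
        using W0 hA adm k by (fastforce simp: nb_def admissible_def)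
      then have "a h = p h h"
        unfolding phh unfolding a_def by (intro R1_eq_R2 adm') auto
      moreover have "s * p 0 0 - s * p h 0 - t * p 0 h = - t * p h h"
        using diff0h by (simp add: algebra_simps eq_neg_iff_add_eq_0)
      ultimately show ?thesis using a0_out[of 0] W0 p0_00 True by simp
    qed
    ultimately show ?thesis by simp
  next
    case False
    then obtain d where d: "c = Suc d" using not0_implies_Suc by blast
    have i': "i \<in> insert 0 ?A" using i by blast
    from False obtain w where w: "w \<in> ?W" by (auto simp: c_def)
    then have "w \<in> A" "w \<le> l" using l by (auto simp: nb_def)
    then have lA: "l \<in> A" using l A0 by auto
    then have lW: "l \<in> ?W" using w \<open>w \<le> l\<close> mono_m[of w l] hA by (auto simp: nb_def)
    have kl: "{x\<in>A. l < x} = {}" using l by auto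
    have I: "p i' l - p i' h = q ^ (1 - of_bool (l < i')) * (a l - a h)" if "i' \<in> insert 0 ?A" for i'
      using relI[of i' l h] that l kl by auto
    have Ih: "p h l - p h h = a l - a h" using I[of h] l by simp
    have I0: "p 0 l - p 0 h = q * (a l - a h)" using I[of 0] by simp
    show ?thesis
    proof (cases "i \<in> ?W")
      case True
      have "i \<le> l" using True l by (auto simp: nb_def)
      then have 1: "p i l = p i h + q * (a l - a h)" using I[OF i'] by (simp add: algebra_simps)
      have 2: "s * p i 0 = s * a 0 - t * a h + t * p i h"
        using relE[OF i'] by (simp add: algebra_simps)
      have "s * (a0 0 - p0 i 0) = s * (qnum q c * (s * a 0 - s * p i 0) - t * a h + t * q ^ d * p i h)"
        using W by (simp add: a0_out p0_in_out[OF True] d algebra_simps)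
      also have "\<dots> = s * t * ((qnum q c - 1) * a h - (qnum q c - q ^ d) * p i h)"
        unfolding 2 by (simp add: algebra_simps)
      also have "qnum q c - 1 = q * qnum q d" by (simp add: d qnum_Suc')
      also have "qnum q c - q ^ d = qnum q d" by (simp add: d qnum_Suc)
      also have "s * t * (q * qnum q d * a h - qnum q d * p i h) = t * (a0 l - p0 i l)"
        by (simp add: a0_in[OF lW] p0_in_in[OF True lW] d 1 algebra_simps)
      finally show ?thesis by simp
    next
      case False
      have 1: "p 0 l = p 0 h + q * (a l - a h)" using I0 by (simp add: algebra_simps)
      have 2: "p h l = p h h + a l - a h" using Ih by (simp add: algebra_simps)
      have 3: "s * p 0 0 = s * a 0 - t * a h + t * p 0 h" using E0 by (simp add: algebra_simps)
      have 4: "s * p h 0 = s * a 0 - t * a h + t * p h h" using Eh by (simp add: algebra_simps)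
      have z: "(0::nat) \<notin> ?W" using W by simp
      have "s * (a0 0 - p0 i 0) = s * (qnum q c * (s * a 0) - t * a h - qnum q (Suc c) * (s * p 0 0)
            + q ^ c * (s * p h 0) + t * q ^ c * p 0 h)"
        using z by (simp add: a0_out p0_out_out[OF i False] p0_00 algebra_simps)
      also have "\<dots> = s * t * ((qnum q c - 1) * a h - qnum q c * p 0 h + q ^ c * p h h)"
        unfolding 3 4 by (simp add: qnum_Suc algebra_simps)
      also have "qnum q c - 1 = q * qnum q d" by (simp add: d qnum_Suc')
      finally have R: "s * (a0 0 - p0 i 0) = s * t * (q * qnum q d * a h - qnum q c * p 0 h + q ^ c * p h h)" .
      have "t * (a0 l - p0 i l) = s * t * (q * qnum q d * a l - qnum q c * p 0 l + q ^ c * p h l)"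
        by (simp add: a0_in[OF lW] p0_out_in[OF i False lW] d algebra_simps)
      also have "\<dots> = s * t * (q * qnum q d * a h - qnum q c * p 0 h + q ^ c * p h h
           + (q * qnum q d + q ^ c - q * qnum q c) * (a l - a h))"
        unfolding 1 2 by (simp add: algebra_simps)
      also have "q * qnum q d + q ^ c - q * qnum q c = 0"
        by (simp add: d qnum_Suc algebra_simps)
      finally show ?thesis using R by simp
    qed
  qed
  show ?thesis
    unfolding relations_def l_def[symmetric] a0_def[symmetric] p0_def[symmetric]
    using rel0_new E_new I_new by blast
qed

lemma relations_hold: "admissible hs A \<Longrightarrow> relations s t hs A"
proof (induction hs arbitrary: A)
  case (Cons h hs)
  show ?case
    by (intro relations_step Cons.IH admissible_step Cons.prems)
qed (rule relations_Nil)

corollary R_key: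
  assumes "admissible hs A" "\<alpha> \<in> A" "\<forall>x\<in>A. x \<le> \<alpha>"
  shows "t * R1 hs s t A \<alpha> - t * R3 hs s t A 0 \<alpha> = s * R1 hs s t A 0 - s * R2 hs s t A 0"
proof -
  have "Max (insert 0 A) = \<alpha>" using assms unfolding admissible_def by (intro Max_eqI) auto
  moreover have "\<alpha> \<noteq> 0" using assms(1,2) unfolding admissible_def by metis
  ultimately show ?thesis
    using relations_hold[OF assms(1), of s t]
    by (auto simp: relations_def R3d_def algebra_simps)
qed

end

section \<open>Antisymmetry of the swap defect\<close>

context interval_graph
begin

lemma prodw_unique:
  fixes F :: "nat set \<Rightarrow> 'a"
  assumes rec: "\<And>S h. finite S \<Longrightarrow> \<forall>x\<in>S. x < h \<Longrightarrow> F (insert h S) = \<psi> h (card (nb S h)) * F S"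
    and "F {} = 1" and "\<And>S. infinite S \<Longrightarrow> F S = 0"
  shows "F = prodw \<psi>"
proof
  fix S
  show "F S = prodw \<psi> S"
  proof (cases "finite S")
    case True
    then show ?thesis
    proof (induction S rule: finite_linorder_max_induct)
      case (insert h S)
      then show ?case using rec[of S h] prodw_insert_max[of S h \<psi>] by (simp add: mult.commute)
    qed (simp add: assms(2))
  qed (simp add: assms(3) prodw_infinite)
qed

text \<open>
  The contribution to \<open>(f \<star> g) (A \<union> set hs)\<close> of all splittings that restrict to a given splitting of
  \<open>A\<close>, for \<open>hs\<close> lying above \<open>A\<close>; \<open>ext3\<close> is the same for three factors.
\<close>

primrec ext2 :: "nat list \<Rightarrow> (nat set \<Rightarrow> 'a) \<Rightarrow> (nat set \<Rightarrow> 'a) \<Rightarrow> nat set \<Rightarrow> nat set \<Rightarrow> 'a" where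
  "ext2 [] f g U V = cross U V * f U * g V"
| "ext2 (h # hs) f g U V = ext2 hs f g (insert h U) V + ext2 hs f g U (insert h V)"

primrec ext3 :: "nat list \<Rightarrow> (nat set \<Rightarrow> 'a) \<Rightarrow> (nat set \<Rightarrow> 'a) \<Rightarrow> (nat set \<Rightarrow> 'a) \<Rightarrow>
    nat set \<Rightarrow> nat set \<Rightarrow> nat set \<Rightarrow> 'a" where
  "ext3 [] f g k P V W = cross P (V \<union> W) * cross V W * f P * g V * k W"
| "ext3 (h # hs) f g k P V W =
     ext3 hs f g k (insert h P) V W + ext3 hs f g k P (insert h V) W + ext3 hs f g k P V (insert h W)"

lemma conv_ext2:
  assumes "finite A" "A \<inter> set hs = {}" "distinct hs"
  shows "(f \<star> g) (A \<union> set hs) = (\<Sum>U\<in>Pow A. ext2 hs f g U (A - U))"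
  using assms
proof (induction hs arbitrary: A)
  case Nil
  then show ?case by (simp add: conv_def)
next
  case (Cons h hs)
  have hA: "h \<notin> A" using Cons.prems by auto
  have "(f \<star> g) (A \<union> set (h # hs)) = (f \<star> g) (insert h A \<union> set hs)" by simp
  also have "\<dots> = (\<Sum>U\<in>Pow (insert h A). ext2 hs f g U (insert h A - U))"
    by (rule Cons.IH) (use Cons.prems in auto)
  also have "\<dots> = (\<Sum>U\<in>Pow A. ext2 (h # hs) f g U (A - U))"
    unfolding sum_Pow_insert[OF Cons.prems(1) hA]
  proof (rule sum.cong[OF refl], goal_cases)
    case (1 U)
    then have "insert h A - insert h U = A - U" "insert h A - U = insert h (A - U)" using hA by auto
    then show ?case by simp
  qed
  finally show ?case .
qed

lemma conv_ext3:
  assumes "finite A" "A \<inter> set hs = {}" "distinct hs"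
  shows "(f \<star> (g \<star> k)) (A \<union> set hs) =
    (\<Sum>P\<in>Pow A. \<Sum>V\<in>Pow (A - P). ext3 hs f g k P V (A - P - V))"
  using assms
proof (induction hs arbitrary: A)
  case Nil
  have "cross P (A - P) * f P * (\<Sum>V\<in>Pow (A - P). cross V (A - P - V) * g V * k (A - P - V))
      = (\<Sum>V\<in>Pow (A - P). ext3 [] f g k P V (A - P - V))" for P
    unfolding sum_distrib_left
  proof (rule sum.cong[OF refl], goal_cases)
    case (1 V)
    then have "V \<union> (A - P - V) = A - P" by auto
    then show ?case by (simp add: mult_ac)
  qed
  then show ?case by (simp add: conv_def)
next
  case (Cons h hs)
  have hA: "h \<notin> A" using Cons.prems by auto
  have "(f \<star> (g \<star> k)) (A \<union> set (h # hs)) = (f \<star> (g \<star> k)) (insert h A \<union> set hs)" by simp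
  also have "\<dots> = (\<Sum>P\<in>Pow (insert h A). \<Sum>V\<in>Pow (insert h A - P). ext3 hs f g k P V (insert h A - P - V))"
    by (rule Cons.IH) (use Cons.prems in auto)
  also have "\<dots> = (\<Sum>P\<in>Pow A. \<Sum>V\<in>Pow (A - P). ext3 (h # hs) f g k P V (A - P - V))"
    unfolding sum_Pow_insert[OF Cons.prems(1) hA]
  proof (rule sum.cong[OF refl], goal_cases)
    case (1 P)
    then have e: "insert h A - insert h P = A - P" "insert h A - P = insert h (A - P)" using hA by auto
    have f: "finite (A - P)" "h \<notin> A - P" using Cons.prems hA by auto
    show ?case
      unfolding e sum_Pow_insert[OF f] sum.distrib[symmetric]
    proof (rule sum.cong[OF refl], goal_cases)
      case (1 V)
      then have "insert h (A - P) - insert h V = A - P - V" "insert h (A - P) - V = insert h (A - P - V)"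
        using f by auto
      then show ?case by (simp add: add_ac)
    qed
  qed
  finally show ?case .
qed

lemma ext2_zero_left: "(\<And>U'. U \<subseteq> U' \<Longrightarrow> f U' = 0) \<Longrightarrow> ext2 hs f g U V = 0"
proof (induction hs arbitrary: U V)
  case (Cons h hs)
  have "ext2 hs f g (insert h U) V = 0" by (rule Cons.IH) (use Cons.prems in auto)
  moreover have "ext2 hs f g U (insert h V) = 0" by (rule Cons.IH) (use Cons.prems in auto)
  ultimately show ?case by simp
qed simp

lemma ext2_zero_right: "(\<And>V'. V \<subseteq> V' \<Longrightarrow> g V' = 0) \<Longrightarrow> ext2 hs f g U V = 0"
proof (induction hs arbitrary: U V)
  case (Cons h hs)
  have "ext2 hs f g (insert h U) V = 0" by (rule Cons.IH) (use Cons.prems in auto)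
  moreover have "ext2 hs f g U (insert h V) = 0" by (rule Cons.IH) (use Cons.prems in auto)
  ultimately show ?case by simp
qed simp

lemma ext3_zero_left: "(\<And>P'. P \<subseteq> P' \<Longrightarrow> f P' = 0) \<Longrightarrow> ext3 hs f g k P V W = 0"
proof (induction hs arbitrary: P V W)
  case (Cons h hs)
  have "ext3 hs f g k (insert h P) V W = 0" by (rule Cons.IH) (use Cons.prems in auto)
  moreover have "ext3 hs f g k P (insert h V) W = 0" by (rule Cons.IH) (use Cons.prems in auto)
  moreover have "ext3 hs f g k P V (insert h W) = 0" by (rule Cons.IH) (use Cons.prems in auto)
  ultimately show ?case by simp
qed simp

lemma ext3_zero_mid: "(\<And>V'. V \<subseteq> V' \<Longrightarrow> g V' = 0) \<Longrightarrow> ext3 hs f g k P V W = 0"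
proof (induction hs arbitrary: P V W)
  case (Cons h hs)
  have "ext3 hs f g k (insert h P) V W = 0" by (rule Cons.IH) (use Cons.prems in auto)
  moreover have "ext3 hs f g k P (insert h V) W = 0" by (rule Cons.IH) (use Cons.prems in auto)
  moreover have "ext3 hs f g k P V (insert h W) = 0" by (rule Cons.IH) (use Cons.prems in auto)
  ultimately show ?case by simp
qed simp

lemma ext3_zero_right: "(\<And>W'. W \<subseteq> W' \<Longrightarrow> k W' = 0) \<Longrightarrow> ext3 hs f g k P V W = 0"
proof (induction hs arbitrary: P V W)
  case (Cons h hs)
  have "ext3 hs f g k (insert h P) V W = 0" by (rule Cons.IH) (use Cons.prems in auto)
  moreover have "ext3 hs f g k P (insert h V) W = 0" by (rule Cons.IH) (use Cons.prems in auto)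
  moreover have "ext3 hs f g k P V (insert h W) = 0" by (rule Cons.IH) (use Cons.prems in auto)
  ultimately show ?case by simp
qed simp

text \<open>
  How the set functions of a graph with a root \<open>\<alpha>\<close> change when a largest vertex \<open>h > \<alpha>\<close> is added. A
  rooted function describes positions behind a neighbour; a free one has one extra position.
\<close>

definition grows_rooted :: "nat \<Rightarrow> 'a \<Rightarrow> (nat set \<Rightarrow> 'a) \<Rightarrow> bool" where
  "grows_rooted \<alpha> s f \<longleftrightarrow>
     (\<forall>U h. finite U \<longrightarrow> \<alpha> < h \<longrightarrow> (\<forall>x\<in>U. x < h) \<longrightarrow> f (insert h U) = s * qnum q (card (nb U h)) * f U)"

definition grows_free :: "nat \<Rightarrow> 'a \<Rightarrow> (nat set \<Rightarrow> 'a) \<Rightarrow> bool" where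
  "grows_free \<alpha> s f \<longleftrightarrow>
     (\<forall>U h. finite U \<longrightarrow> \<alpha> < h \<longrightarrow> (\<forall>x\<in>U. x < h) \<longrightarrow> f (insert h U) = s * qnum q (Suc (card (nb U h))) * f U)"

definition grows_stable :: "nat \<Rightarrow> 'a \<Rightarrow> (nat set \<Rightarrow> 'a) \<Rightarrow> bool" where
  "grows_stable \<alpha> t g \<longleftrightarrow>
     (\<forall>V h. finite V \<longrightarrow> \<alpha> < h \<longrightarrow> (\<forall>x\<in>V. x < h) \<longrightarrow> g (insert h V) = (if nb V h = {} then - t * g V else 0)) \<and>
     (\<forall>V x. g V \<noteq> 0 \<longrightarrow> x \<in> V \<longrightarrow> nb V x = {})"

lemma grows_stable_zero:
  assumes "grows_stable \<alpha> t g" "nb V h \<noteq> {}" "insert h V \<subseteq> V'"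
  shows "g V' = 0"
proof (rule ccontr)
  assume "g V' \<noteq> 0"
  then have "nb V' h = {}" using assms(1,3) by (auto simp: grows_stable_def)
  then show False using assms(2,3) by (auto simp: nb_def)
qed

text \<open>
  The later vertices \<open>hs\<close> see the part \<open>V\<close> of \<open>A\<close> through the single vertex \<open>v\<close>.
\<close>

definition tracks :: "nat list \<Rightarrow> nat set \<Rightarrow> nat set \<Rightarrow> nat \<Rightarrow> bool" where
  "tracks hs A V v \<longleftrightarrow> v \<notin> set hs \<and> (\<forall>h\<in>set hs. nb V h = nb A h \<inter> {v})"

lemma tracks_keep: "tracks (h # hs) A V v \<Longrightarrow> tracks hs (insert h A) V v"
  by (auto simp: tracks_def nb_def)

lemma tracks_new:
  assumes "tracks (h # hs) A V v" "nb V h = {}" "admissible (h # hs) A" "V \<subseteq> A"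
  shows "tracks hs (insert h A) (insert h V) h"
  unfolding tracks_def
proof (intro conjI ballI)
  show "h \<notin> set hs" using assms(3) by (auto simp: admissible_def)
  fix k assume k: "k \<in> set hs"
  then have hk: "h < k" and Ah: "\<forall>x\<in>A. x < h" using assms(3) by (auto simp: admissible_def)
  have "nb V k = {}" using assms(2,4) hk Ah by (fastforce simp: nb_def)
  then show "nb (insert h V) k = nb (insert h A) k \<inter> {h}"
    by (auto simp: nb_def)
qed

text \<open>
  A vertex \<open>h\<close> that joins the rooted part keeps \<open>v\<close> as the last relevant vertex of the stable part;
  it may join the stable part only if \<open>v\<close> is not its neighbour, and then it replaces \<open>v\<close>.
\<close>

lemma ext2_R1:
  assumes "admissible hs A" "U \<union> V = A" "U \<inter> V = {}" "\<forall>h\<in>set hs. \<alpha> < h"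
    and "grows_rooted \<alpha> s f" "grows_stable \<alpha> t g" "tracks hs A V v"
  shows "ext2 hs f g U V = cross U V * f U * g V * R1 hs s t A v"
  using assms(1-4,7)
proof (induction hs arbitrary: A U V v)
  case (Cons h hs)
  note adm = Cons.prems(1) and UV = Cons.prems(2,3) and tr = Cons.prems(5)
  have finA: "finite A" and hA: "\<forall>x\<in>A. x < h" using adm by (auto simp: admissible_def)
  have fin: "finite U" "finite V" "\<forall>x\<in>U. x < h" "\<forall>x\<in>V. x < h" "h \<notin> U" "h \<notin> V" "\<alpha> < h"
    using UV finA hA Cons.prems(4) by auto
  have c: "card (nb A h) = card (nb U h) + card (nb V h)" using card_nb_Un[OF UV(2), of h] UV(1) by simp
  have nV: "nb V h = nb A h \<inter> {v}" using tr by (simp add: tracks_def)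
  have f: "f (insert h U) = s * qnum q (card (nb U h)) * f U"
    using assms(5) fin by (simp add: grows_rooted_def)
  have IHU: "ext2 hs f g (insert h U) V
      = q ^ card (nb V h) * cross U V * (s * qnum q (card (nb U h)) * f U) * g V * R1 hs s t (insert h A) v"
    using Cons.IH[OF admissible_step[OF adm], of "insert h U" V v] UV tracks_keep[OF tr] fin f Cons.prems(4)
    by (simp add: cross_insert_left)
  show ?case
  proof (cases "v \<in> nb A h")
    case True
    then have nV1: "nb V h = {v}" using nV by auto
    then have "ext2 hs f g U (insert h V) = 0"
      using grows_stable_zero[OF assms(6), of V h] by (intro ext2_zero_right) auto
    then show ?thesis using True IHU nV1 c by (simp add: mult_ac)
  next
    case False
    then have nV0: "nb V h = {}" using nV by auto
    have "ext2 hs f g U (insert h V) = cross U V * f U * (- t * g V) * R1 hs s t (insert h A) h"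
      using Cons.IH[OF admissible_step[OF adm], of U "insert h V" h] UV fin Cons.prems(4)
        tracks_new[OF tr nV0 adm] assms(6) nV0 hA
      by (auto simp: cross_insert_right grows_stable_def)
    then show ?thesis using False IHU nV0 c by (simp add: algebra_simps)
  qed
qed simp

lemma ext2_R2:
  assumes "admissible hs A" "U \<union> V = A" "U \<inter> V = {}" "\<forall>h\<in>set hs. \<alpha> < h"
    and "grows_rooted \<alpha> s f" "grows_stable \<alpha> t g" "tracks hs A V v"
  shows "ext2 hs g f V U = cross V U * g V * f U * R2 hs s t A v"
  using assms(1-4,7)
proof (induction hs arbitrary: A U V v)
  case (Cons h hs)
  note adm = Cons.prems(1) and UV = Cons.prems(2,3) and tr = Cons.prems(5)
  have finA: "finite A" and hA: "\<forall>x\<in>A. x < h" using adm by (auto simp: admissible_def)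
  have fin: "finite U" "finite V" "\<forall>x\<in>U. x < h" "\<forall>x\<in>V. x < h" "h \<notin> U" "h \<notin> V" "\<alpha> < h"
    using UV finA hA Cons.prems(4) by auto
  have c: "card (nb A h) = card (nb U h) + card (nb V h)" using card_nb_Un[OF UV(2), of h] UV(1) by simp
  have nV: "nb V h = nb A h \<inter> {v}" using tr by (simp add: tracks_def)
  have f: "f (insert h U) = s * qnum q (card (nb U h)) * f U"
    using assms(5) fin by (simp add: grows_rooted_def)
  have IHU: "ext2 hs g f V (insert h U)
      = cross V U * g V * (s * qnum q (card (nb U h)) * f U) * R2 hs s t (insert h A) v"
    using Cons.IH[OF admissible_step[OF adm], of "insert h U" V v] UV tracks_keep[OF tr] fin f Cons.prems(4)
    by (simp add: cross_insert_right)
  show ?case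
  proof (cases "v \<in> nb A h")
    case True
    then have nV1: "nb V h = {v}" using nV by auto
    then have "ext2 hs g f (insert h V) U = 0"
      using grows_stable_zero[OF assms(6), of V h] by (intro ext2_zero_left) auto
    then show ?thesis using True IHU nV1 c by (simp add: mult_ac)
  next
    case False
    then have nV0: "nb V h = {}" using nV by auto
    have "ext2 hs g f (insert h V) U
        = q ^ card (nb U h) * cross V U * (- t * g V) * f U * R2 hs s t (insert h A) h"
      using Cons.IH[OF admissible_step[OF adm], of U "insert h V" h] UV fin Cons.prems(4)
        tracks_new[OF tr nV0 adm] assms(6) nV0 hA
      by (auto simp: cross_insert_left grows_stable_def)
    then show ?thesis using False IHU nV0 c by (simp add: algebra_simps)
  qed
qed simp

lemma ext3_R3:
  assumes "admissible hs A" "P \<union> V \<union> W = A" "P \<inter> V = {}" "P \<inter> W = {}" "V \<inter> W = {}" "\<forall>h\<in>set hs. \<alpha> < h"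
    and "grows_stable \<alpha> s f" "grows_stable \<alpha> t g" "grows_free \<alpha> s k" "tracks hs A P i" "tracks hs A V j"
  shows "ext3 hs f g k P V W = cross P (V \<union> W) * cross V W * f P * g V * k W * R3 hs s t A i j"
  using assms(1-6,10,11)
proof (induction hs arbitrary: A P V W i j)
  case (Cons h hs)
  note adm = Cons.prems(1) and PVW = Cons.prems(2-5) and tr = Cons.prems(7,8)
  have finA: "finite A" and hA: "\<forall>x\<in>A. x < h" using adm by (auto simp: admissible_def)
  have fin: "finite P" "finite V" "finite W" "\<forall>x\<in>P. x < h" "\<forall>x\<in>V. x < h" "\<forall>x\<in>W. x < h"
    "h \<notin> P" "h \<notin> V" "h \<notin> W" "\<alpha> < h"
    using PVW finA hA Cons.prems(6) by auto
  have c: "card (nb A h) = card (nb P h) + card (nb V h) + card (nb W h)"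
    "card (nb (V \<union> W) h) = card (nb V h) + card (nb W h)"
    using card_nb_Un[of P "V \<union> W" h] card_nb_Un[of V W h] PVW
    by (simp_all add: Un_assoc Int_Un_distrib flip: PVW(1))
  have nP: "nb P h = nb A h \<inter> {i}" and nV: "nb V h = nb A h \<inter> {j}" using tr by (simp_all add: tracks_def)
  let ?A = "insert h A"
  let ?T = "cross P (V \<union> W) * cross V W * f P * g V * k W"
  note IH = Cons.IH[OF admissible_step[OF adm]]
  have kW: "k (insert h W) = s * qnum q (Suc (card (nb W h))) * k W"
    using assms(9) fin by (simp add: grows_free_def)
  have W: "ext3 hs f g k P V (insert h W) = ?T * (s * qnum q (Suc (card (nb W h))) * R3 hs s t ?A i j)"
  proof -
    have "cross P (V \<union> insert h W) = cross P (V \<union> W)" "cross V (insert h W) = cross V W"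
      using fin by (simp_all add: cross_insert_right)
    then show ?thesis
      using IH[of P V "insert h W" i j] PVW tracks_keep[OF tr(1)] tracks_keep[OF tr(2)] fin kW Cons.prems(6)
      by (simp add: mult_ac)
  qed
  have P1: "ext3 hs f g k (insert h P) V W = 0" if "i \<in> nb A h"
    using grows_stable_zero[OF assms(7), of P h] that nP by (intro ext3_zero_left) auto
  have V1: "ext3 hs f g k P (insert h V) W = 0" if "j \<in> nb A h"
    using grows_stable_zero[OF assms(8), of V h] that nV by (intro ext3_zero_mid) auto
  have P0: "ext3 hs f g k (insert h P) V W = ?T * (- s * q ^ card (nb A h) * R3 hs s t ?A h j)"
    if "i \<notin> nb A h"
  proof -
    have e: "nb P h = {}" using nP that by auto
    have "f (insert h P) = - s * f P" using assms(7) e fin by (simp add: grows_stable_def)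
    moreover have "cross (insert h P) (V \<union> W) = q ^ card (nb A h) * cross P (V \<union> W)"
      using fin c e by (simp add: cross_insert_left)
    moreover have "tracks hs ?A (insert h P) h"
      by (rule tracks_new[OF tr(1) e adm]) (use PVW in auto)
    ultimately show ?thesis
      using IH[of "insert h P" V W h j] PVW tracks_keep[OF tr(2)] fin Cons.prems(6)
      by (simp add: mult_ac)
  qed
  have V0: "ext3 hs f g k P (insert h V) W = ?T * (- t * q ^ card (nb W h) * R3 hs s t ?A i h)"
    if "j \<notin> nb A h"
  proof -
    have e: "nb V h = {}" using nV that by auto
    have "g (insert h V) = - t * g V" using assms(8) e fin by (simp add: grows_stable_def)
    moreover have "cross (insert h V) W = q ^ card (nb W h) * cross V W"
      using fin by (simp add: cross_insert_left)
    moreover have "cross P (insert h V \<union> W) = cross P (V \<union> W)"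
      using fin by (simp add: cross_insert_right)
    moreover have "tracks hs ?A (insert h V) h"
      by (rule tracks_new[OF tr(2) e adm]) (use PVW in auto)
    ultimately show ?thesis
      using IH[of P "insert h V" W i h] PVW tracks_keep[OF tr(1)] fin Cons.prems(6)
      by (simp add: mult_ac)
  qed
  have nc: "card (nb P h) = of_bool (i \<in> nb A h)" "card (nb V h) = of_bool (j \<in> nb A h)"
    unfolding nP nV by auto
  show ?case
    using W P1 V1 P0 V0 c nc
    by (cases "i \<in> nb A h"; cases "j \<in> nb A h") (simp_all add: algebra_simps)
qed simp

end

text \<open>
  The root will be the letter \<open>Suc a\<close> of a triple of the second type. All smaller letters from
  \<open>i + 2\<close> on are adjacent to it.
\<close>

locale rooted_interval_graph = interval_graph +
  fixes \<alpha> :: nat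
  assumes root_reach: "\<alpha> \<le> m x"
begin

text \<open>
  \<open>tau\<close> and \<open>kap\<close> are carried by stable sets above the root and by stable sets whose lowest vertex
  is the root; \<open>free\<close> is the word function of the graph without the root. The functions \<open>low\<close>,
  \<open>lowq\<close> and \<open>alph\<close> are weights of the letters in one of two new cycles. Below the root every vertex
  has an extra position, because the opening letter of its cycle is adjacent to it, and the factor
  \<open>q\<close> in \<open>lowq\<close> and \<open>alph\<close> accounts for the opening letter of the other cycle or for the edge to the
  root. The functions \<open>kap\<close> and \<open>alph\<close> are supported on sets containing the root, the others on sets
  without it.
\<close>

definition tau :: "'a \<Rightarrow> nat set \<Rightarrow> 'a" where
  "tau t = stab {\<alpha><..} t"

definition kap :: "'a \<Rightarrow> nat set \<Rightarrow> 'a" where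
  "kap t U = of_bool (\<alpha> \<in> U) * stab {\<alpha>..} t U"

definition free :: "'a \<Rightarrow> nat set \<Rightarrow> 'a" where
  "free t = wrd (- {\<alpha>}) t"

definition low :: "'a \<Rightarrow> nat set \<Rightarrow> 'a" where
  "low t = prodw (\<lambda>h k. if h < \<alpha> then t * qnum q (Suc k) else if h = \<alpha> then 0 else t * qnum q k)"

definition lowq :: "'a \<Rightarrow> nat set \<Rightarrow> 'a" where
  "lowq t = prodw (\<lambda>h k. if h < \<alpha> then t * q * qnum q (Suc k) else if h = \<alpha> then 0 else t * qnum q k)"

definition alph :: "'a \<Rightarrow> nat set \<Rightarrow> 'a" where
  "alph t U = of_bool (\<alpha> \<in> U) *
     prodw (\<lambda>h k. if h < \<alpha> then t * q * qnum q (Suc k) else if h = \<alpha> then t else t * qnum q k) U"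

lemma lowq_root: "\<alpha> \<in> U \<Longrightarrow> lowq t U = 0"
  by (auto simp: lowq_def prodw_def intro!: prod_zero)

lemma free_root: "\<alpha> \<in> U \<Longrightarrow> free t U = 0"
  by (auto simp: free_def wrd_def prodw_def intro!: prod_zero)

text \<open>
  Below the root the first factor contributes only the empty set, so the vertices keep their weights
  in \<open>free\<close>. Above the root the two parts combine as in \<open>stab \<star> wrd\<close>, which removes the extra
  position.
\<close>

lemma tau_conv_free: "tau t \<star> free t = low t"
  unfolding low_def
proof (rule prodw_unique)
  fix S h assume S: "finite S" "\<forall>x\<in>S. x < (h::nat)"
  show "(tau t \<star> free t) (insert h S) =
     (if h < \<alpha> then t * qnum q (Suc (card (nb S h))) else if h = \<alpha> then 0 else t * qnum q (card (nb S h)))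
     * (tau t \<star> free t) S"
  proof (rule conv_rec[OF S], goal_cases)
    case (1 U V)
    then have U: "finite U" "finite V" "\<forall>x\<in>U. x < h" "\<forall>x\<in>V. x < h"
      using S by auto
    show ?case
    proof (cases "stab {\<alpha><..} t U = 0")
      case True
      then show ?thesis
        using U by (simp add: tau_def stab_insert_max)
    next
      case False
      have c: "card (nb S h) = card (nb U h) + card (nb V h)"
        using card_nb_Un[of U V h] 1 by auto
      have "card (nb U h) = 0 \<or> card (nb U h) = Suc 0"
        using stab_card_nb_le_1[OF False, of h] by linarith
      moreover have "U = {}" if "h < \<alpha>"
        using stab_nonzeroD(2)[OF False] U that by fastforce
      ultimately show ?thesis
        unfolding c using U
        by (auto simp: tau_def free_def stab_insert_max wrd_insert_max qnum_Suc algebra_simps)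
    qed
  qed
next
  show "(tau t \<star> free t) {} = 1" by (simp add: conv_def tau_def free_def stab_def wrd_def)
qed (simp add: conv_infinite)

text \<open>
  A set occurring in \<open>kap\<close> has the root as its lowest vertex. When the root is added, all smaller
  vertices lie in the other part and are adjacent to it, which produces the power of \<open>q\<close> by which
  \<open>alph\<close> differs from \<open>free\<close> below the root.
\<close>

lemma kap_conv_free: "kap t \<star> free t = (\<lambda>S. - alph t S)"
proof
  fix S
  show "(kap t \<star> free t) S = - alph t S"
  proof (cases "finite S")
    case True
    then show ?thesis
    proof (induction S rule: finite_linorder_max_induct)
      case empty
      then show ?case by (simp add: conv_def kap_def alph_def)
    next
      case (insert h S)
      have S: "finite S" "\<forall>x\<in>S. x < h" using insert by auto
      consider (1) "\<alpha> \<notin> insert h S" | (2) "h = \<alpha>" | (3) "\<alpha> \<in> S" "h \<noteq> \<alpha>" by auto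
      then show ?case
      proof cases
        case 1
        then have "kap t U = 0" if "U \<subseteq> insert h S" for U using that by (auto simp: kap_def)
        then show ?thesis using 1 by (simp add: conv_def alph_def)
      next
        case 2
        have nb: "nb S \<alpha> = S" using S 2 root_reach by (auto simp: nb_def)
        have kap0: "kap t U = 0" if "U \<subseteq> S" for U using that S 2 by (auto simp: kap_def)
        have kap1: "kap t (insert \<alpha> U) = (if U = {} then - t else 0)" if "U \<subseteq> S" for U
        proof -
          have U: "finite U" "\<forall>x\<in>U. x < \<alpha>" using that S 2 finite_subset by auto
          show ?thesis
          proof (cases "U = {}")
            case True
            then show ?thesis using stab_insert_max[of "{}" \<alpha> "{\<alpha>..}" t]
              by (simp add: kap_def stab_def nb_def)
          next
            case False
            then obtain x where "x \<in> U" by blast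
            then have "\<not> U \<subseteq> {\<alpha>..}" using U(2) by force
            then have "stab {\<alpha>..} t U = 0" using stab_nonzeroD(2) by blast
            then show ?thesis using False U by (simp add: kap_def stab_insert_max)
          qed
        qed
        have "(kap t \<star> free t) (insert \<alpha> S) = (\<Sum>U\<in>Pow S. if U = {} then q ^ card S * (- t) * free t S else 0)"
          unfolding conv_insert_max[OF S[unfolded 2]]
          by (rule sum.cong) (auto simp: kap0 kap1 nb)
        also have "\<dots> = - (t * (q ^ card S * free t S))"
          using S by (simp add: sum.delta)
        also have "q ^ card S * free t S =
          prodw (\<lambda>h k. if h < \<alpha> then t * q * qnum q (Suc k) else if h = \<alpha> then t else t * qnum q k) S"
          using S 2 unfolding free_def wrd_def prodw_def
          by (auto simp: prod.distrib[symmetric] prod_constant[symmetric] simp del: prod_constant intro!: prod.cong)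
        also have "t * \<dots> = alph t (insert \<alpha> S)"
          using S 2 by (simp add: alph_def prodw_insert_max)
        finally show ?thesis using 2 by simp
      next
        case 3
        then have h: "\<alpha> < h" using S by auto
        have "(kap t \<star> free t) (insert h S) = t * qnum q (card (nb S h)) * (kap t \<star> free t) S"
        proof (rule conv_rec[OF S], goal_cases)
          case (1 U V)
          then have U: "finite U" "finite V" "\<forall>x\<in>U. x < h" "\<forall>x\<in>V. x < h"
            using S by auto
          show ?case
          proof (cases "stab {\<alpha>..} t U = 0")
            case True
            then show ?thesis
              using U h by (simp add: kap_def stab_insert_max)
          next
            case False
            have c: "card (nb S h) = card (nb U h) + card (nb V h)"
              using card_nb_Un[of U V h] 1 by auto
            have "card (nb U h) = 0 \<or> card (nb U h) = Suc 0"
              using stab_card_nb_le_1[OF False, of h] by linarith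
            then show ?thesis
              unfolding c using U h
              by (auto simp: kap_def free_def stab_insert_max wrd_insert_max qnum_Suc algebra_simps)
          qed
        qed
        moreover have "h \<noteq> \<alpha>" "\<not> h < \<alpha>" using h by auto
        ultimately show ?thesis using insert.IH 3 by (simp add: alph_def prodw_insert_max[OF S] mult_ac)
      qed
    qed
  qed (simp add: conv_infinite alph_def prodw_infinite)
qed

lemma grows:
  "grows_rooted \<alpha> s (lowq s)" "grows_rooted \<alpha> s (alph s)" "grows_free \<alpha> s (free s)"
  "grows_stable \<alpha> t (tau t)" "grows_stable \<alpha> t (kap t)"
proof -
  show "grows_rooted \<alpha> s (lowq s)"
    by (simp add: grows_rooted_def lowq_def prodw_insert_max)
  show "grows_rooted \<alpha> s (alph s)"
    by (simp add: grows_rooted_def alph_def prodw_insert_max)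
  show "grows_free \<alpha> s (free s)"
    by (simp add: grows_free_def free_def wrd_insert_max)
  show "grows_stable \<alpha> t (tau t)"
    using stab_nonzeroD(3)[of "{\<alpha><..}" t] by (simp add: grows_stable_def tau_def stab_insert_max)
  show "grows_stable \<alpha> t (kap t)"
    using stab_nonzeroD(3)[of "{\<alpha>..}" t] by (simp add: grows_stable_def kap_def stab_insert_max)
qed

text \<open>
  Fix the part \<open>A\<close> of \<open>S\<close> up to the root. Because \<open>tau\<close> avoids \<open>A\<close>, \<open>kap\<close> meets it in the root
  alone, and \<open>lowq\<close> and \<open>free\<close> avoid the root, each of the four products has just one splitting of
  \<open>A\<close> that contributes. The sum over its extensions to the vertices above the root is one of the
  factors \<open>R1\<close>, \<open>R2\<close>, \<open>R3\<close>, up to the common factor \<open>lowq s B\<close> of the part \<open>B\<close> below the root.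
\<close>

lemma key_identity:
  assumes S: "finite S" "0 \<notin> S"
  shows "(lowq s \<star> kap t) S + (alph s \<star> tau t) S = (tau s \<star> (kap t \<star> free s)) S + (tau t \<star> alph s) S"
proof (cases "\<alpha> \<in> S")
  case False
  have z: "kap t U = 0" "alph s U = 0" if "U \<subseteq> S" for U
    using False that by (auto simp: kap_def alph_def)
  have "(kap t \<star> free s) U = 0" if "U \<subseteq> S" for U
    unfolding conv_def by (rule sum.neutral) (use z that in auto)
  then have "(tau s \<star> (kap t \<star> free s)) S = 0"
    unfolding conv_def[of "tau s"] by (intro sum.neutral) auto
  moreover have "(lowq s \<star> kap t) S = 0" "(alph s \<star> tau t) S = 0" "(tau t \<star> alph s) S = 0"
    unfolding conv_def by (rule sum.neutral, use z in auto)+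
  ultimately show ?thesis by simp
next
  case True
  define A where "A = {x\<in>S. x \<le> \<alpha>}"
  define B where "B = {x\<in>S. x < \<alpha>}"
  define hs where "hs = sorted_list_of_set {x\<in>S. \<alpha> < x}"
  have hs: "set hs = {x\<in>S. \<alpha> < x}" "distinct hs" "sorted_wrt (<) hs"
    unfolding hs_def using S by (simp_all del: set_sorted_list_of_set add: set_sorted_list_of_set)
  have SA: "S = A \<union> set hs" unfolding hs(1) A_def by auto
  have AB: "A = insert \<alpha> B" using True by (auto simp: A_def B_def)
  have fin: "finite A" "finite B" using S by (simp_all add: A_def B_def)
  have B: "\<forall>x\<in>B. x < \<alpha>" "\<alpha> \<notin> B" "0 \<notin> B" using S by (auto simp: B_def)
  have adm: "admissible hs A" using S hs(3) fin unfolding admissible_def hs(1) A_def by auto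
  have disj: "A \<inter> set hs = {}" unfolding hs(1) A_def by auto
  have big: "\<forall>h\<in>set hs. \<alpha> < h" unfolding hs(1) by simp
  have \<alpha>0: "\<alpha> \<noteq> 0" using True S by metis
  have nb\<alpha>: "nb B \<alpha> = B" using B root_reach by (auto simp: nb_def)
  have tr0: "tracks hs A {} 0" using adm by (auto simp: tracks_def admissible_def nb_def)
  have tr\<alpha>: "tracks hs A {\<alpha>} \<alpha>" using big AB by (auto simp: tracks_def nb_def)
  have z2: "kap t U = 0" if "\<alpha> \<notin> U \<or> U \<inter> B \<noteq> {}" for U
    using that B stab_nonzeroD(2)[of "{\<alpha>..}" t U] by (force simp: kap_def)
  have z3: "tau r U = 0" if "U \<inter> A \<noteq> {}" for U r
    using that stab_nonzeroD(2)[of "{\<alpha><..}" r U] by (force simp: tau_def A_def)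
  have v1: "kap t {\<alpha>} = - t" "tau r {} = 1" for r
    using stab_insert_max[of "{}" \<alpha> "{\<alpha>..}" t] by (simp_all add: kap_def tau_def stab_def)
  have v2: "alph s A = s * lowq s B"
    unfolding AB alph_def using B fin
    by (simp add: prodw_insert_max mult.commute lowq_def) (auto simp: prodw_def intro!: prod.cong)
  have v3: "lowq s B = q ^ card B * free s B"
    using fin B by (auto simp: lowq_def free_def wrd_def prodw_def prod.distrib[symmetric]
        prod_constant[symmetric] simp del: prod_constant intro!: prod.cong)
  have cr: "cross B {\<alpha>} = 1" "cross {\<alpha>} B = q ^ card B"
  proof -
    have "nb {\<alpha>} x = {}" if "x \<in> B" for x using that B(1) by (auto simp: nb_def)
    then show "cross B {\<alpha>} = 1" unfolding cross_def by (intro prod.neutral) simp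
  qed (simp add: cross_def nb\<alpha>)
  have T1: "(lowq s \<star> kap t) S = - t * lowq s B * R1 hs s t A \<alpha>"
  proof -
    have "(lowq s \<star> kap t) S = (\<Sum>U\<in>Pow A. ext2 hs (lowq s) (kap t) U (A - U))"
      unfolding SA by (rule conv_ext2[OF fin(1) disj hs(2)])
    also have "\<dots> = (\<Sum>U\<in>{B}. ext2 hs (lowq s) (kap t) U (A - U))"
    proof (rule sum.mono_neutral_right)
      show "\<forall>U\<in>Pow A - {B}. ext2 hs (lowq s) (kap t) U (A - U) = 0"
      proof
        fix U assume U: "U \<in> Pow A - {B}"
        then have "\<alpha> \<in> U \<or> (A - U) \<inter> B \<noteq> {}" using AB B by auto
        then show "ext2 hs (lowq s) (kap t) U (A - U) = 0"
          by (elim disjE; intro ext2_zero_left ext2_zero_right lowq_root z2) auto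
      qed
    qed (use fin AB in auto)
    also have "\<dots> = ext2 hs (lowq s) (kap t) B {\<alpha>}" using AB B by (simp add: insert_Diff_if)
    also have "\<dots> = cross B {\<alpha>} * lowq s B * kap t {\<alpha>} * R1 hs s t A \<alpha>"
      by (rule ext2_R1[OF adm _ _ big grows(1) grows(5) tr\<alpha>]) (use AB B in auto)
    finally show ?thesis by (simp add: cr v1)
  qed
  have T2: "(alph s \<star> tau t) S = s * lowq s B * R1 hs s t A 0"
  proof -
    have "(alph s \<star> tau t) S = (\<Sum>U\<in>Pow A. ext2 hs (alph s) (tau t) U (A - U))"
      unfolding SA by (rule conv_ext2[OF fin(1) disj hs(2)])
    also have "\<dots> = (\<Sum>U\<in>{A}. ext2 hs (alph s) (tau t) U (A - U))"
      by (rule sum.mono_neutral_right) (use fin in \<open>auto intro!: ext2_zero_right z3\<close>)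
    also have "\<dots> = ext2 hs (alph s) (tau t) A {}" by simp
    also have "\<dots> = cross A {} * alph s A * tau t {} * R1 hs s t A 0"
      by (rule ext2_R1[OF adm _ _ big grows(2) grows(4) tr0]) auto
    finally show ?thesis by (simp add: v1 v2)
  qed
  have T3: "(tau t \<star> alph s) S = s * lowq s B * R2 hs s t A 0"
  proof -
    have "(tau t \<star> alph s) S = (\<Sum>U\<in>Pow A. ext2 hs (tau t) (alph s) U (A - U))"
      unfolding SA by (rule conv_ext2[OF fin(1) disj hs(2)])
    also have "\<dots> = (\<Sum>U\<in>{{}}. ext2 hs (tau t) (alph s) U (A - U))"
      by (rule sum.mono_neutral_right) (use fin in \<open>auto intro!: ext2_zero_left z3\<close>)
    also have "\<dots> = ext2 hs (tau t) (alph s) {} A" by simp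
    also have "\<dots> = cross {} A * tau t {} * alph s A * R2 hs s t A 0"
      by (rule ext2_R2[OF adm _ _ big grows(2) grows(4) tr0]) auto
    finally show ?thesis by (simp add: v1 v2)
  qed
  have T4: "(tau s \<star> (kap t \<star> free s)) S = - t * lowq s B * R3 hs s t A 0 \<alpha>"
  proof -
    let ?E = "ext3 hs (tau s) (kap t) (free s)"
    have "(tau s \<star> (kap t \<star> free s)) S = (\<Sum>P\<in>Pow A. \<Sum>V\<in>Pow (A - P). ?E P V (A - P - V))"
      unfolding SA by (rule conv_ext3[OF fin(1) disj hs(2)])
    also have "\<dots> = (\<Sum>P\<in>{{}}. \<Sum>V\<in>Pow (A - P). ?E P V (A - P - V))"
      by (rule sum.mono_neutral_right) (use fin in \<open>auto intro!: sum.neutral ext3_zero_left z3\<close>)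
    also have "\<dots> = (\<Sum>V\<in>Pow A. ?E {} V (A - V))" by simp
    also have "\<dots> = (\<Sum>V\<in>{{\<alpha>}}. ?E {} V (A - V))"
    proof (rule sum.mono_neutral_right)
      show "\<forall>V\<in>Pow A - {{\<alpha>}}. ?E {} V (A - V) = 0"
      proof
        fix V assume V: "V \<in> Pow A - {{\<alpha>}}"
        then have "\<alpha> \<in> A - V \<or> V \<inter> B \<noteq> {}" using AB B by auto
        then show "?E {} V (A - V) = 0"
          by (elim disjE; intro ext3_zero_mid ext3_zero_right free_root z2) auto
      qed
    qed (use fin AB in auto)
    also have "\<dots> = ?E {} {\<alpha>} B" using AB B by simp
    also have "\<dots> = cross {} ({\<alpha>} \<union> B) * cross {\<alpha>} B * tau s {} * kap t {\<alpha>} * free s B * R3 hs s t A 0 \<alpha>"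
      by (rule ext3_R3[OF adm _ _ _ _ big grows(4) grows(5) grows(3) tr0 tr\<alpha>]) (use AB B in auto)
    finally show ?thesis by (simp add: cr v1 v3)
  qed
  have "t * R1 hs s t A \<alpha> - t * R3 hs s t A 0 \<alpha> = s * R1 hs s t A 0 - s * R2 hs s t A 0"
    by (rule R_key[OF adm]) (auto simp: A_def True)
  then have "lowq s B * (t * R1 hs s t A \<alpha> - t * R3 hs s t A 0 \<alpha>)
      = lowq s B * (s * R1 hs s t A 0 - s * R2 hs s t A 0)" by simp
  then show ?thesis unfolding T1 T2 T3 T4 by (simp add: algebra_simps)
qed

lemma conv_cong_left: "(\<And>U. U \<subseteq> S \<Longrightarrow> f U = f' U) \<Longrightarrow> (f \<star> g) S = (f' \<star> g) S"
  unfolding conv_def by (rule sum.cong) auto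

text \<open>
  The generating function of the splitting weights of two new cycles, where \<open>s\<close> and \<open>t\<close> mark the
  vertices of the first and the second cycle.
\<close>

definition swap_defect :: "'a \<Rightarrow> 'a \<Rightarrow> nat set \<Rightarrow> 'a" where
  "swap_defect s t S = (lowq s \<star> alph t) S - (alph s \<star> low t) S"

lemma swap_defect_eq:
  assumes S: "finite S" "0 \<notin> S"
  shows "swap_defect s t S = (tau t \<star> kap s \<star> free s \<star> free t) S - (tau s \<star> kap t \<star> free s \<star> free t) S"
proof -
  have alph: "alph r = (\<lambda>S. - (kap r \<star> free r) S)" for r by (simp add: kap_conv_free)
  have "(lowq s \<star> alph t) S = - ((lowq s \<star> kap t) \<star> free t) S"
    by (simp add: alph[of t] conv_uminus_right conv_assoc)
  moreover have "(alph s \<star> low t) S = ((alph s \<star> tau t) \<star> free t) S"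
    by (simp add: conv_assoc tau_conv_free)
  moreover have "((lowq s \<star> kap t) \<star> free t) S + ((alph s \<star> tau t) \<star> free t) S
      = ((\<lambda>S. (lowq s \<star> kap t) S + (alph s \<star> tau t) S) \<star> free t) S"
    by (simp add: conv_add_left)
  moreover have "\<dots> = ((\<lambda>S. (tau s \<star> (kap t \<star> free s)) S + (tau t \<star> alph s) S) \<star> free t) S"
    by (rule conv_cong_left, rule key_identity) (use S finite_subset in auto)
  moreover have "\<dots> = (tau s \<star> kap t \<star> free s \<star> free t) S - (tau t \<star> kap s \<star> free s \<star> free t) S"
    by (simp add: conv_diff_left conv_assoc alph[of s] conv_uminus_right conv_uminus_left)
  ultimately show ?thesis by (simp add: swap_defect_def algebra_simps)
qed

text \<open>
  By the key identity the defect is the difference of two products that arise from each other by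
  exchanging \<open>s\<close> and \<open>t\<close> in all factors except \<open>free s \<star> free t\<close>, and these two commute.
\<close>

theorem swap_defect_antisym:
  assumes "finite S" "0 \<notin> S"
  shows "swap_defect s t S + swap_defect t s S = 0"
  unfolding swap_defect_eq[OF assms] using wrd_commute[of "- {\<alpha>}" s t]
  by (simp add: free_def)

end

section \<open>Vanishing of symmetric sums over splittings\<close>

lemma const_poly_power: "[:c:] ^ n = [:c ^ n:]" for c :: "'a::comm_ring_1"
  by (induction n) (simp_all add: mult.commute one_pCons)

lemma const_poly_prod: "(\<Prod>x\<in>A. [:f x:]) = [:\<Prod>x\<in>A. f x:]" for f :: "'b \<Rightarrow> 'a::comm_ring_1"
  by (induction A rule: infinite_finite_induct) (simp_all add: one_pCons mult.commute)

lemma const_poly_qnum: "qnum [:z:] n = [:qnum z n:]"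
  by (induction n) (simp_all add: qnum_Suc const_poly_power)

context rooted_interval_graph
begin

text \<open>
  The factor of a vertex \<open>h\<close> that joins the first or the second of two new cycles with vertex sets
  \<open>U\<close> and \<open>V\<close>. The root contributes with opposite signs to the two cycles; \<open>of_bool (h < \<alpha>)\<close>
  accounts for the opening letters, which are adjacent to the letters below the root.
\<close>

definition left_wt :: "nat set \<Rightarrow> nat set \<Rightarrow> nat \<Rightarrow> 'a" where
  "left_wt U V h = (if h = \<alpha> then - (q ^ card (nb V h))
     else q ^ (card (nb V h) + of_bool (h < \<alpha>)) * qnum q (card (nb U h) + of_bool (h < \<alpha>)))"

definition right_wt :: "nat set \<Rightarrow> nat set \<Rightarrow> nat \<Rightarrow> 'a" where
  "right_wt U V h = (if h = \<alpha> then q ^ card (nb V h)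
     else qnum q (card (nb V h) + of_bool (h < \<alpha>)))"

definition split_wt :: "nat set \<Rightarrow> nat set \<Rightarrow> 'a" where
  "split_wt U V = (\<Prod>h\<in>U. left_wt U V h) * (\<Prod>h\<in>V. right_wt U V h)"

lemma split_wt_right:
  assumes "finite U" "finite V" "\<alpha> \<in> V" "\<alpha> \<notin> U"
  shows "split_wt U V = cross U V * lowq 1 U * alph 1 V"
proof -
  have 1: "(\<Prod>h\<in>U. left_wt U V h) = cross U V * lowq 1 U"
    using assms unfolding cross_def lowq_def prodw_def
    by (auto simp: left_wt_def power_add prod.distrib[symmetric] intro!: prod.cong)
  have nb: "nb V \<alpha> = {h\<in>V. h < \<alpha>}" using root_reach by (auto simp: nb_def)
  have "(\<Prod>h\<in>V. if h < \<alpha> then q else 1) = (\<Prod>h\<in>{h\<in>V. h < \<alpha>}. q)"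
    using assms by (simp add: prod.If_cases Int_def)
  then have 2: "(\<Prod>h\<in>V. if h = \<alpha> then q ^ card (nb V \<alpha>) else 1) = (\<Prod>h\<in>V. if h < \<alpha> then q else 1)"
    using assms by (simp add: nb prod.delta)
  have "(\<Prod>h\<in>V. right_wt U V h) = (\<Prod>h\<in>V. if h = \<alpha> then q ^ card (nb V \<alpha>) else 1)
      * (\<Prod>h\<in>V. if h = \<alpha> then 1 else qnum q (card (nb V h) + of_bool (h < \<alpha>)))"
    unfolding prod.distrib[symmetric] by (rule prod.cong) (auto simp: right_wt_def)
  also have "\<dots> = alph 1 V"
    unfolding 2 prod.distrib[symmetric] alph_def prodw_def using assms
    by (auto intro!: prod.cong)
  finally show ?thesis using 1 by (simp add: split_wt_def)
qed

lemma split_wt_left: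
  assumes "finite U" "finite V" "\<alpha> \<notin> V" "\<alpha> \<in> U"
  shows "split_wt U V = - (cross U V * alph 1 U * low 1 V)"
proof -
  have "(\<Prod>h\<in>V. right_wt U V h) = low 1 V"
    using assms unfolding low_def prodw_def
    by (auto simp: right_wt_def intro!: prod.cong)
  moreover have "(\<Prod>h\<in>U. left_wt U V h) = (\<Prod>h\<in>U. (if h = \<alpha> then - 1 else 1) * (q ^ card (nb V h) *
      (if h < \<alpha> then 1 * q * qnum q (Suc (card (nb U h))) else if h = \<alpha> then 1 else 1 * qnum q (card (nb U h)))))"
    by (rule prod.cong) (auto simp: left_wt_def power_add)
  then have "(\<Prod>h\<in>U. left_wt U V h) = (\<Prod>h\<in>U. if h = \<alpha> then - 1 else 1) * (cross U V * alph 1 U)"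
    using assms unfolding prod.distrib by (simp only: cross_def alph_def prodw_def) simp
  moreover have "(\<Prod>h\<in>U. if h = \<alpha> then - 1 else (1::'a)) = - 1"
    using assms by (simp add: prod.delta)
  ultimately show ?thesis by (simp add: split_wt_def)
qed

text \<open>
  The antisymmetry over the polynomial ring, with \<open>s\<close> specialised to the variable and \<open>t\<close> to \<open>1\<close>. As
  the two sizes add up to \<open>card S\<close>, the variable still records both of them.
\<close>

lemma sum_split_wt_graded:
  assumes S: "finite S" "0 \<notin> S" "\<alpha> \<in> S"
  shows "(\<Sum>U\<in>Pow S. monom (split_wt U (S - U)) (card U)) + (\<Sum>U\<in>Pow S. monom (split_wt U (S - U)) (card (S - U))) = 0"
proof -
  interpret P: rooted_interval_graph m "[:q:]" \<alpha>
    by unfold_locales (auto simp: mono_m root_reach)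
  have cross: "P.cross U V = [:cross U V:]" for U V
    by (simp add: P.cross_def cross_def const_poly_power const_poly_prod)
  have prodw: "P.prodw (\<lambda>h k. s * [:\<psi> h k:]) U = s ^ card U * [:prodw \<psi> U:]" for s \<psi> U
    by (simp add: P.prodw_def prodw_def prod.distrib const_poly_prod del: mult_pCons_left mult_pCons_right)
  have low: "P.low s U = s ^ card U * [:low 1 U:]" for s U
    unfolding low_def P.low_def prodw[symmetric]
    by (intro arg_cong2[of _ _ _ _ P.prodw] ext) (simp_all add: const_poly_qnum)
  have lowq: "P.lowq s U = s ^ card U * [:lowq 1 U:]" for s U
    unfolding lowq_def P.lowq_def prodw[symmetric]
    by (intro arg_cong2[of _ _ _ _ P.prodw] ext) (simp_all add: const_poly_qnum mult_ac)
  have alph: "P.alph s U = s ^ card U * [:alph 1 U:]" for s U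
  proof -
    have "P.prodw (\<lambda>h k. if h < \<alpha> then s * [:q:] * qnum [:q:] (Suc k) else if h = \<alpha> then s else s * qnum [:q:] k) U
        = s ^ card U * [:prodw (\<lambda>h k. if h < \<alpha> then 1 * q * qnum q (Suc k) else if h = \<alpha> then 1 else 1 * qnum q k) U:]"
      unfolding prodw[symmetric]
      by (intro arg_cong2[of _ _ _ _ P.prodw] ext) (simp_all add: const_poly_qnum mult_ac flip: one_pCons)
    then show ?thesis by (simp add: alph_def P.alph_def)
  qed
  have defect: "P.swap_defect s t S = (\<Sum>U\<in>Pow S. s ^ card U * t ^ card (S - U) * [:split_wt U (S - U):])" for s t
    unfolding P.swap_defect_def P.conv_def sum_subtractf[symmetric]
  proof (rule sum.cong[OF refl], goal_cases)
    case (1 U)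
    then have fin: "finite U" "finite (S - U)" using S finite_subset by auto
    show ?case
    proof (cases "\<alpha> \<in> U")
      case True
      then have "P.lowq s U = 0" "P.alph t (S - U) = 0"
        by (simp_all add: P.lowq_root P.alph_def)
      then show ?thesis using True split_wt_left[of U "S - U"] fin
        by (simp add: cross low alph mult_ac)
    next
      case False
      then have "P.alph s U = 0" by (simp add: P.alph_def)
      then show ?thesis using False S split_wt_right[of U "S - U"] fin
        by (simp add: cross lowq alph mult_ac)
    qed
  qed
  have X: "smult c ([:0, 1:] ^ n) = monom c n" for n and c :: 'a
    by (simp add: monom_altdef)
  show ?thesis
    using P.swap_defect_antisym[OF S(1,2), of "[:0, 1:]" 1]
    unfolding defect by (simp add: X)
qed

text \<open>
  By the graded identity, the total weight of the splittings with \<open>card U = k\<close> changes sign when \<open>k\<close>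
  is replaced by \<open>card S - k\<close>, whereas a symmetric \<open>\<phi>\<close> does not change. The sum equals its own
  negative.
\<close>

theorem sum_split_wt_symmetric:
  assumes S: "finite S" "0 \<notin> S" "\<alpha> \<in> S"
    and two: "\<And>x::'a. x + x = 0 \<Longrightarrow> x = 0"
    and sym: "\<And>a b. \<phi> a b = \<phi> b a"
  shows "(\<Sum>U\<in>Pow S. split_wt U (S - U) * \<phi> (card U) (card (S - U))) = 0"
proof -
  define n where "n = card S"
  define A where "A k = (\<Sum>U | U \<in> Pow S \<and> card U = k. split_wt U (S - U))" for k
  have card: "card U \<le> n" "card (S - U) = n - card U" if "U \<in> Pow S" for U
    using that S by (auto simp: n_def card_mono card_Diff_subset finite_subset)
  have anti: "A k + A (n - k) = 0" if k: "k \<le> n" for k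
  proof -
    have "coeff (\<Sum>U\<in>Pow S. monom (split_wt U (S - U)) (card U)) k = A k"
      using S by (simp add: coeff_sum A_def sum.If_cases Int_def if_distrib sum.inter_filter[symmetric])
    moreover have "coeff (\<Sum>U\<in>Pow S. monom (split_wt U (S - U)) (card (S - U))) k
        = (\<Sum>U\<in>Pow S. if card U = n - k then split_wt U (S - U) else 0)"
      unfolding coeff_sum by (rule sum.cong) (use card k in auto)
    moreover have "\<dots> = A (n - k)"
      using S by (simp add: A_def sum.inter_filter[symmetric])
    ultimately show ?thesis
      using arg_cong[OF sum_split_wt_graded[OF S], of "\<lambda>p. coeff p k"] by simp
  qed
  define T where "T = (\<Sum>k\<le>n. A k * \<phi> k (n - k))"
  have "(\<Sum>U\<in>Pow S. split_wt U (S - U) * \<phi> (card U) (card (S - U)))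
      = (\<Sum>k\<le>n. \<Sum>U | U \<in> Pow S \<and> card U = k. split_wt U (S - U) * \<phi> (card U) (card (S - U)))"
    by (rule sum.group[symmetric]) (use S card in auto)
  also have "\<dots> = T"
    unfolding T_def A_def sum_distrib_right
    by (intro sum.cong refl) (use card in auto)
  finally have eq: "(\<Sum>U\<in>Pow S. split_wt U (S - U) * \<phi> (card U) (card (S - U))) = T" .
  have reflect: "T = (\<Sum>k\<le>n. A (n - k) * \<phi> (n - k) k)"
    unfolding T_def by (rule sum.reindex_bij_witness[of _ "\<lambda>k. n - k" "\<lambda>k. n - k"]) auto
  have "T + T = (\<Sum>k\<le>n. A k * \<phi> k (n - k)) + (\<Sum>k\<le>n. A (n - k) * \<phi> k (n - k))"
    by (subst (2) reflect) (simp add: T_def sym[of "n - _"])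
  also have "\<dots> = (\<Sum>k\<le>n. (A k + A (n - k)) * \<phi> k (n - k))"
    by (simp add: sum.distrib[symmetric] distrib_right)
  also have "\<dots> = 0" by (rule sum.neutral) (simp add: anti)
  finally show ?thesis using two eq by simp
qed

end

section \<open>Sums over colourings and triples of the first type\<close>

text \<open>
  A colouring of the letters \<open>1, \<dots>, length cs\<close> is a list with the colour of the largest letter at
  its head, so that the letter at the head of \<open>c # cs\<close> is \<open>Suc (length cs)\<close>. The number
  \<open>cnt m h P cs\<close> counts the neighbours of \<open>h\<close> whose colour satisfies \<open>P\<close>.
\<close>

primrec cnt :: "(nat \<Rightarrow> nat) \<Rightarrow> nat \<Rightarrow> (nat \<Rightarrow> bool) \<Rightarrow> nat list \<Rightarrow> nat" where
  "cnt m h P [] = 0"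
| "cnt m h P (c # cs) = cnt m h P cs + of_bool (h \<le> m (Suc (length cs)) \<and> P c)"

text \<open>
  The colours in use are \<open>0, \<dots>, ncol cs - 1\<close>, so \<open>ncol cs\<close> is the colour of the next new cycle.
\<close>

primrec ncol :: "nat list \<Rightarrow> nat" where
  "ncol [] = 0"
| "ncol (c # cs) = max (Suc c) (ncol cs)"

text \<open>
  The total weight of all ways to insert the next letter into the cycle \<open>c\<close>. A new cycle, with
  \<open>c = ncol cs\<close>, offers one position although it contains no neighbour.
\<close>

definition step_wt :: "'a::comm_ring_1 \<Rightarrow> (nat \<Rightarrow> nat) \<Rightarrow> nat list \<Rightarrow> nat \<Rightarrow> 'a" where
  "step_wt z m cs c = z ^ cnt m (Suc (length cs)) (\<lambda>d. c < d) cs *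
     qnum z (cnt m (Suc (length cs)) (\<lambda>d. d = c) cs + of_bool (c = ncol cs))"

text \<open>
  The sum of \<open>F\<close> over all continuations of \<open>cs\<close> by \<open>r\<close> letters, each weighted by the product of its
  steps.
\<close>

primrec val :: "(nat list \<Rightarrow> nat \<Rightarrow> 'a::comm_ring_1) \<Rightarrow> (nat list \<Rightarrow> 'a) \<Rightarrow> nat \<Rightarrow> nat list \<Rightarrow> 'a" where
  "val w F 0 cs = F cs"
| "val w F (Suc r) cs = (\<Sum>c\<le>ncol cs. w cs c * val w F r (c # cs))"

lemma ncol_gt: "d \<in> set cs \<Longrightarrow> d < ncol cs"
  by (induction cs) auto

lemma cnt_eq_0: "(\<And>d. d \<in> set cs \<Longrightarrow> \<not> P d) \<Longrightarrow> cnt m h P cs = 0"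
  by (induction cs) auto

lemma cnt_cong:
  "(\<And>x. 1 \<le> x \<Longrightarrow> x \<le> length cs \<Longrightarrow> (h \<le> m x \<longleftrightarrow> h' \<le> m' x)) \<Longrightarrow> cnt m h P cs = cnt m' h' P cs"
  by (induction cs) auto

lemma cnt_swap:
  "(h \<le> m (Suc (length cs)) \<longleftrightarrow> h \<le> m (Suc (Suc (length cs)))) \<Longrightarrow>
   cnt m h P (ds @ c # c' # cs) = cnt m h P (ds @ c' # c # cs)"
  by (induction ds) auto

lemma ncol_swap: "ncol (ds @ c # c' # cs) = ncol (ds @ c' # c # cs)"
  by (induction ds) auto

lemma step_wt_cong:
  "(\<And>x. 1 \<le> x \<Longrightarrow> x \<le> length cs \<Longrightarrow> (Suc (length cs) \<le> m x \<longleftrightarrow> Suc (length cs) \<le> m' x)) \<Longrightarrow>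
   step_wt z m cs c = step_wt z m' cs c"
  unfolding step_wt_def by (subst (1 2) cnt_cong[of cs _ m _ m']) auto

lemma step_wt_swap:
  "(Suc (length (ds @ c # c' # cs)) \<le> m (Suc (length cs)) \<longleftrightarrow>
    Suc (length (ds @ c # c' # cs)) \<le> m (Suc (Suc (length cs)))) \<Longrightarrow>
   step_wt z m (ds @ c # c' # cs) d = step_wt z m (ds @ c' # c # cs) d"
  unfolding step_wt_def ncol_swap[of ds c c'] by (subst (1 2) cnt_swap) auto

lemma val_cong:
  assumes "\<And>es c. length cs \<le> length es \<Longrightarrow> length es < length cs + r \<Longrightarrow> w es c = w' es c"
  shows "val w F r cs = val w' F r cs"
  using assms
proof (induction r arbitrary: cs)
  case (Suc r)
  have "val w F r (c # cs) = val w' F r (c # cs)" for c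
    by (rule Suc.IH, rule Suc.prems) simp_all
  then show ?case using Suc.prems by simp
qed simp

text \<open>
  Two adjacent letters with the same later neighbours are indistinguishable for all later steps.
\<close>

lemma val_swap:
  assumes "\<And>h. length (ds @ c # c' # cs) < h \<Longrightarrow>
      (h \<le> m (Suc (length cs)) \<longleftrightarrow> h \<le> m (Suc (Suc (length cs))))"
    and "\<And>ds. F (ds @ c # c' # cs) = F (ds @ c' # c # cs)"
  shows "val (step_wt z m) F r (ds @ c # c' # cs) = val (step_wt z m) F r (ds @ c' # c # cs)"
  using assms(1)
proof (induction r arbitrary: ds)
  case 0
  then show ?case by (simp add: assms(2))
next
  case (Suc r)
  have "step_wt z m (ds @ c # c' # cs) d = step_wt z m (ds @ c' # c # cs) d" for d
    by (rule step_wt_swap, rule Suc.prems) simp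
  moreover have "val (step_wt z m) F r (d # ds @ c # c' # cs) = val (step_wt z m) F r (d # ds @ c' # c # cs)" for d
    using Suc.IH[of "d # ds"] Suc.prems by simp
  ultimately show ?case by (simp add: ncol_swap[of ds c c'])
qed

definition defect :: "'a::comm_ring_1 \<Rightarrow> (nat list \<Rightarrow> nat \<Rightarrow> 'a) \<Rightarrow> (nat list \<Rightarrow> nat \<Rightarrow> 'a) \<Rightarrow> (nat list \<Rightarrow> nat \<Rightarrow> 'a) \<Rightarrow>
    (nat list \<Rightarrow> 'a) \<Rightarrow> nat \<Rightarrow> nat list \<Rightarrow> 'a" where
  "defect z w w' w'' F r cs = (1 + z) * val w' F r cs - z * val w F r cs - val w'' F r cs"

lemma defect_Suc:
  assumes "\<And>c. w' cs c = w cs c" "\<And>c. w'' cs c = w cs c"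
  shows "defect z w w' w'' F (Suc r) cs = (\<Sum>c\<le>ncol cs. w cs c * defect z w w' w'' F r (c # cs))"
  by (simp add: defect_def assms sum_distrib_left sum_subtractf[symmetric] algebra_simps)

text \<open>
  As long as the three weights agree, the defect of a colouring is a weighted sum of the defects of
  its extensions by one letter.
\<close>

lemma defect_zero:
  assumes "\<And>cs c. length cs < p \<Longrightarrow> w' cs c = w cs c" "\<And>cs c. length cs < p \<Longrightarrow> w'' cs c = w cs c"
    and "p \<le> n" "\<And>cs. length cs = p \<Longrightarrow> defect z w w' w'' F (n - p) cs = 0" "length cs \<le> p"
  shows "defect z w w' w'' F (n - length cs) cs = 0"
  using assms(5)
proof (induction "p - length cs" arbitrary: cs)
  case 0
  then show ?case using assms(4)[of cs] by simp
next
  case (Suc k)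
  then have "length cs < p" by simp
  then have "n - length cs = Suc (n - length (c # cs))" for c using assms(3) by simp
  moreover have "defect z w w' w'' F (n - length (c # cs)) (c # cs) = 0" for c
    by (rule Suc.hyps(1)) (use Suc.hyps(2) in auto)
  ultimately show ?case
    using \<open>length cs < p\<close> assms(1,2) by (simp add: defect_Suc del: length_Cons)
qed

lemma antisym_sum:
  fixes E :: "nat \<Rightarrow> nat \<Rightarrow> 'a::comm_ring_1"
  assumes "\<And>i j. i < j \<Longrightarrow> j \<le> K \<Longrightarrow> E i j + E j i = 0" "\<And>i. i \<le> K \<Longrightarrow> E i i = 0"
  shows "(\<Sum>i\<le>K. \<Sum>j\<le>K. E i j) = 0"
  using assms
proof (induction K)
  case (Suc K)
  have "(\<Sum>i\<le>K. E i (Suc K)) + (\<Sum>j\<le>K. E (Suc K) j) = (\<Sum>i\<le>K. E i (Suc K) + E (Suc K) i)"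
    by (simp add: sum.distrib)
  also have "\<dots> = 0" by (rule sum.neutral) (use Suc.prems in auto)
  finally have "(\<Sum>i\<le>K. E i (Suc K)) + (\<Sum>j\<le>K. E (Suc K) j) = 0" .
  then show ?case using Suc by (simp add: sum.distrib algebra_simps)
qed simp

text \<open>
  The colours of two consecutive letters, cancelled in pairs \<open>(c, c')\<close> and \<open>(c', c)\<close>. The pair in
  which both letters open new cycles has no partner.
\<close>

lemma two_step:
  fixes E :: "nat \<Rightarrow> nat \<Rightarrow> 'a::comm_ring_1"
  assumes "\<And>c c'. c < c' \<Longrightarrow> c' \<le> ncol cs \<Longrightarrow> E c c' + E c' c = 0"
    "\<And>c. c \<le> ncol cs \<Longrightarrow> E c c = 0" "E (ncol cs) (Suc (ncol cs)) = 0"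
  shows "(\<Sum>c\<le>ncol cs. \<Sum>c'\<le>ncol (c # cs). E c c') = 0"
proof -
  let ?K = "ncol cs"
  have "(\<Sum>c'\<le>ncol (c # cs). E c c') = (\<Sum>c'\<le>?K. E c c')" if "c \<le> ?K" for c
  proof (cases "c = ?K")
    case True
    then show ?thesis using assms(3) by simp
  next
    case False
    then have "ncol (c # cs) = ?K" using that by simp
    then show ?thesis by simp
  qed
  then have "(\<Sum>c\<le>?K. \<Sum>c'\<le>ncol (c # cs). E c c') = (\<Sum>c\<le>?K. \<Sum>c'\<le>?K. E c c')" by simp
  then show ?thesis using antisym_sum[of ?K E] assms(1,2) by simp
qed

lemma cnt_extra:
  assumes "1 \<le> i" "i \<le> length cs" "h \<le> m' i" "\<not> h \<le> m i"
    and "\<And>x. 1 \<le> x \<Longrightarrow> x \<le> length cs \<Longrightarrow> x \<noteq> i \<Longrightarrow> m x = m' x"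
  shows "\<exists>g\<in>set cs. \<forall>P. cnt m' h P cs = cnt m h P cs + of_bool (P g)"
  using assms
proof (induction cs)
  case (Cons c cs)
  show ?case
  proof (cases "i = Suc (length cs)")
    case True
    have "cnt m' h P cs = cnt m h P cs" for P by (rule cnt_cong) (use Cons.prems True in auto)
    then show ?thesis using True Cons.prems by (intro bexI[of _ c]) auto
  next
    case False
    then obtain g where "g \<in> set cs" "\<forall>P. cnt m' h P cs = cnt m h P cs + of_bool (P g)"
      using Cons by auto
    then show ?thesis using False Cons.prems by (intro bexI[of _ g]) auto
  qed
qed simp

definition swap_invariant :: "(nat list \<Rightarrow> 'a) \<Rightarrow> bool" where
  "swap_invariant F \<longleftrightarrow> (\<forall>ds c c' cs. F (ds @ c # c' # cs) = F (ds @ c' # c # cs))"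

text \<open>
  The letter \<open>i\<close> is a neighbour of \<open>a\<close> for \<open>m'\<close> and \<open>m''\<close> and of \<open>Suc a\<close> for \<open>m''\<close>, and this is the
  only difference between the three functions. Apart from \<open>i\<close>, the letters \<open>a\<close> and \<open>Suc a\<close> have the
  same smaller neighbours, and \<open>a\<close> is a neighbour of \<open>Suc a\<close>. Hence the weights of the two steps can
  be expressed by the counts \<open>B\<close> of these common neighbours and the colour \<open>g\<close> of \<open>i\<close>. As \<open>a\<close> and
  \<open>Suc a\<close> have the same later neighbours too, the value of the remaining steps is symmetric in their
  colours.
\<close>

lemma type_I:
  fixes z :: "'a::comm_ring_1"
  assumes i: "1 \<le> i" "i < a" "Suc a \<le> n" and mi: "Suc (m i) = a" "m' i = a" "m'' i = Suc a"
    and other: "\<And>x. 1 \<le> x \<Longrightarrow> x \<le> n \<Longrightarrow> x \<noteq> i \<Longrightarrow> m x = m' x \<and> m'' x = m' x"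
    and gap: "\<And>x. 1 \<le> x \<Longrightarrow> x \<le> n \<Longrightarrow> x \<noteq> i \<Longrightarrow> m' x \<noteq> a"
    and ma: "Suc a \<le> m' a" "m' a = m' (Suc a)"
    and F: "swap_invariant F"
  shows "defect z (step_wt z m) (step_wt z m') (step_wt z m'') F n [] = 0"
proof -
  let ?w = "step_wt z m" and ?w' = "step_wt z m'" and ?w'' = "step_wt z m''"
  \<comment> \<open>As \<open>m'\<close> attains \<open>a\<close> at \<open>i\<close> alone, the thresholds \<open>a\<close> and \<open>Suc a\<close> select the same letters apart from \<open>i\<close>.\<close>
  have at_a: "Suc a \<le> m x \<longleftrightarrow> a \<le> m x" "Suc a \<le> m' x \<longleftrightarrow> a \<le> m x" "Suc a \<le> m'' x \<longleftrightarrow> a \<le> m' x"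
    "a \<le> m'' x \<longleftrightarrow> a \<le> m' x" if "1 \<le> x" "x \<le> n" for x
    using mi other[OF that] gap[OF that] by (cases "x = i"; auto)+
  have below_a: "h \<le> m' x \<longleftrightarrow> h \<le> m x" "h \<le> m'' x \<longleftrightarrow> h \<le> m x" if "1 \<le> x" "x \<le> n" "h < a" for x h
    using mi other[OF that(1,2)] that(3) by (cases "x = i"; auto)+
  have beyond_a: "h \<le> m' x \<longleftrightarrow> h \<le> m x" "h \<le> m'' x \<longleftrightarrow> h \<le> m x" if "1 \<le> x" "x \<le> n" "Suc a < h" for x h
    using mi other[OF that(1,2)] that(3) by (cases "x = i"; auto)+
  have "defect z ?w ?w' ?w'' F (n - length ([]::nat list)) [] = 0"
  proof (rule defect_zero[where p = "a - 1"])
    fix cs :: "nat list" and c assume l: "length cs < a - 1"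
    show "?w' cs c = ?w cs c" "?w'' cs c = ?w cs c"
      by (rule step_wt_cong, rule below_a; use l i in auto)+
  next
    fix cs :: "nat list" assume len: "length cs = a - 1"
    then have sl: "Suc (length cs) = a" using i by simp
    obtain r where r: "n - (a - 1) = Suc (Suc r)"
    proof
      show "n - (a - 1) = Suc (Suc (n - Suc a))" using i by simp
    qed
    let ?K = "ncol cs"
    define B where "B P = cnt m a P cs" for P
    have "\<exists>g\<in>set cs. \<forall>P. cnt m' a P cs = cnt m a P cs + of_bool (P g)"
      by (rule cnt_extra[of i]) (use i mi other len in auto)
    then obtain g where g: "g \<in> set cs" "\<And>P. cnt m' a P cs = B P + of_bool (P g)"
      unfolding B_def by blast
    have gK: "g < ?K" using g ncol_gt by blast
    have B0: "cnt m'' a P cs = B P + of_bool (P g)" for P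
      unfolding g(2)[symmetric] by (rule cnt_cong, rule at_a(4)) (use i len in auto)
    have B1: "cnt m (Suc a) P cs = B P" "cnt m' (Suc a) P cs = B P" for P
      unfolding B_def by (rule cnt_cong, rule at_a; use i len in auto)+
    have B2: "cnt m'' (Suc a) P cs = B P + of_bool (P g)" for P
      unfolding g(2)[symmetric] by (rule cnt_cong, rule at_a(3)) (use i len in auto)
    have ma3: "Suc a \<le> m a" "Suc a \<le> m' a" "Suc a \<le> m'' a" using ma other[of a] i by auto
    have BK: "B (\<lambda>d. ?K < d) = 0" "B (\<lambda>d. d = ?K) = 0"
      unfolding B_def by (rule cnt_eq_0; use ncol_gt[of _ cs] in fastforce)+
    define V where "V c c' = val ?w F r (c' # c # cs)" for c c'
    have V': "val ?w' F r (c' # c # cs) = V c c'" "val ?w'' F r (c' # c # cs) = V c c'" for c c'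
      unfolding V_def
      by (rule val_cong, rule step_wt_cong, rule beyond_a; use i len r in auto)+
    have Vsym: "V c c' = V c' c" for c c'
      unfolding V_def using val_swap[of "[]" c' c cs m F z r] F ma other[of a] other[of "Suc a"] i sl
      by (auto simp: swap_invariant_def)
    define D where "D c c' = (1 + z) * (?w' cs c * ?w' (c # cs) c') - z * (?w cs c * ?w (c # cs) c')
        - ?w'' cs c * ?w'' (c # cs) c'" for c c'
    have "defect z ?w ?w' ?w'' F (Suc (Suc r)) cs = (\<Sum>c\<le>?K. \<Sum>c'\<le>ncol (c # cs). D c c' * V c c')"
      by (simp add: defect_def V' V_def[symmetric] D_def sum_distrib_left sum_subtractf[symmetric] algebra_simps del: ncol.simps)
    also have "\<dots> = 0"
    proof (rule two_step)
      fix c c' assume c: "c < c'" "c' \<le> ?K"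
      have "D c c' + D c' c = 0"
        using c gK
        by (cases g c rule: linorder_cases; cases g c' rule: linorder_cases)
           (simp_all add: D_def step_wt_def sl g(2) B0 B1 B2 ma3 B_def[symmetric] algebra_simps)
      then show "D c c' * V c c' + D c' c * V c' c = 0"
        unfolding Vsym[of c' c] by (simp flip: distrib_right)
    next
      fix c assume c: "c \<le> ?K"
      have "D c c = 0"
      proof (cases "c = ?K")
        case True
        then show ?thesis using gK
          by (simp add: D_def step_wt_def sl g(2) B0 B1 B2 ma3 B_def[symmetric] BK)
      next
        case False
        then show ?thesis using c gK
          by (cases g c rule: linorder_cases)
             (simp_all add: D_def step_wt_def sl g(2) B0 B1 B2 ma3 B_def[symmetric] qnum_Suc' algebra_simps)
      qed
      then show "D c c * V c c = 0" by simp
    next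
      have "D ?K (Suc ?K) = 0" using gK
        by (simp add: D_def step_wt_def sl g(2) B0 B1 B2 ma3 B_def[symmetric] algebra_simps)
      then show "D ?K (Suc ?K) * V ?K (Suc ?K) = 0" by simp
    qed
    finally show "defect z ?w ?w' ?w'' F (n - (a - 1)) cs = 0" unfolding r .
  qed (use i in auto)
  then show ?thesis by simp
qed

section \<open>Triples of the second type: reduction to two new cycles\<close>

text \<open>
  The letters \<open>Suc (length cs)\<close> and its successor are adjacent and have the same smaller neighbours,
  so the weight of the second one differs from that of the first one by the edge between them.
\<close>

lemma pair_wt:
  assumes "Suc (Suc (length cs)) \<le> m (Suc (length cs))"
    and "\<And>x. 1 \<le> x \<Longrightarrow> x \<le> length cs \<Longrightarrow> (Suc (Suc (length cs)) \<le> m x \<longleftrightarrow> Suc (length cs) \<le> m x)"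
    and "c \<noteq> c'" "c \<le> ncol cs" "c' \<le> ncol cs"
  shows "step_wt z m (c # cs) c' = z ^ of_bool (c' < c) * step_wt z m cs c'"
proof -
  have e: "cnt m (Suc (Suc (length cs))) P cs = cnt m (Suc (length cs)) P cs" for P
    by (rule cnt_cong) (rule assms(2))
  have "(c' = ncol (c # cs)) = (c' = ncol cs)" using assms(3-5) by auto
  then show ?thesis using assms(1,3)
    by (simp add: step_wt_def e power_add mult_ac del: ncol.simps)
qed

text \<open>
  The three functions differ in whether \<open>Suc a\<close> is a neighbour of neither of \<open>i\<close> and \<open>Suc i\<close>, of
  \<open>Suc i\<close>, or of both. The value \<open>i\<close> is not attained by \<open>m'\<close>, so \<open>i\<close> and \<open>Suc i\<close> have the same
  smaller neighbours.
\<close>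

locale type_II =
  fixes q :: "'a::comm_ring_1" and n i a :: nat and m m' m'' :: "nat \<Rightarrow> nat" and F :: "nat list \<Rightarrow> 'a"
  assumes i: "1 \<le> i" "i < a" "Suc a \<le> n"
    and mi: "m i = a" "m (Suc i) = a" "m' i = a" "m' (Suc i) = Suc a" "m'' i = Suc a" "m'' (Suc i) = Suc a"
    and other: "\<And>x. 1 \<le> x \<Longrightarrow> x \<le> n \<Longrightarrow> x \<noteq> i \<Longrightarrow> x \<noteq> Suc i \<Longrightarrow> m x = m' x \<and> m'' x = m' x"
    and below: "\<And>x. 1 \<le> x \<Longrightarrow> x < i \<Longrightarrow> m' x \<noteq> i"
    and F: "swap_invariant F"
begin

abbreviation "w \<equiv> step_wt q m"
abbreviation "w' \<equiv> step_wt q m'"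
abbreviation "w'' \<equiv> step_wt q m''"

lemma agree:
  assumes "1 \<le> x" "x \<le> n" "h \<noteq> Suc a"
  shows "h \<le> m' x \<longleftrightarrow> h \<le> m x" "h \<le> m'' x \<longleftrightarrow> h \<le> m x"
  using mi other[OF assms(1,2)] assms(3) by (cases "x = i"; cases "x = Suc i"; auto)+

lemma w_agree:
  assumes "length cs \<noteq> a" "length cs \<le> n"
  shows "w' cs c = w cs c" "w'' cs c = w cs c"
  by (rule step_wt_cong, rule agree; use assms in auto)+

definition \<delta> :: "nat list \<Rightarrow> 'a" where
  "\<delta> cs = defect q w w' w'' F (n - length cs) cs"

lemma \<delta>_step:
  assumes "length cs < a"
  shows "\<delta> cs = (\<Sum>c\<le>ncol cs. w cs c * \<delta> (c # cs))"
proof -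
  have "n - length cs = Suc (n - length (c # cs))" for c using assms i by simp
  then show ?thesis unfolding \<delta>_def
    using defect_Suc[of w' cs w w'' q F] w_agree[of cs] assms i by (simp del: length_Cons)
qed

lemma \<delta>_at_a:
  assumes "length cs = a"
  shows "\<delta> cs = (\<Sum>c\<le>ncol cs. ((1 + q) * w' cs c - q * w cs c - w'' cs c) * val w F (n - Suc a) (c # cs))"
proof -
  have e: "n - length cs = Suc (n - Suc a)" using assms i by simp
  have "val w' F (n - Suc a) (c # cs) = val w F (n - Suc a) (c # cs)"
    "val w'' F (n - Suc a) (c # cs) = val w F (n - Suc a) (c # cs)" for c
    by (rule val_cong, rule w_agree; use assms i in auto)+
  then show ?thesis
    by (simp add: \<delta>_def defect_def e sum_distrib_left sum_subtractf[symmetric] algebra_simps)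
qed

text \<open>
  Since \<open>m\<close> sends \<open>i\<close> and \<open>Suc i\<close> to \<open>a\<close>, this counts the neighbours of \<open>Suc a\<close> other than these
  two.
\<close>

definition rest :: "(nat \<Rightarrow> bool) \<Rightarrow> nat list \<Rightarrow> nat" where
  "rest P cs = cnt m (Suc a) P cs"

lemma cnt_pair:
  assumes "length cs = i - 1" "length ds + Suc i \<le> n"
  shows "cnt m' (Suc a) P (ds @ c' # c # cs) = rest P (ds @ c' # c # cs) + of_bool (P c')"
    "cnt m'' (Suc a) P (ds @ c' # c # cs) = rest P (ds @ c' # c # cs) + of_bool (P c) + of_bool (P c')"
proof -
  have l: "Suc (length cs) = i" using assms i by simp
  have base: "cnt m' (Suc a) P cs = cnt m (Suc a) P cs" "cnt m'' (Suc a) P cs = cnt m (Suc a) P cs"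
    by (rule cnt_cong; use other l i in auto)+
  have "cnt m' (Suc a) P (ds @ c' # c # cs) = rest P (ds @ c' # c # cs) + of_bool (P c') \<and>
    cnt m'' (Suc a) P (ds @ c' # c # cs) = rest P (ds @ c' # c # cs) + of_bool (P c) + of_bool (P c')"
    using assms(2)
  proof (induction ds)
    case Nil
    then show ?case using l mi base by (simp add: rest_def)
  next
    case (Cons d ds)
    have "Suc (length ds + Suc (Suc (length cs))) \<noteq> i" "Suc (length ds + Suc (Suc (length cs))) \<noteq> Suc i"
      "Suc (length ds + Suc (Suc (length cs))) \<le> n"
      using l Cons.prems by auto
    from other[OF _ this(3,1,2)] show ?case using Cons by (simp add: rest_def)
  qed
  then show "cnt m' (Suc a) P (ds @ c' # c # cs) = rest P (ds @ c' # c # cs) + of_bool (P c')"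
    "cnt m'' (Suc a) P (ds @ c' # c # cs) = rest P (ds @ c' # c # cs) + of_bool (P c) + of_bool (P c')"
    by blast+
qed

lemma rest_swap:
  assumes "length cs = i - 1"
  shows "rest P (ds @ c' # c # cs) = rest P (ds @ c # c' # cs)"
proof -
  have l: "Suc (length cs) = i" using assms i by simp
  show ?thesis unfolding rest_def by (rule cnt_swap) (simp add: l mi)
qed

text \<open>
  The weights of the steps from \<open>i + 2\<close> to \<open>a\<close> are symmetric in the colours of \<open>i\<close> and \<open>Suc i\<close>, so
  it is enough to look at the step of \<open>Suc a\<close>, where the relation holds for each of its colours \<open>f\<close>.
\<close>

lemma \<delta>_swap:
  assumes "length cs = i - 1" "length ds + Suc i \<le> a"
  shows "c < c' \<Longrightarrow> \<delta> (ds @ c' # c # cs) + q * \<delta> (ds @ c # c' # cs) = 0" "\<delta> (ds @ c # c # cs) = 0"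
proof -
  have l: "Suc (length cs) = i" using assms i by simp
  have "(c < c' \<longrightarrow> \<delta> (ds @ c' # c # cs) + q * \<delta> (ds @ c # c' # cs) = 0) \<and> \<delta> (ds @ c # c # cs) = 0"
    using assms(2)
  proof (induction "a - (length ds + Suc i)" arbitrary: ds)
    case 0
    then have ds: "length ds + Suc i = a" by simp
    have len: "length (ds @ d # e # cs) = a" for d e using ds l by simp
    let ?V = "\<lambda>d e f. val w F (n - Suc a) (f # ds @ d # e # cs)"
    let ?W = "\<lambda>d e f. (1 + q) * w' (ds @ d # e # cs) f - q * w (ds @ d # e # cs) f - w'' (ds @ d # e # cs) f"
    have V: "?V d e f = ?V e d f" for d e f
      using val_swap[of "f # ds" d e cs m F q "n - Suc a"] F mi len[of d e] l
      by (auto simp: swap_invariant_def)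
    have W: "step_wt q m' (ds @ d # e # cs) f = q ^ (rest ((<) f) (ds @ d # e # cs) + of_bool (f < d)) *
        qnum q (rest (\<lambda>x. x = f) (ds @ d # e # cs) + of_bool (d = f) + of_bool (f = ncol (ds @ d # e # cs)))"
      "step_wt q m (ds @ d # e # cs) f = q ^ (rest ((<) f) (ds @ d # e # cs)) *
        qnum q (rest (\<lambda>x. x = f) (ds @ d # e # cs) + of_bool (f = ncol (ds @ d # e # cs)))"
      "step_wt q m'' (ds @ d # e # cs) f = q ^ (rest ((<) f) (ds @ d # e # cs) + of_bool (f < e) + of_bool (f < d)) *
        qnum q (rest (\<lambda>x. x = f) (ds @ d # e # cs) + of_bool (e = f) + of_bool (d = f) + of_bool (f = ncol (ds @ d # e # cs)))"
      for d e f
      unfolding step_wt_def len using cnt_pair[OF assms(1), of ds] ds i by (simp_all add: rest_def)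
    have 1: "?W c' c f + q * ?W c c' f = 0" if "c < c'" for f
      using that unfolding W rest_swap[OF assms(1), of _ ds c c'] ncol_swap[of ds c c']
      by (cases f c rule: linorder_cases; cases f c' rule: linorder_cases)
         (simp_all add: algebra_simps)
    have 2: "?W c c f = 0" for f
      unfolding W
      by (cases f c rule: linorder_cases) (simp_all add: qnum_Suc' algebra_simps)
    have "\<delta> (ds @ c' # c # cs) + q * \<delta> (ds @ c # c' # cs)
        = (\<Sum>f\<le>ncol (ds @ c' # c # cs). (?W c' c f + q * ?W c c' f) * ?V c' c f)"
      unfolding \<delta>_at_a[OF len] ncol_swap[of ds c c'] V[of _ c c']
      by (simp only: sum_distrib_left sum.distrib[symmetric] distrib_right mult.assoc)
    then have "c < c' \<longrightarrow> \<delta> (ds @ c' # c # cs) + q * \<delta> (ds @ c # c' # cs) = 0" using 1 by simp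
    moreover have "\<delta> (ds @ c # c # cs) = 0" unfolding \<delta>_at_a[OF len] using 2 by simp
    ultimately show ?case by blast
  next
    case (Suc k)
    then have ds: "length ds + Suc i < a" by simp
    have len: "length (ds @ d # e # cs) < a" for d e using ds l by simp
    have IH: "c < c' \<Longrightarrow> \<delta> ((d # ds) @ c' # c # cs) + q * \<delta> ((d # ds) @ c # c' # cs) = 0"
      "\<delta> ((d # ds) @ c # c # cs) = 0" for d
      using Suc.hyps(1)[of "d # ds"] Suc.hyps(2) ds by auto
    have w: "w (ds @ c # c' # cs) d = w (ds @ c' # c # cs) d" for d
      by (rule step_wt_swap) (use ds l mi in auto)
    have "\<delta> (ds @ c' # c # cs) + q * \<delta> (ds @ c # c' # cs)
        = (\<Sum>d\<le>ncol (ds @ c' # c # cs). w (ds @ c' # c # cs) d *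
             (\<delta> ((d # ds) @ c' # c # cs) + q * \<delta> ((d # ds) @ c # c' # cs)))"
      unfolding \<delta>_step[OF len] ncol_swap[of ds c c'] w
      by (simp add: sum_distrib_left sum.distrib[symmetric] algebra_simps)
    then have "c < c' \<longrightarrow> \<delta> (ds @ c' # c # cs) + q * \<delta> (ds @ c # c' # cs) = 0" using IH(1) by simp
    moreover have "\<delta> (ds @ c # c # cs) = 0"
      unfolding \<delta>_step[OF len] using IH(2) by simp
    ultimately show ?case by blast
  qed
  then show "c < c' \<Longrightarrow> \<delta> (ds @ c' # c # cs) + q * \<delta> (ds @ c # c' # cs) = 0" "\<delta> (ds @ c # c # cs) = 0"
    by blast+
qed

text \<open>
  The step weights of \<open>i\<close> and \<open>Suc i\<close> in the two orders of a pair of colours differ by a factor \<open>q\<close>,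
  which is exactly compensated by the behaviour of \<open>\<delta>\<close> under the exchange of the two colours.
\<close>

lemma reduce_to_new_pair:
  assumes core: "\<And>cs. length cs = i - 1 \<Longrightarrow> \<delta> (Suc (ncol cs) # ncol cs # cs) = 0"
  shows "defect q w w' w'' F n [] = 0"
proof -
  have "defect q w w' w'' F (n - length ([]::nat list)) [] = 0"
  proof (rule defect_zero[where p = "i - 1"])
    fix cs :: "nat list" assume len: "length cs = i - 1"
    then have l: "Suc (length cs) = i" using i by simp
    let ?K = "ncol cs"
    have nbr: "Suc (Suc (length cs)) \<le> m (Suc (length cs))" using l mi i by simp
    have same: "Suc (Suc (length cs)) \<le> m x \<longleftrightarrow> Suc (length cs) \<le> m x" if "1 \<le> x" "x \<le> length cs" for x
      using other[of x] below[of x] that l i by force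
    have "\<delta> cs = (\<Sum>c\<le>?K. w cs c * (\<Sum>c'\<le>ncol (c # cs). w (c # cs) c' * \<delta> (c' # c # cs)))"
      using \<delta>_step[of cs] \<delta>_step[of "c # cs" for c] i l by (simp del: ncol.simps)
    also have "\<dots> = (\<Sum>c\<le>?K. \<Sum>c'\<le>ncol (c # cs). w cs c * w (c # cs) c' * \<delta> (c' # c # cs))"
      by (simp add: sum_distrib_left mult.assoc del: ncol.simps)
    also have "\<dots> = 0"
    proof (rule two_step)
      fix c c' assume c: "c < c'" "c' \<le> ?K"
      note pair = pair_wt[where cs = cs and m = m and z = q, OF nbr same]
      have "w (c # cs) c' = w cs c'" "w (c' # cs) c = q * w cs c"
        using pair[of c c'] pair[of c' c] c by simp_all
      then have "w cs c * w (c # cs) c' * \<delta> (c' # c # cs) + w cs c' * w (c' # cs) c * \<delta> (c # c' # cs)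
          = w cs c * w cs c' * (\<delta> ([] @ c' # c # cs) + q * \<delta> ([] @ c # c' # cs))"
        by (simp add: algebra_simps)
      also have "\<dots> = 0" using \<delta>_swap(1)[OF len, of "[]" c c'] c i by simp
      finally show "w cs c * w (c # cs) c' * \<delta> (c' # c # cs) + w cs c' * w (c' # cs) c * \<delta> (c # c' # cs) = 0" .
    next
      fix c show "w cs c * w (c # cs) c * \<delta> (c # c # cs) = 0"
        using \<delta>_swap(2)[OF len, of "[]" c] i by simp
    qed (simp add: core[OF len])
    finally show "defect q w w' w'' F (n - (i - 1)) cs = 0" by (simp add: \<delta>_def len)
  qed (use i w_agree in auto)
  then show ?thesis by simp
qed

end

section \<open>Triples of the second type: two new cycles\<close>

text \<open>
  The value depends on the number of letters of colour \<open>0\<close>, which is the length of the first cycle,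
  and on the multiset of the other cycle lengths.
\<close>

definition block_symmetric :: "(nat list \<Rightarrow> 'a) \<Rightarrow> bool" where
  "block_symmetric F \<longleftrightarrow> (\<forall>cs ds. ncol cs = ncol ds \<longrightarrow> count_list cs 0 = count_list ds 0 \<longrightarrow>
     mset (map (count_list cs) [1..<ncol cs]) = mset (map (count_list ds) [1..<ncol ds]) \<longrightarrow> F cs = F ds)"

lemma block_symmetricD:
  assumes "block_symmetric F" "ncol cs = ncol ds" "count_list cs 0 = count_list ds 0"
    "mset (map (count_list cs) [1..<ncol cs]) = mset (map (count_list ds) [1..<ncol ds])"
  shows "F cs = F ds"
  using assms unfolding block_symmetric_def by blast

lemma block_symmetric_swap_invariant:
  assumes "block_symmetric F"
  shows "swap_invariant F"
  unfolding swap_invariant_def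
proof (intro allI)
  fix ds cs :: "nat list" and c c'
  have e: "count_list (ds @ c # c' # cs) = count_list (ds @ c' # c # cs)" by auto
  show "F (ds @ c # c' # cs) = F (ds @ c' # c # cs)"
    by (rule block_symmetricD[OF assms ncol_swap]; simp only: e ncol_swap[of ds c c'])
qed

lemma cnt_split: "cnt m h ((<) k) cs = cnt m h ((<) (Suc k)) cs + cnt m h (\<lambda>x. x = Suc k) cs"
  by (induction cs) auto

lemma (in rooted_interval_graph) split_wt_insert_left:
  assumes "finite U" "finite V" "\<forall>x\<in>U. x < h" "\<forall>x\<in>V. x < h"
  shows "split_wt (insert h U) V = split_wt U V * left_wt U V h"
proof -
  have "h \<notin> U" using assms by auto
  moreover have "left_wt (insert h U) V x = left_wt U V x" if "x \<le> h" for x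
    using that by (simp add: left_wt_def nb_insert_ge)
  moreover have "right_wt (insert h U) V x = right_wt U V x" for x
    by (simp add: right_wt_def)
  ultimately show ?thesis using assms
    by (simp add: split_wt_def mult_ac less_imp_le cong: prod.cong)
qed

lemma (in rooted_interval_graph) split_wt_insert_right:
  assumes "finite U" "finite V" "\<forall>x\<in>U. x < h" "\<forall>x\<in>V. x < h"
  shows "split_wt U (insert h V) = split_wt U V * right_wt U V h"
proof -
  have "h \<notin> V" using assms by auto
  moreover have "left_wt U (insert h V) x = left_wt U V x" if "x \<le> h" for x
    using that by (simp add: left_wt_def nb_insert_ge)
  moreover have "right_wt U (insert h V) x = right_wt U V x" if "x \<le> h" for x
    using that by (simp add: right_wt_def nb_insert_ge)
  ultimately show ?thesis using assms
    by (simp add: split_wt_def mult_ac less_imp_le cong: prod.cong)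
qed

text \<open>
  The remaining case of the second type: \<open>i\<close> and \<open>Suc i\<close> open the cycles \<open>K\<close> and \<open>Suc K\<close>. The
  assumption \<open>0 < K\<close> says that neither of them is the first cycle, so \<open>F\<close> is symmetric in their
  lengths.
\<close>

locale type_II_pair = type_II +
  fixes cs :: "nat list" and K :: nat
  assumes len_cs: "length cs = i - 1" and K: "K = ncol cs" "0 < K"
    and mono: "\<And>x y. 1 \<le> x \<Longrightarrow> x \<le> y \<Longrightarrow> y \<le> n \<Longrightarrow> m x \<le> m y"
    and bounded: "\<And>x. 1 \<le> x \<Longrightarrow> x \<le> n \<Longrightarrow> m x \<le> n"
    and far: "\<And>x. Suc i < x \<Longrightarrow> x \<le> n \<Longrightarrow> Suc a \<le> m x"
    and blocks: "block_symmetric F"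
    and two: "\<And>x::'a. x + x = 0 \<Longrightarrow> x = 0"
begin

abbreviation "base \<equiv> Suc K # K # cs"

lemma len_base [simp]: "length cs + 2 = Suc i" "Suc (length cs) = i" "length base = Suc i"
  using len_cs i by simp_all

text \<open>
  For these colours of \<open>i\<close> and \<open>Suc i\<close>, the combination of the three weights of the letter \<open>Suc a\<close>
  in the defect vanishes unless this letter joins one of the cycles \<open>K\<close> and \<open>Suc K\<close>, and then is \<open>q\<close>
  times the value given here. All other steps have the weights of \<open>m\<close>.
\<close>

definition pair_wts :: "nat list \<Rightarrow> nat \<Rightarrow> 'a" where
  "pair_wts es c = (if length es = a then
       (if c = K then - (q ^ cnt m (Suc a) ((<) K) es)
        else if c = Suc K then q ^ cnt m (Suc a) ((<) K) es else 0)
     else w es c)"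

lemma ncol_base: "Suc (Suc K) \<le> ncol (es @ base)"
  by (induction es) auto

lemma \<delta>_eq_pair_wts:
  assumes "length es + Suc i \<le> a"
  shows "\<delta> (es @ base) = q * val pair_wts F (n - length (es @ base)) (es @ base)"
  using assms
proof (induction "a - (length es + Suc i)" arbitrary: es)
  case 0
  then have es: "length es + Suc i = a" by simp
  then have len: "length (es @ base) = a" by simp
  have e: "n - length (es @ base) = Suc (n - Suc a)" using len i by simp
  let ?r = "\<lambda>P. rest P (es @ base)"
  have W: "step_wt q m' (es @ base) f = q ^ (?r ((<) f) + of_bool (f < Suc K)) *
      qnum q (?r (\<lambda>x. x = f) + of_bool (Suc K = f) + of_bool (f = ncol (es @ base)))"
    "step_wt q m (es @ base) f = q ^ ?r ((<) f) *
      qnum q (?r (\<lambda>x. x = f) + of_bool (f = ncol (es @ base)))"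
    "step_wt q m'' (es @ base) f = q ^ (?r ((<) f) + of_bool (f < K) + of_bool (f < Suc K)) *
      qnum q (?r (\<lambda>x. x = f) + of_bool (K = f) + of_bool (Suc K = f) + of_bool (f = ncol (es @ base)))"
    for f
    unfolding step_wt_def len using cnt_pair[OF len_cs, of es] es i by (simp_all add: rest_def)
  have sp: "?r ((<) K) = ?r ((<) (Suc K)) + ?r (\<lambda>x. x = Suc K)"
    unfolding rest_def by (rule cnt_split)
  have new: "pair_wts (es @ base) f = (if f = K then - (q ^ ?r ((<) K)) else if f = Suc K then q ^ ?r ((<) K) else 0)" for f
    unfolding pair_wts_def len by (simp add: rest_def)
  have 1: "(1 + q) * w' (es @ base) f - q * w (es @ base) f - w'' (es @ base) f = q * pair_wts (es @ base) f" for f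
  proof -
    consider "f < K" | "f = K" | "f = Suc K" | "Suc K < f" by linarith
    then show ?thesis
    proof cases
      case 2
      then show ?thesis using ncol_base[of es] unfolding W new
        by (simp add: qnum_Suc' algebra_simps)
    next
      case 3
      then show ?thesis using ncol_base[of es] unfolding W new
        by (simp add: qnum_Suc algebra_simps sp power_add)
    qed (unfold W new, simp_all add: algebra_simps)
  qed
  have "val pair_wts F (n - Suc a) (f # es @ base) = val w F (n - Suc a) (f # es @ base)" for f
    by (rule val_cong) (use len in \<open>simp add: pair_wts_def\<close>)
  then show ?case
    unfolding \<delta>_at_a[OF len] e by (simp add: 1 sum_distrib_left mult.assoc)
next
  case (Suc k)
  then have es: "length es + Suc i < a" by simp
  then have len: "length (es @ base) < a" by simp
  have e: "n - length (es @ base) = Suc (n - Suc (length (es @ base)))" using len i by simp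
  have "\<delta> ((c # es) @ base) = q * val pair_wts F (n - length ((c # es) @ base)) ((c # es) @ base)" for c
    by (rule Suc.hyps(1)) (use Suc.hyps(2) es in auto)
  moreover have "pair_wts (es @ base) c = w (es @ base) c" for c using len by (simp add: pair_wts_def)
  ultimately show ?case
    unfolding \<delta>_step[OF len] unfolding e by (simp add: sum_distrib_left mult_ac)
qed

text \<open>
  In a continuation \<open>es @ base\<close> the letters of \<open>es\<close> start at \<open>Suc i + 1\<close>.
\<close>

primrec letters :: "nat \<Rightarrow> nat list \<Rightarrow> nat set" where
  "letters c [] = {}"
| "letters c (d # es) = (if d = c then insert (Suc (length es + Suc i)) (letters c es) else letters c es)"

lemma letters_bounds: "x \<in> letters c es \<Longrightarrow> Suc i < x \<and> x \<le> length es + Suc i"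
  by (induction es) (auto split: if_splits)

lemma finite_letters [simp]: "finite (letters c es)"
  by (induction es) auto

lemma card_letters: "card (letters c es) = count_list es c"
proof (induction es)
  case (Cons d es)
  have "Suc (length es + Suc i) \<notin> letters c es" using letters_bounds by fastforce
  then show ?case using Cons by simp
qed simp

text \<open>
  This function agrees with \<open>m\<close> for the adjacency of letters between \<open>Suc i\<close> and \<open>n\<close>, by \<open>far\<close>. The
  maximum with \<open>Suc a\<close> makes \<open>Suc a\<close> a root; the values outside \<open>1, \<dots>, n\<close> keep the function
  increasing.
\<close>

definition reach :: "nat \<Rightarrow> nat" where
  "reach x = max (Suc a) (if x = 0 then 0 else if x \<le> n then m x else n)"

sublocale G: rooted_interval_graph reach q "Suc a"
proof
  fix x y :: nat assume "x \<le> y"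
  then show "reach x \<le> reach y"
    using mono[of x y] bounded[of x] i by (auto simp: reach_def max_def)
qed (simp add: reach_def)

lemma reach_iff:
  assumes "Suc i < x" "x < h" "h \<le> n"
  shows "h \<le> reach x \<longleftrightarrow> h \<le> m x"
proof (cases "h \<le> Suc a")
  case True
  then show ?thesis using far[of x] assms by (simp add: reach_def)
next
  case False
  then show ?thesis using assms by (simp add: reach_def le_max_iff_disj)
qed

lemma cnt_letters_aux:
  "cnt m h (\<lambda>x. x = c) (es @ base) = card {x\<in>letters c es. h \<le> m x} + cnt m h (\<lambda>x. x = c) base"
proof (induction es)
  case (Cons d es)
  have "Suc (length es + Suc i) \<notin> letters c es" using letters_bounds by fastforce
  moreover have "{x. (x = Suc (length es + Suc i) \<or> x \<in> letters c es) \<and> h \<le> m x}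
      = (if h \<le> m (Suc (length es + Suc i)) then {Suc (length es + Suc i)} else {}) \<union> {x\<in>letters c es. h \<le> m x}"
    by auto
  ultimately show ?case using Cons by (auto simp: card_insert_if)
qed simp

text \<open>
  The last term is the opening letter of the cycle, \<open>i\<close> or \<open>Suc i\<close>, which for \<open>m\<close> is a neighbour of
  the letters up to \<open>a\<close> and of no later one.
\<close>

lemma cnt_letters:
  assumes "c = K \<or> c = Suc K" "length es + Suc i < h" "h \<le> n"
  shows "cnt m h (\<lambda>x. x = c) (es @ base) = card (G.nb (letters c es) h) + of_bool (h < Suc a)"
proof -
  have "d \<noteq> c" if "d \<in> set cs" for d
    using ncol_gt[OF that] assms(1) K by auto
  then have "cnt m h (\<lambda>x. x = c) cs = 0"
    by (intro cnt_eq_0)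
  then have "cnt m h (\<lambda>x. x = c) base = of_bool (h < Suc a)"
    using assms(1) mi len_base(2) by auto
  moreover have "{x\<in>letters c es. h \<le> m x} = G.nb (letters c es) h"
    using letters_bounds[of _ c es] assms reach_iff by (fastforce simp: G.nb_def)
  ultimately show ?thesis unfolding cnt_letters_aux by simp
qed

text \<open>
  The part of the step weight of a letter joining one of the two new cycles that depends on how the
  earlier letters are distributed between them.
\<close>

definition \<theta> :: "nat list \<Rightarrow> nat \<Rightarrow> 'a" where
  "\<theta> es c = (if c = K then G.left_wt (letters K es) (letters (Suc K) es) (Suc (length es + Suc i))
    else G.right_wt (letters K es) (letters (Suc K) es) (Suc (length es + Suc i)))"

lemma pair_wts_\<theta>:
  assumes "c = K \<or> c = Suc K" "length es + Suc i < n"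
  shows "pair_wts (es @ base) c = q ^ cnt m (Suc (length (es @ base))) ((<) (Suc K)) (es @ base) * \<theta> es c"
proof -
  let ?h = "Suc (length es + Suc i)"
  have len: "length (es @ base) = length es + Suc i" by simp
  have "c \<noteq> ncol (es @ base)" using assms(1) ncol_base[of es] by auto
  then show ?thesis
    using assms cnt_split[of m ?h K "es @ base"]
      cnt_letters[of K es ?h] cnt_letters[of "Suc K" es ?h]
    unfolding pair_wts_def step_wt_def len \<theta>_def G.left_wt_def G.right_wt_def
    by (auto simp: power_add)
qed

text \<open>
  A skeleton \<open>e\<close> is a colour sequence in which \<open>K\<close> stands for both new cycles. It fixes the colours
  of the letters outside them.
\<close>

definition refines :: "nat list \<Rightarrow> nat list \<Rightarrow> bool" where
  "refines es e \<longleftrightarrow> list_all2 (\<lambda>x y. if y = K then x = K \<or> x = Suc K else x = y) es e"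

text \<open>
  The sum of \<open>G\<close> over all refinements of a skeleton, weighted with the factors \<open>\<theta>\<close>.
\<close>

primrec refinement_sum :: "nat list \<Rightarrow> (nat list \<Rightarrow> 'a) \<Rightarrow> 'a" where
  "refinement_sum [] G = G []"
| "refinement_sum (c # e) G = refinement_sum e (\<lambda>es. if c = K then \<theta> es K * G (K # es) + \<theta> es (Suc K) * G (Suc K # es)
     else G (c # es))"

lemma refinement_sum_cong: "(\<And>es. refines es e \<Longrightarrow> G es = G' es) \<Longrightarrow> refinement_sum e G = refinement_sum e G'"
proof (induction e arbitrary: G G')
  case (Cons c e)
  show ?case unfolding refinement_sum.simps
    by (rule Cons.IH) (use Cons.prems in \<open>auto simp: refines_def\<close>)
qed (simp add: refines_def)

lemma refinement_sum_add: "refinement_sum e (\<lambda>es. G es + G' es) = refinement_sum e G + refinement_sum e G'"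
proof (induction e arbitrary: G G')
  case (Cons c e)
  show ?case unfolding refinement_sum.simps Cons.IH[symmetric]
    by (rule refinement_sum_cong) (simp add: algebra_simps)
qed simp

lemma refinement_sum_scale: "refinement_sum e (\<lambda>es. x * G es) = x * refinement_sum e G"
proof (induction e arbitrary: G)
  case (Cons c e)
  show ?case unfolding refinement_sum.simps Cons.IH[symmetric]
    by (rule refinement_sum_cong) (simp add: algebra_simps)
qed simp

lemma refinement_sum_sum: "finite A \<Longrightarrow> refinement_sum e (\<lambda>es. \<Sum>c\<in>A. G c es) = (\<Sum>c\<in>A. refinement_sum e (G c))"
proof (induction A rule: finite_induct)
  case empty
  then show ?case using refinement_sum_scale[of e 0 "\<lambda>_. 0"] by simp
qed (simp add: refinement_sum_add)

lemma refines_length: "refines es e \<Longrightarrow> length es = length e"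
  by (auto simp: refines_def dest: list_all2_lengthD)

lemma refines_ncol: "refines es e \<Longrightarrow> ncol (es @ base) = ncol (e @ base)"
  unfolding refines_def
proof (induction es e rule: list_all2_induct)
  case (Cons x es y e)
  then show ?case using ncol_base[of e] by (auto split: if_splits)
qed simp

lemma refines_cnt: "refines es e \<Longrightarrow> P K = P (Suc K) \<Longrightarrow> cnt m h P (es @ base) = cnt m h P (e @ base)"
  unfolding refines_def
proof (induction es e rule: list_all2_induct)
  case (Cons x es y e)
  then show ?case using list_all2_lengthD[of _ es e] by (auto split: if_splits)
qed simp

lemma refines_pair_wts:
  assumes "refines es e" "c \<noteq> K" "c \<noteq> Suc K"
  shows "pair_wts (es @ base) c = pair_wts (e @ base) c"
proof -
  have "cnt m h ((<) c) (es @ base) = cnt m h ((<) c) (e @ base)"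
    "cnt m h (\<lambda>x. x = c) (es @ base) = cnt m h (\<lambda>x. x = c) (e @ base)" for h
    by (rule refines_cnt[OF assms(1)]; use assms(2,3) in auto)+
  moreover have "length (es @ base) = length (e @ base)" using refines_length[OF assms(1)] by simp
  ultimately show ?thesis
    using refines_ncol[OF assms(1)] assms(2,3) unfolding pair_wts_def step_wt_def by simp
qed

text \<open>
  A refinement is a splitting of the set of letters of colour \<open>K\<close> in the skeleton, and its factors
  \<open>\<theta>\<close> multiply to the splitting weight.
\<close>

lemma refinement_sum_sets:
  assumes "Suc K \<notin> set e"
  shows "refinement_sum e (\<lambda>es. H (letters K es) (letters (Suc K) es))
    = (\<Sum>U\<in>Pow (letters K e). G.split_wt U (letters K e - U) * H U (letters K e - U))"
  using assms
proof (induction e arbitrary: H)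
  case Nil
  then show ?case by (simp add: G.split_wt_def)
next
  case (Cons c e)
  let ?h = "Suc (length e + Suc i)" and ?S = "letters K e"
  have hS: "?h \<notin> ?S" using letters_bounds by fastforce
  have SK: "Suc K \<notin> set e" "c \<noteq> Suc K" using Cons.prems by auto
  show ?case
  proof (cases "c = K")
    case False
    then show ?thesis using Cons.IH[OF SK(1), of H] SK by simp
  next
    case True
    have "refinement_sum (c # e) (\<lambda>es. H (letters K es) (letters (Suc K) es))
      = refinement_sum e (\<lambda>es. (\<lambda>U V. G.left_wt U V ?h * H (insert ?h U) V + G.right_wt U V ?h * H U (insert ?h V))
            (letters K es) (letters (Suc K) es))"
      unfolding refinement_sum.simps
      by (rule refinement_sum_cong) (simp add: True \<theta>_def refines_length)
    also have "\<dots> = (\<Sum>U\<in>Pow ?S. G.split_wt U (?S - U) *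
        (G.left_wt U (?S - U) ?h * H (insert ?h U) (?S - U) + G.right_wt U (?S - U) ?h * H U (insert ?h (?S - U))))"
      by (rule Cons.IH[OF SK(1)])
    also have "\<dots> = (\<Sum>U\<in>Pow (insert ?h ?S). G.split_wt U (insert ?h ?S - U) * H U (insert ?h ?S - U))"
      unfolding G.sum_Pow_insert[OF finite_letters hS]
    proof (rule sum.cong[OF refl], goal_cases)
      case (1 U)
      then have U: "U \<subseteq> ?S" "finite U" by (auto intro: finite_subset)
      have lt: "\<forall>x\<in>U. x < ?h" "\<forall>x\<in>?S - U. x < ?h" using U letters_bounds[of _ K e] by fastforce+
      have "insert ?h ?S - insert ?h U = ?S - U" "insert ?h ?S - U = insert ?h (?S - U)"
        using U hS by auto
      then show ?case
        using G.split_wt_insert_left[OF U(2) _ lt] G.split_wt_insert_right[OF U(2) _ lt]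
        by (simp add: algebra_simps)
    qed
    finally show ?thesis using True by simp
  qed
qed

text \<open>
  A representative with the letters of the two cycles sorted shows that \<open>F\<close> depends on the
  refinement through the two cycle lengths. The transposition of \<open>K\<close> and \<open>Suc K\<close> fixes the colour
  \<open>0\<close>, so the dependence is symmetric.
\<close>

lemma F_sizes:
  fixes e
  defines "\<phi> \<equiv> \<lambda>x y. F (filter (\<lambda>c. c \<noteq> K) e @ replicate x K @ replicate y (Suc K) @ base)"
  assumes "Suc K \<notin> set e"
  shows "refines es e \<Longrightarrow> F (es @ base) = \<phi> (count_list es K) (count_list es (Suc K))"
    and "\<phi> x y = \<phi> y x"
proof -
  let ?f = "filter (\<lambda>c. c \<noteq> K) e"
  let ?l = "\<lambda>x y. ?f @ replicate x K @ replicate y (Suc K) @ base"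
  have n1: "ncol (replicate y (Suc K) @ base) = ncol base" for y by (induction y) auto
  have n2: "ncol (replicate x K @ replicate y (Suc K) @ base) = ncol base" for x y
    by (induction x) (auto simp: n1)
  have n3: "ncol (filter (\<lambda>c. c \<noteq> K) e @ zs) = ncol (e @ base)" if "ncol zs = ncol base" for zs e
    using that
  proof (induction e)
    case (Cons c e)
    then show ?case using ncol_base[of e] by auto
  qed simp
  have nc: "ncol (?l x y) = ncol (e @ base)" for x y by (rule n3) (rule n2)
  have crep: "count_list (replicate k d) c = (if c = d then k else 0)" for k c and d :: nat
    by (induction k) auto
  have cf: "count_list ?f c = (if c = K then 0 else count_list e c)" for c
    by (induction e) auto
  show "F (es @ base) = \<phi> (count_list es K) (count_list es (Suc K))" if r: "refines es e"
  proof -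
    have "count_list es c = count_list e c" if "c \<noteq> K" "c \<noteq> Suc K" for c
      using r that unfolding refines_def
      by (induction es e rule: list_all2_induct) (auto split: if_splits)
    moreover have "count_list e (Suc K) = 0" using assms(2) by (simp add: count_list_0_iff)
    ultimately have "count_list (es @ base) c = count_list (?l (count_list es K) (count_list es (Suc K))) c" for c
      by (auto simp: crep cf)
    then have e: "count_list (es @ base) = count_list (?l (count_list es K) (count_list es (Suc K)))" by (rule ext)
    have n: "ncol (es @ base) = ncol (?l (count_list es K) (count_list es (Suc K)))"
      by (simp only: refines_ncol[OF r] nc)
    show ?thesis unfolding \<phi>_def by (rule block_symmetricD[OF blocks n]; simp only: e n)
  qed
  show "\<phi> x y = \<phi> y x"
  proof -
    let ?\<tau> = "Transposition.transpose K (Suc K)"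
    let ?N = "ncol (e @ base)"
    have eK: "count_list e (Suc K) = 0" using assms(2) by (simp add: count_list_0_iff)
    have csK: "count_list cs K = 0" "count_list cs (Suc K) = 0"
      using K ncol_gt[of K cs] ncol_gt[of "Suc K" cs] by (auto simp: count_list_0_iff)
    have c: "count_list (?l x y) c = count_list (?l y x) (?\<tau> c)" for c
      by (simp add: crep cf transpose_def eK csK)
    have im: "?\<tau> ` {1..<?N} = {1..<?N}"
      using K(2) ncol_base[of e] by (intro transpose_image_eq) auto
    have "inj_on ?\<tau> {1..<?N}" by (rule inj_onI) (rule transpose_eq_imp_eq)
    from image_mset_mset_set[OF this] im
    have "mset_set {1..<?N} = image_mset ?\<tau> (mset_set {1..<?N})" by simp
    then have "image_mset (count_list (?l y x)) (mset_set {1..<?N})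
        = image_mset (count_list (?l y x)) (image_mset ?\<tau> (mset_set {1..<?N}))"
      by (rule arg_cong)
    also have "\<dots> = image_mset (count_list (?l x y)) (mset_set {1..<?N})"
      by (simp only: multiset.map_comp comp_def, rule image_mset_cong, simp only: c)
    finally have M: "image_mset (count_list (?l x y)) (mset_set {1..<?N})
        = image_mset (count_list (?l y x)) (mset_set {1..<?N})" ..
    have z: "count_list (?l x y) 0 = count_list (?l y x) 0" using K(2) c[of 0] by (simp add: transpose_def)
    show ?thesis unfolding \<phi>_def
      by (rule block_symmetricD[OF blocks]) (simp_all only: nc z mset_map mset_upt M)
  qed
qed

text \<open>
  By downward induction on the length of the skeleton. The steps into other cycles, and the factor
  \<open>?g\<close> common to the steps into the two new cycles, are determined by the skeleton, so the sum is a
  combination of the sums for its extensions; at \<open>Suc a\<close> only the colour \<open>K\<close> survives. Complete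
  skeletons are covered by the vanishing of symmetric sums over splittings.
\<close>

lemma refinement_sum_zero:
  assumes "Suc K \<notin> set e" "length e + Suc i \<le> n" "a < length e + Suc i \<longrightarrow> Suc a \<in> letters K e"
  shows "refinement_sum e (\<lambda>es. val pair_wts F (n - (length es + Suc i)) (es @ base)) = 0"
  using assms
proof (induction "n - (length e + Suc i)" arbitrary: e)
  case 0
  then have len: "length e + Suc i = n" by simp
  define \<phi> where "\<phi> = (\<lambda>x y. F (filter (\<lambda>c. c \<noteq> K) e @ replicate x K @ replicate y (Suc K) @ base))"
  have "refinement_sum e (\<lambda>es. val pair_wts F (n - (length es + Suc i)) (es @ base))
      = refinement_sum e (\<lambda>es. (\<lambda>U V. \<phi> (card U) (card V)) (letters K es) (letters (Suc K) es))"
    by (rule refinement_sum_cong)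
      (use len F_sizes(1)[OF 0(2)] in \<open>simp add: refines_length \<phi>_def card_letters\<close>)
  also have "\<dots> = 0"
    unfolding refinement_sum_sets[OF 0(2), of "\<lambda>U V. \<phi> (card U) (card V)"]
  proof (rule G.sum_split_wt_symmetric)
    show "Suc a \<in> letters K e" using 0 len i by simp
    show "0 \<notin> letters K e" using letters_bounds by fastforce
    show "\<phi> x y = \<phi> y x" for x y unfolding \<phi>_def by (rule F_sizes(2)[OF 0(2)])
  qed (use two in auto)
  finally show ?case .
next
  case (Suc k)
  then have len: "length e + Suc i < n" by simp
  let ?B = "{..ncol (e @ base)} - {K, Suc K}"
  let ?g = "q ^ cnt m (Suc (length (e @ base))) ((<) (Suc K)) (e @ base)"
  let ?v = "\<lambda>es. val pair_wts F (n - (length es + Suc i)) (es @ base)"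
  have split: "{..ncol (e @ base)} = ?B \<union> {K, Suc K}" using ncol_base[of e] by auto
  have step: "?v es = (\<Sum>c\<in>?B. pair_wts (e @ base) c * ?v (c # es))
      + ?g * (\<theta> es K * ?v (K # es) + \<theta> es (Suc K) * ?v (Suc K # es))" if r: "refines es e" for es
  proof -
    have l: "length es = length e" by (rule refines_length[OF r])
    have n: "n - (length es + Suc i) = Suc (n - (length (c # es) + Suc i))" for c using len l by simp
    have g: "cnt m (Suc (length (es @ base))) ((<) (Suc K)) (es @ base)
        = cnt m (Suc (length (e @ base))) ((<) (Suc K)) (e @ base)"
      using refines_cnt[OF r, of "(<) (Suc K)"] l by simp
    have "?v es = (\<Sum>c\<le>ncol (e @ base). pair_wts (es @ base) c * ?v (c # es))"
      using n refines_ncol[OF r] by simp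
    also have "\<dots> = (\<Sum>c\<in>?B. pair_wts (es @ base) c * ?v (c # es)) + (\<Sum>c\<in>{K, Suc K}. pair_wts (es @ base) c * ?v (c # es))"
      by (subst split, rule sum.union_disjoint) auto
    also have "(\<Sum>c\<in>?B. pair_wts (es @ base) c * ?v (c # es)) = (\<Sum>c\<in>?B. pair_wts (e @ base) c * ?v (c # es))"
      by (rule sum.cong) (use refines_pair_wts[OF r] in auto)
    also have "(\<Sum>c\<in>{K, Suc K}. pair_wts (es @ base) c * ?v (c # es))
        = ?g * (\<theta> es K * ?v (K # es) + \<theta> es (Suc K) * ?v (Suc K # es))"
      using pair_wts_\<theta>[of K es] pair_wts_\<theta>[of "Suc K" es] g len l by (simp add: algebra_simps)
    finally show ?thesis .
  qed
  have J: "refinement_sum e ?v = (\<Sum>c\<in>?B. pair_wts (e @ base) c * refinement_sum (c # e) ?v) + ?g * refinement_sum (K # e) ?v"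
  proof -
    have "refinement_sum e ?v = refinement_sum e (\<lambda>es. (\<Sum>c\<in>?B. pair_wts (e @ base) c * ?v (c # es))
      + ?g * (\<theta> es K * ?v (K # es) + \<theta> es (Suc K) * ?v (Suc K # es)))"
      by (rule refinement_sum_cong) (rule step)
    also have "\<dots> = (\<Sum>c\<in>?B. pair_wts (e @ base) c * refinement_sum e (\<lambda>es. ?v (c # es)))
        + ?g * refinement_sum e (\<lambda>es. \<theta> es K * ?v (K # es) + \<theta> es (Suc K) * ?v (Suc K # es))"
      by (simp only: refinement_sum_add refinement_sum_scale refinement_sum_sum[OF finite_Diff[OF finite_atMost]])
    finally show ?thesis by simp
  qed
  have "refinement_sum (K # e) ?v = 0"
    by (rule Suc.hyps(1)) (use Suc.hyps(2) Suc.prems len in auto)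
  moreover have "pair_wts (e @ base) c * refinement_sum (c # e) ?v = 0" if c: "c \<in> ?B" for c
  proof (cases "length e + Suc i = a")
    case True
    then have "pair_wts (e @ base) c = 0" using c by (simp add: pair_wts_def)
    then show ?thesis by simp
  next
    case False
    have "refinement_sum (c # e) ?v = 0"
      by (rule Suc.hyps(1)) (use Suc.hyps(2) Suc.prems len c False in auto)
    then show ?thesis by simp
  qed
  ultimately show ?case unfolding J by simp
qed

theorem new_pair_zero: "\<delta> base = 0"
proof -
  have "Suc i \<le> a" using i by simp
  then show ?thesis using \<delta>_eq_pair_wts[of "[]"] refinement_sum_zero[of "[]"] i by simp
qed

end

section \<open>Cycle forms under insertion of the largest letter\<close>

definition is_cyc :: "(nat \<Rightarrow> nat) \<Rightarrow> nat list \<Rightarrow> bool" where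
  "is_cyc \<sigma> ys \<longleftrightarrow> ys \<noteq> [] \<and> distinct ys \<and> successively (\<lambda>a b. \<sigma> a = b) ys \<and> \<sigma> (last ys) = hd ys"

lemma is_cyc_rotate:
  assumes "is_cyc \<sigma> (as @ bs)" "bs \<noteq> []"
  shows "is_cyc \<sigma> (bs @ as)"
  using assms by (cases "as = []") (auto simp: is_cyc_def successively_append_iff)

lemma is_cyc_funpow:
  assumes "is_cyc \<sigma> ys" "j < length ys"
  shows "(\<sigma> ^^ j) (hd ys) = ys ! j"
  using assms(2)
proof (induction j)
  case 0
  then show ?case by (simp add: hd_conv_nth)
next
  case (Suc j)
  then have "\<sigma> (ys ! j) = ys ! Suc j"
    using assms(1) by (auto simp: is_cyc_def successively_conv_nth)
  then show ?case using Suc by simp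
qed

lemma is_cyc_support:
  assumes "is_cyc \<sigma> ys"
  shows "support \<sigma> (hd ys) = ys"
proof -
  have ne: "ys \<noteq> []" and d: "distinct ys" using assms by (auto simp: is_cyc_def)
  obtain k where k: "length ys = Suc k" using ne by (cases ys) auto
  have "(\<sigma> ^^ Suc k) (hd ys) = \<sigma> (ys ! k)"
    using is_cyc_funpow[OF assms, of k] k by simp
  also have "ys ! k = last ys" using ne k by (simp add: last_conv_nth)
  finally have 1: "(\<sigma> ^^ length ys) (hd ys) = hd ys"
    using assms unfolding k by (simp add: is_cyc_def)
  have "least_power \<sigma> (hd ys) = length ys"
    unfolding least_power_def
  proof (rule Least_equality)
    show "(\<sigma> ^^ length ys) (hd ys) = hd ys \<and> 0 < length ys" using 1 ne by simp
    fix k assume k: "(\<sigma> ^^ k) (hd ys) = hd ys \<and> 0 < k"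
    show "length ys \<le> k"
    proof (rule ccontr)
      assume "\<not> length ys \<le> k"
      then have "ys ! k = ys ! 0" using is_cyc_funpow[OF assms, of k] k ne by (simp add: hd_conv_nth)
      then show False using d k \<open>\<not> length ys \<le> k\<close> ne by (simp add: nth_eq_iff_index_eq)
    qed
  qed
  then show ?thesis
    using is_cyc_funpow[OF assms] by (intro nth_equalityI) simp_all
qed

text \<open>
  The canonical cycle notation of \<open>\<sigma>\<close>: every cycle starts with its minimum, and the minima increase.
  Unlike the definition of \<open>cycles_of\<close> by orbits, it is easy to verify after an insertion, and it
  determines \<open>cycles_of\<close>.
\<close>

definition cyc_form :: "nat \<Rightarrow> (nat \<Rightarrow> nat) \<Rightarrow> nat list list \<Rightarrow> bool" where
  "cyc_form n \<sigma> css \<longleftrightarrow> (\<forall>ys\<in>set css. is_cyc \<sigma> ys \<and> (\<forall>y\<in>set ys. hd ys \<le> y)) \<and>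
     sorted_wrt (<) (map hd css) \<and> distinct (concat css) \<and> set (concat css) = {1..n}"

text \<open>
  The first letters of the cycles are the minima of the orbits, which are the letters selected in
  the definition of \<open>cycles_of\<close>, and iterating \<open>\<sigma>\<close> from them reproduces the cycles.
\<close>

lemma cyc_form_cycles_of:
  assumes "cyc_form n \<sigma> css"
  shows "cycles_of n \<sigma> = css"
proof -
  have cyc: "is_cyc \<sigma> ys" "\<And>y. y \<in> set ys \<Longrightarrow> hd ys \<le> y" "hd ys \<in> set ys" if "ys \<in> set css" for ys
    using assms that by (auto simp: cyc_form_def is_cyc_def)
  have supp: "set (support \<sigma> i) = set ys" if "ys \<in> set css" "i \<in> set ys" for i ys
  proof -
    obtain as bs where ys: "ys = as @ i # bs" using \<open>i \<in> set ys\<close> by (meson split_list)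
    have "is_cyc \<sigma> ((i # bs) @ as)" by (rule is_cyc_rotate) (use cyc(1)[OF that(1)] ys in auto)
    from is_cyc_support[OF this] show ?thesis using ys by auto
  qed
  have "set (map hd css) = {i\<in>{1..n}. \<forall>j\<in>set (support \<sigma> i). i \<le> j}"
  proof (intro equalityI subsetI)
    fix i assume "i \<in> set (map hd css)"
    then obtain ys where ys: "ys \<in> set css" "i = hd ys" by auto
    then show "i \<in> {i\<in>{1..n}. \<forall>j\<in>set (support \<sigma> i). i \<le> j}"
      using supp[OF ys(1), of i] cyc[OF ys(1)] assms by (auto simp: cyc_form_def)
  next
    fix i assume i: "i \<in> {i\<in>{1..n}. \<forall>j\<in>set (support \<sigma> i). i \<le> j}"
    then have "i \<in> set (concat css)" using assms by (simp add: cyc_form_def)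
    then obtain ys where ys: "ys \<in> set css" "i \<in> set ys" by auto
    have "\<forall>j\<in>set (support \<sigma> i). i \<le> j" using i by blast
    then have "i \<le> hd ys" "hd ys \<le> i" unfolding supp[OF ys] using cyc(2,3)[OF ys(1)] ys(2) by blast+
    then show "i \<in> set (map hd css)" using ys by auto
  qed
  then have "set (map hd css) = set (filter (\<lambda>i. \<forall>j\<in>set (support \<sigma> i). i \<le> j) [1..<n + 1])"
    by auto
  moreover have "sorted_wrt (<) (map hd css)" using assms by (simp add: cyc_form_def)
  moreover have "sorted_wrt (<) (filter (\<lambda>i. \<forall>j\<in>set (support \<sigma> i). i \<le> j) [1..<n + 1])"
    by (rule sorted_wrt_filter, rule sorted_wrt_upt)
  ultimately have "map hd css = filter (\<lambda>i. \<forall>j\<in>set (support \<sigma> i). i \<le> j) [1..<n + 1]"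
    by (intro strict_sorted_equal)
  then have "cycles_of n \<sigma> = map (support \<sigma>) (map hd css)" by (simp add: cycles_of_def)
  also have "\<dots> = map (\<lambda>ys. ys) css"
    unfolding map_map by (rule map_cong) (use cyc is_cyc_support in auto)
  finally show ?thesis by simp
qed

primrec insert_after :: "nat \<Rightarrow> nat \<Rightarrow> nat list \<Rightarrow> nat list" where
  "insert_after z x [] = []"
| "insert_after z x (y # ys) = (if y = x then y # z # ys else y # insert_after z x ys)"

lemma insert_after_notin: "x \<notin> set ys \<Longrightarrow> insert_after z x ys = ys"
  by (induction ys) auto

lemma insert_after_split: "x \<notin> set as \<Longrightarrow> insert_after z x (as @ x # bs) = as @ x # z # bs"
  by (induction as) auto

lemma is_cyc_cong: "(\<And>y. y \<in> set ys \<Longrightarrow> \<sigma> y = \<sigma>' y) \<Longrightarrow> is_cyc \<sigma> ys = is_cyc \<sigma>' ys"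
  unfolding is_cyc_def by (auto cong: successively_cong)

lemma is_cyc_insert_after:
  assumes c: "is_cyc \<sigma> (us @ x # vs)" and z: "z \<notin> set (us @ x # vs)"
    and \<sigma>': "\<sigma>' x = z" "\<sigma>' z = \<sigma> x" "\<And>y. y \<noteq> x \<Longrightarrow> y \<noteq> z \<Longrightarrow> \<sigma>' y = \<sigma> y"
  shows "is_cyc \<sigma>' (us @ x # z # vs)"
proof -
  have old: "\<sigma>' y = \<sigma> y" if "y \<in> set us \<union> set vs" for y
    by (rule \<sigma>'(3)) (use that c z in \<open>auto simp: is_cyc_def\<close>)
  have us: "successively (\<lambda>a b. \<sigma>' a = b) us = successively (\<lambda>a b. \<sigma> a = b) us"
    "successively (\<lambda>a b. \<sigma>' a = b) vs = successively (\<lambda>a b. \<sigma> a = b) vs"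
    by (rule successively_cong; simp add: old)+
  have l: "us \<noteq> [] \<Longrightarrow> \<sigma>' (last us) = \<sigma> (last us)" "vs \<noteq> [] \<Longrightarrow> \<sigma>' (last vs) = \<sigma> (last vs)"
    by (simp_all add: old)
  show ?thesis
    using c z \<sigma>'(1,2) us l
    by (cases "us = []"; cases "vs = []")
       (auto simp: is_cyc_def successively_append_iff successively_Cons)
qed

text \<open>
  Composing with the transposition of \<open>x\<close> and \<open>Suc n\<close> puts \<open>Suc n\<close> behind \<open>x\<close> in its cycle. As
  \<open>Suc n\<close> is the largest letter, the minima and hence the order of the cycles do not change.
\<close>

lemma cyc_form_extend:
  assumes c: "cyc_form n \<sigma> css" and \<sigma>: "\<sigma> permutes {1..n}" and x: "x \<in> {1..n}"
  shows "cyc_form (Suc n) (\<sigma> \<circ> Transposition.transpose x (Suc n)) (map (insert_after (Suc n) x) css)"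
proof -
  let ?z = "Suc n" and ?\<sigma> = "\<sigma> \<circ> Transposition.transpose x (Suc n)"
  have "x \<in> set (concat css)" using c x by (simp add: cyc_form_def)
  then obtain ys where ys: "ys \<in> set css" "x \<in> set ys" by auto
  obtain us vs where "ys = us @ x # vs" using split_list[OF ys(2)] by blast
  with split_list[OF ys(1)] obtain pre post where css: "css = pre @ (us @ x # vs) # post" by blast
  have dist: "distinct (concat css)" and st: "set (concat css) = {1..n}" using c by (auto simp: cyc_form_def)
  have zn: "?z \<notin> set (concat css)" using st by simp
  have xn: "x \<notin> set us" "x \<notin> set vs" "x \<notin> set (concat pre)" "x \<notin> set (concat post)"
    using dist unfolding css by auto
  have css': "map (insert_after ?z x) css = pre @ (us @ x # ?z # vs) # post"
    using xn unfolding css by (auto simp: insert_after_split insert_after_notin intro!: map_idI)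
  have s: "?\<sigma> x = ?z" "?\<sigma> ?z = \<sigma> x" "y \<noteq> x \<Longrightarrow> y \<noteq> ?z \<Longrightarrow> ?\<sigma> y = \<sigma> y" for y
    using permutes_not_in[OF \<sigma>, of ?z] by auto
  have hd: "hd (us @ x # ?z # vs) = hd (us @ x # vs)" by (cases us) auto
  have old: "is_cyc ?\<sigma> ws \<and> (\<forall>y\<in>set ws. hd ws \<le> y)" if ws: "ws \<in> set pre \<union> set post" for ws
  proof -
    have "is_cyc \<sigma> ws \<and> (\<forall>y\<in>set ws. hd ws \<le> y)" using c ws css by (auto simp: cyc_form_def)
    moreover have "is_cyc ?\<sigma> ws = is_cyc \<sigma> ws"
      by (rule is_cyc_cong, rule s(3)) (use ws xn zn css in auto)
    ultimately show ?thesis by simp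
  qed
  have "is_cyc \<sigma> (us @ x # vs)" using c css by (auto simp: cyc_form_def)
  moreover have "?z \<notin> set (us @ x # vs)" using zn unfolding css by auto
  ultimately have "is_cyc ?\<sigma> (us @ x # ?z # vs)"
    by (rule is_cyc_insert_after) (use s in auto)
  moreover have "\<forall>y\<in>set (us @ x # ?z # vs). hd (us @ x # ?z # vs) \<le> y"
  proof -
    have m: "\<forall>y\<in>set (us @ x # vs). hd (us @ x # vs) \<le> y" using c css by (auto simp: cyc_form_def)
    moreover have "hd (us @ x # vs) \<le> x" using m by auto
    ultimately show ?thesis unfolding hd using x by auto
  qed
  ultimately have cyc: "\<forall>ws\<in>set (pre @ (us @ x # ?z # vs) # post). is_cyc ?\<sigma> ws \<and> (\<forall>y\<in>set ws. hd ws \<le> y)"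
    using old by auto
  have "map hd (pre @ (us @ x # ?z # vs) # post) = map hd css"
    unfolding css by (simp only: map_append list.map hd)
  then have srt: "sorted_wrt (<) (map hd (pre @ (us @ x # ?z # vs) # post))"
    using c by (simp only: cyc_form_def)
  have cc: "concat css = (concat pre @ us) @ x # (vs @ concat post)"
    "concat (pre @ (us @ x # ?z # vs) # post) = (concat pre @ us) @ x # ?z # (vs @ concat post)"
    unfolding css by simp_all
  have "distinct (concat (pre @ (us @ x # ?z # vs) # post))"
    using dist zn unfolding cc by (simp only: distinct_append distinct.simps set_append list.set) blast
  moreover have "set (concat (pre @ (us @ x # ?z # vs) # post)) = insert ?z (set (concat css))"
    unfolding cc by (simp only: set_append list.set) blast
  moreover have "insert ?z {1..n} = {1..Suc n}" by auto
  ultimately show ?thesis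
    using cyc srt unfolding cyc_form_def css' st by metis
qed

lemma cyc_form_new:
  assumes c: "cyc_form n \<sigma> css" and \<sigma>: "\<sigma> permutes {1..n}"
  shows "cyc_form (Suc n) \<sigma> (css @ [[Suc n]])"
proof -
  have "\<sigma> (Suc n) = Suc n" using permutes_not_in[OF \<sigma>] by simp
  moreover have "hd ys < Suc n" if "ys \<in> set css" for ys
  proof -
    have "hd ys \<in> set ys" using c that by (auto simp: cyc_form_def is_cyc_def)
    moreover have "set ys \<subseteq> set (concat css)" using that by auto
    ultimately have "hd ys \<in> {1..n}" using c unfolding cyc_form_def by blast
    then show ?thesis by simp
  qed
  ultimately show ?thesis
    using c by (auto simp: cyc_form_def is_cyc_def sorted_wrt_append)
qed

text \<open>
  Removing the letter \<open>Suc n\<close> from its cycle, where \<open>x\<close> is the letter before it; \<open>x = Suc n\<close> if it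
  is a fixed point.
\<close>

lemma permutes_Suc_decompose:
  assumes "\<sigma>' permutes {1..Suc n}"
  defines "x \<equiv> inv \<sigma>' (Suc n)"
  shows "(\<sigma>' \<circ> Transposition.transpose x (Suc n)) permutes {1..n}" "x \<in> {1..Suc n}"
proof -
  show x: "x \<in> {1..Suc n}" unfolding x_def using permutes_in_image[OF permutes_inv[OF assms(1)]] by simp
  have sx: "\<sigma>' x = Suc n" unfolding x_def using permutes_inverses(1)[OF assms(1)] .
  have "(\<sigma>' \<circ> Transposition.transpose x (Suc n)) permutes {1..Suc n}"
    by (rule permutes_compose[OF permutes_swap_id assms(1)]) (use x in auto)
  then show "(\<sigma>' \<circ> Transposition.transpose x (Suc n)) permutes {1..n}"
    by (rule permutes_superset) (auto simp: sx atLeastAtMostSuc_conv)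
qed

lemma permutes_Suc_compose:
  assumes "\<sigma> permutes {1..n}" "x \<in> {1..Suc n}"
  shows "(\<sigma> \<circ> Transposition.transpose x (Suc n)) permutes {1..Suc n}"
    "inv (\<sigma> \<circ> Transposition.transpose x (Suc n)) (Suc n) = x"
proof -
  have "\<sigma> permutes {1..Suc n}" by (rule permutes_subset[OF assms(1)]) auto
  then show p: "(\<sigma> \<circ> Transposition.transpose x (Suc n)) permutes {1..Suc n}"
    by (intro permutes_compose[OF permutes_swap_id]) (use assms(2) in auto)
  have "(\<sigma> \<circ> Transposition.transpose x (Suc n)) x = Suc n" using permutes_not_in[OF assms(1)] by simp
  then show "inv (\<sigma> \<circ> Transposition.transpose x (Suc n)) (Suc n) = x"
    using permutes_inverses(2)[OF p, of x] by simp
qed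

lemma cyc_form_cycles:
  assumes "\<sigma> permutes {1..n}"
  shows "cyc_form n \<sigma> (cycles_of n \<sigma>)"
  using assms
proof (induction n arbitrary: \<sigma>)
  case 0
  then show ?case by (simp add: cyc_form_def cycles_of_def)
next
  case (Suc n)
  define x where "x = inv \<sigma> (Suc n)"
  define \<tau> where "\<tau> = \<sigma> \<circ> Transposition.transpose x (Suc n)"
  have \<tau>: "\<tau> permutes {1..n}" "x \<in> {1..Suc n}"
    using permutes_Suc_decompose[OF Suc.prems] by (simp_all add: \<tau>_def x_def)
  have \<sigma>: "\<sigma> = \<tau> \<circ> Transposition.transpose x (Suc n)" by (simp add: \<tau>_def comp_assoc)
  have "\<exists>css. cyc_form (Suc n) \<sigma> css"
  proof (cases "x = Suc n")
    case True
    then show ?thesis using cyc_form_new[OF Suc.IH[OF \<tau>(1)] \<tau>(1)] \<sigma> by auto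
  next
    case False
    then show ?thesis using cyc_form_extend[OF Suc.IH[OF \<tau>(1)] \<tau>(1), of x] \<sigma> \<tau>(2) by auto
  qed
  then show ?case using cyc_form_cycles_of by metis
qed

lemma cycles_of_extend:
  assumes "\<sigma> permutes {1..n}" "x \<in> {1..n}"
  shows "cycles_of (Suc n) (\<sigma> \<circ> Transposition.transpose x (Suc n)) = map (insert_after (Suc n) x) (cycles_of n \<sigma>)"
  by (rule cyc_form_cycles_of[OF cyc_form_extend[OF cyc_form_cycles[OF assms(1)] assms]])

lemma cycles_of_new:
  assumes "\<sigma> permutes {1..n}"
  shows "cycles_of (Suc n) \<sigma> = cycles_of n \<sigma> @ [[Suc n]]"
  by (rule cyc_form_cycles_of[OF cyc_form_new[OF cyc_form_cycles[OF assms] assms]])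

section \<open>Colourings of permutations\<close>

lemma precedes_in_Cons: "precedes_in a b (y # ys) \<longleftrightarrow> (a = y \<and> b \<in> set ys) \<or> precedes_in a b ys"
proof
  assume "precedes_in a b (y # ys)"
  then obtain i j where ij: "i < j" "j < length (y # ys)" "(y # ys) ! i = a" "(y # ys) ! j = b"
    by (auto simp: precedes_in_def)
  then obtain j' where j: "j = Suc j'" by (cases j) auto
  show "(a = y \<and> b \<in> set ys) \<or> precedes_in a b ys"
  proof (cases i)
    case 0
    then show ?thesis using ij j by auto
  next
    case (Suc i')
    then have "precedes_in a b ys" using ij j unfolding precedes_in_def
      by (intro exI[of _ i'] exI[of _ j']) auto
    then show ?thesis ..
  qed
next
  assume "(a = y \<and> b \<in> set ys) \<or> precedes_in a b ys"
  then show "precedes_in a b (y # ys)"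
  proof
    assume "a = y \<and> b \<in> set ys"
    then obtain k where "k < length ys" "ys ! k = b" "a = y" by (auto simp: in_set_conv_nth)
    then show ?thesis unfolding precedes_in_def by (intro exI[of _ 0] exI[of _ "Suc k"]) auto
  next
    assume "precedes_in a b ys"
    then obtain i j where "i < j" "j < length ys" "ys ! i = a" "ys ! j = b" by (auto simp: precedes_in_def)
    then show ?thesis unfolding precedes_in_def by (intro exI[of _ "Suc i"] exI[of _ "Suc j"]) auto
  qed
qed

lemma precedes_in_Nil [simp]: "\<not> precedes_in a b []"
  by (simp add: precedes_in_def)

lemma precedes_in_append:
  "precedes_in a b (us @ vs) \<longleftrightarrow> precedes_in a b us \<or> precedes_in a b vs \<or> (a \<in> set us \<and> b \<in> set vs)"
  by (induction us) (auto simp: precedes_in_Cons)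

lemma precedes_in_set: "precedes_in a b ws \<Longrightarrow> a \<in> set ws \<and> b \<in> set ws"
  by (induction ws) (auto simp: precedes_in_Cons)

text \<open>
  A new letter inserted directly behind \<open>x\<close> precedes the letters that stand behind \<open>x\<close>, and those
  among them that lie in \<open>N\<close> count for the weight.
\<close>

primrec later :: "nat set \<Rightarrow> nat \<Rightarrow> nat list \<Rightarrow> nat" where
  "later N x [] = 0"
| "later N x (y # ys) = (if x = y then card (N \<inter> set ys) else later N x ys)"

lemma later_split: "x \<notin> set us \<Longrightarrow> later N x (us @ x # vs) = card (N \<inter> set vs)"
  by (induction us) auto

lemma later_append_left:
  assumes "distinct (us @ vs)" "x \<in> set us"
  shows "later N x (us @ vs) = later N x us + card (N \<inter> set vs)"
  using assms
proof (induction us)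
  case (Cons u us)
  have "N \<inter> (set us \<union> set vs) = (N \<inter> set us) \<union> (N \<inter> set vs)" by auto
  moreover have "card ((N \<inter> set us) \<union> (N \<inter> set vs)) = card (N \<inter> set us) + card (N \<inter> set vs)"
    by (rule card_Un_disjoint) (use Cons.prems in auto)
  ultimately show ?case using Cons by auto
qed simp

lemma later_append_right: "x \<notin> set us \<Longrightarrow> later N x (us @ vs) = later N x vs"
  by (induction us) auto

text \<open>
  For the elements \<open>x\<close> of \<open>N\<close> from right to left, the exponents are \<open>0, 1, 2, \<dots>\<close>.
\<close>

lemma sum_later:
  fixes z :: "'a::comm_ring_1"
  assumes "distinct ys"
  shows "(\<Sum>x\<in>N \<inter> set ys. z ^ later N x ys) = qnum z (card (N \<inter> set ys))"
  using assms
proof (induction ys)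
  case (Cons y ys)
  have "(\<Sum>x\<in>N \<inter> set ys. z ^ later N x (y # ys)) = (\<Sum>x\<in>N \<inter> set ys. z ^ later N x ys)"
    by (rule sum.cong) (use Cons.prems in auto)
  then show ?case using Cons by (cases "y \<in> N") (auto simp: qnum_Suc add.commute)
qed simp

text \<open>
  The position of the cycle that contains \<open>y\<close>, which is its colour.
\<close>

primrec idx :: "nat list list \<Rightarrow> nat \<Rightarrow> nat" where
  "idx [] y = 0"
| "idx (ys # css) y = (if y \<in> set ys then 0 else Suc (idx css y))"

lemma idx_less: "y \<in> set (concat css) \<Longrightarrow> idx css y < length css"
  by (induction css) auto

lemma idx_notin: "y \<notin> set (concat css) \<Longrightarrow> idx (css @ [zs]) y = length css + (if y \<in> set zs then 0 else 1)"
  by (induction css) auto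

lemma idx_append: "y \<in> set (concat css) \<Longrightarrow> idx (css @ dss) y = idx css y"
  by (induction css) auto

lemma set_insert_after: "set (insert_after z x ys) = (if x \<in> set ys then insert z (set ys) else set ys)"
  by (induction ys) auto

lemma idx_insert_after:
  "y \<noteq> z \<Longrightarrow> idx (map (insert_after z x) css) y = idx css y"
  by (induction css) (auto simp: set_insert_after)

lemma idx_insert_after_new:
  "z \<notin> set (concat css) \<Longrightarrow> x \<in> set (concat css) \<Longrightarrow> idx (map (insert_after z x) css) z = idx css x"
  by (induction css) (auto simp: set_insert_after)

lemma idx_class:
  "distinct (concat css) \<Longrightarrow> k < length css \<Longrightarrow> {y\<in>set (concat css). idx css y = k} = set (css ! k)"
proof (induction css arbitrary: k)
  case (Cons ys css)
  show ?case
  proof (cases k)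
    case 0
    then show ?thesis by auto
  next
    case (Suc k')
    have "{y\<in>set (concat (ys # css)). idx (ys # css) y = k} = {y\<in>set (concat css). idx css y = k'}"
      using Cons.prems Suc by auto
    then show ?thesis using Cons Suc by simp
  qed
qed simp

text \<open>
  The elements of \<open>N\<close> after \<open>x\<close> are those in later cycles and the later ones in the cycle of \<open>x\<close>.
\<close>

lemma sum_later_concat:
  fixes z :: "'a::comm_ring_1"
  assumes "distinct (concat css)"
  shows "(\<Sum>x\<in>N \<inter> set (concat css). z ^ later N x (concat css) * g (idx css x)) =
    (\<Sum>k<length css. z ^ card {y\<in>N \<inter> set (concat css). k < idx css y} *
       qnum z (card {y\<in>N \<inter> set (concat css). idx css y = k}) * g k)"
  using assms
proof (induction css arbitrary: g)
  case (Cons ys css)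
  let ?R = "set (concat css)"
  have d: "distinct ys" "distinct (concat css)" "set ys \<inter> ?R = {}" using Cons.prems by auto
  have disj: "N \<inter> set (concat (ys # css)) = (N \<inter> set ys) \<union> (N \<inter> ?R)" by auto
  have "(\<Sum>x\<in>N \<inter> set (concat (ys # css)). z ^ later N x (concat (ys # css)) * g (idx (ys # css) x))
    = (\<Sum>x\<in>N \<inter> set ys. z ^ later N x (concat (ys # css)) * g (idx (ys # css) x))
      + (\<Sum>x\<in>N \<inter> ?R. z ^ later N x (concat (ys # css)) * g (idx (ys # css) x))"
    unfolding disj by (rule sum.union_disjoint) (use d in auto)
  also have "(\<Sum>x\<in>N \<inter> set ys. z ^ later N x (concat (ys # css)) * g (idx (ys # css) x))
      = (\<Sum>x\<in>N \<inter> set ys. z ^ later N x ys) * (z ^ card (N \<inter> ?R) * g 0)"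
    unfolding sum_distrib_right
    by (rule sum.cong) (use Cons.prems in \<open>auto simp: later_append_left power_add mult_ac\<close>)
  also have "\<dots> = z ^ card {y\<in>N \<inter> set (concat (ys # css)). 0 < idx (ys # css) y} *
       qnum z (card {y\<in>N \<inter> set (concat (ys # css)). idx (ys # css) y = 0}) * g 0"
  proof -
    have "{y\<in>N \<inter> set (concat (ys # css)). 0 < idx (ys # css) y} = N \<inter> ?R"
      "{y\<in>N \<inter> set (concat (ys # css)). idx (ys # css) y = 0} = N \<inter> set ys"
      using d(3) by auto
    then show ?thesis by (simp only: sum_later[OF d(1)] mult_ac)
  qed
  also have "(\<Sum>x\<in>N \<inter> ?R. z ^ later N x (concat (ys # css)) * g (idx (ys # css) x))
      = (\<Sum>x\<in>N \<inter> ?R. z ^ later N x (concat css) * g (Suc (idx css x)))"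
  proof (rule sum.cong[OF refl], goal_cases)
    case (1 x)
    then have "x \<notin> set ys" using d(3) by auto
    then show ?case by (simp add: later_append_right)
  qed
  also have "\<dots> = (\<Sum>k<length css. z ^ card {y\<in>N \<inter> set (concat (ys # css)). Suc k < idx (ys # css) y} *
       qnum z (card {y\<in>N \<inter> set (concat (ys # css)). idx (ys # css) y = Suc k}) * g (Suc k))"
  proof -
    have "{y\<in>N \<inter> ?R. k < idx css y} = {y\<in>N \<inter> set (concat (ys # css)). Suc k < idx (ys # css) y}"
      "{y\<in>N \<inter> ?R. idx css y = k} = {y\<in>N \<inter> set (concat (ys # css)). idx (ys # css) y = Suc k}" for k
      using d(3) by auto
    then show ?thesis by (simp only: Cons.IH[OF d(2), of "\<lambda>k. g (Suc k)"])
  qed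
  finally show ?case by (simp only: length_Cons sum.lessThan_Suc_shift comp_def)
qed simp

primrec colouring :: "nat list list \<Rightarrow> nat \<Rightarrow> nat list" where
  "colouring css 0 = []"
| "colouring css (Suc n) = idx css (Suc n) # colouring css n"

lemma length_colouring [simp]: "length (colouring css n) = n"
  by (induction n) auto

lemma set_colouring: "set (colouring css n) = idx css ` {1..n}"
  by (induction n) (auto simp: atLeastAtMostSuc_conv)

lemma colouring_cong: "(\<And>y. 1 \<le> y \<Longrightarrow> y \<le> n \<Longrightarrow> idx css y = idx dss y) \<Longrightarrow> colouring css n = colouring dss n"
  by (induction n) auto

lemma cnt_colouring: "cnt m h P (colouring css n) = card {y\<in>{1..n}. h \<le> m y \<and> P (idx css y)}"
proof (induction n)
  case (Suc n)
  have "{y\<in>{1..Suc n}. h \<le> m y \<and> P (idx css y)} =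
    (if h \<le> m (Suc n) \<and> P (idx css (Suc n)) then {Suc n} else {}) \<union> {y\<in>{1..n}. h \<le> m y \<and> P (idx css y)}"
    by (auto simp: le_Suc_eq)
  then show ?case using Suc by (auto simp: card_insert_if)
qed simp

lemma count_colouring: "count_list (colouring css n) k = card {y\<in>{1..n}. idx css y = k}"
proof (induction n)
  case (Suc n)
  have "{y\<in>{1..Suc n}. idx css y = k} =
    (if idx css (Suc n) = k then {Suc n} else {}) \<union> {y\<in>{1..n}. idx css y = k}"
    by (auto simp: le_Suc_eq)
  then show ?case using Suc by (auto simp: card_insert_if)
qed simp

lemma ncol_le: "(\<And>d. d \<in> set cs \<Longrightarrow> d < l) \<Longrightarrow> ncol cs \<le> l"
  by (induction cs) (auto simp: Suc_le_eq)

lemma ncol_colouring: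
  assumes "cyc_form n \<sigma> css"
  shows "ncol (colouring css n) = length css"
proof (rule antisym)
  have st: "set (concat css) = {1..n}" and d: "distinct (concat css)" using assms by (auto simp: cyc_form_def)
  show "ncol (colouring css n) \<le> length css"
    by (rule ncol_le) (use idx_less[of _ css] in \<open>unfold set_colouring st[symmetric], blast\<close>)
  show "length css \<le> ncol (colouring css n)"
  proof (cases "length css")
    case (Suc k)
    then have "css ! k \<in> set css" by simp
    then have "css ! k \<noteq> []" using assms by (auto simp: cyc_form_def is_cyc_def)
    then obtain y where "y \<in> set (css ! k)" by (cases "css ! k") auto
    then have "y \<in> {y\<in>set (concat css). idx css y = k}" using idx_class[OF d, of k] Suc by simp
    then have "k \<in> set (colouring css n)" unfolding set_colouring st[symmetric] by auto
    then show ?thesis using ncol_gt Suc by fastforce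
  qed simp
qed

definition block_sizes :: "nat list \<Rightarrow> nat list" where
  "block_sizes cs = map (count_list cs) [0..<ncol cs]"

lemma block_sizes_colouring:
  assumes "cyc_form n \<sigma> css"
  shows "block_sizes (colouring css n) = map length css"
proof (rule nth_equalityI)
  have st: "set (concat css) = {1..n}" and d: "distinct (concat css)" using assms by (auto simp: cyc_form_def)
  show "length (block_sizes (colouring css n)) = length (map length css)"
    by (simp add: block_sizes_def ncol_colouring[OF assms])
  fix k assume "k < length (block_sizes (colouring css n))"
  then have k: "k < length css" by (simp add: block_sizes_def ncol_colouring[OF assms])
  have "distinct (css ! k)" using assms k by (auto simp: cyc_form_def is_cyc_def)
  moreover have "{y\<in>{1..n}. idx css y = k} = set (css ! k)" using idx_class[OF d k] unfolding st .
  ultimately show "block_sizes (colouring css n) ! k = map length css ! k"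
    using k by (simp add: block_sizes_def ncol_colouring[OF assms] count_colouring distinct_card)
qed

section \<open>Permutation sums as colouring sums\<close>

lemma insert_after_append:
  "insert_after z x (us @ vs) = (if x \<in> set us then insert_after z x us @ vs else us @ insert_after z x vs)"
  by (induction us) auto

lemma concat_insert_after:
  "distinct (concat css) \<Longrightarrow> concat (map (insert_after z x) css) = insert_after z x (concat css)"
proof (induction css)
  case (Cons ys css)
  have "concat (map (insert_after z x) css) = concat css" if "x \<in> set ys"
  proof -
    have "x \<notin> set (concat css)" using that Cons.prems by auto
    then show ?thesis using Cons by (simp add: insert_after_notin)
  qed
  then show ?case using Cons by (auto simp: insert_after_append insert_after_notin)
qed simp

lemma precedes_in_insert_after:
  assumes "x \<in> set ws" "distinct ws" "z \<notin> set ws" "b \<noteq> z"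
  shows "a \<noteq> z \<Longrightarrow> precedes_in a b (insert_after z x ws) \<longleftrightarrow> precedes_in a b ws"
    "N \<subseteq> set ws \<Longrightarrow> card {b\<in>N. precedes_in z b (insert_after z x ws)} = later N x ws"
proof -
  obtain us vs where ws: "ws = us @ x # vs" using split_list[OF assms(1)] by blast
  have x: "x \<notin> set us" using assms(2) ws by auto
  show "precedes_in a b (insert_after z x ws) \<longleftrightarrow> precedes_in a b ws" if "a \<noteq> z"
    using that assms unfolding ws insert_after_split[OF x] by (auto simp: precedes_in_append precedes_in_Cons)
  have "precedes_in z y (insert_after z x ws) \<longleftrightarrow> y \<in> set vs" if "y \<in> set ws" for y
    using that assms(3) unfolding ws insert_after_split[OF x]
    by (auto simp: precedes_in_append precedes_in_Cons dest: precedes_in_set)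
  moreover assume "N \<subseteq> set ws"
  ultimately have "{b\<in>N. precedes_in z b (insert_after z x ws)} = N \<inter> set vs"
    unfolding ws by auto
  then show "card {b\<in>N. precedes_in z b (insert_after z x ws)} = later N x ws"
    unfolding ws later_split[OF x] by simp
qed

text \<open>
  A pair \<open>(i, Suc n)\<close> is counted by the weight if \<open>i\<close> is a neighbour of \<open>Suc n\<close> that stands behind
  it, and \<open>Suc n\<close> is never the smaller element of a pair.
\<close>

lemma wt_Suc:
  assumes old: "\<And>a b. a \<noteq> Suc n \<Longrightarrow> b \<noteq> Suc n \<Longrightarrow>
      precedes_in a b (cycle_word (Suc n) \<sigma>') \<longleftrightarrow> precedes_in a b (cycle_word n \<sigma>)"
  shows "wt (Suc n) m \<sigma>' = wt n m \<sigma> +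
    card {i\<in>{y\<in>{1..n}. Suc n \<le> m y}. precedes_in (Suc n) i (cycle_word (Suc n) \<sigma>')}"
proof -
  let ?S = "{(i, j). i \<in> {1..n} \<and> j \<in> {1..n} \<and> i < j \<and> j \<le> m i \<and> precedes_in j i (cycle_word n \<sigma>)}"
  let ?T = "{i\<in>{y\<in>{1..n}. Suc n \<le> m y}. precedes_in (Suc n) i (cycle_word (Suc n) \<sigma>')}"
  have fin: "finite ?S" by (rule finite_subset[of _ "{1..n} \<times> {1..n}"]) auto
  have "{(i, j). i \<in> {1..Suc n} \<and> j \<in> {1..Suc n} \<and> i < j \<and> j \<le> m i \<and>
      precedes_in j i (cycle_word (Suc n) \<sigma>')} = ?S \<union> (\<lambda>i. (i, Suc n)) ` ?T"
    using old by (auto simp: le_Suc_eq)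
  moreover have "card (?S \<union> (\<lambda>i. (i, Suc n)) ` ?T) = card ?S + card ?T"
    by (subst card_Un_disjoint) (use fin in \<open>auto simp: card_image inj_on_def\<close>)
  ultimately show ?thesis unfolding wt_def by simp
qed

lemma wt_extend:
  assumes "\<sigma> permutes {1..n}" "x \<in> {1..n}"
  shows "wt (Suc n) m (\<sigma> \<circ> Transposition.transpose x (Suc n)) =
    wt n m \<sigma> + later {y\<in>{1..n}. Suc n \<le> m y} x (concat (cycles_of n \<sigma>))"
proof -
  let ?\<sigma> = "\<sigma> \<circ> Transposition.transpose x (Suc n)"
  have f: "distinct (concat (cycles_of n \<sigma>))" "set (concat (cycles_of n \<sigma>)) = {1..n}"
    using cyc_form_cycles[OF assms(1)] by (auto simp: cyc_form_def)
  have w: "cycle_word (Suc n) ?\<sigma> = insert_after (Suc n) x (cycle_word n \<sigma>)"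
    unfolding cycle_word_def cycles_of_extend[OF assms] by (rule concat_insert_after[OF f(1)])
  note p = precedes_in_insert_after[of x "cycle_word n \<sigma>" "Suc n", folded w]
  have "wt (Suc n) m ?\<sigma> = wt n m \<sigma> +
    card {i\<in>{y\<in>{1..n}. Suc n \<le> m y}. precedes_in (Suc n) i (cycle_word (Suc n) ?\<sigma>)}"
    by (rule wt_Suc, rule p(1)) (use f assms(2) in \<open>auto simp: cycle_word_def\<close>)
  also have "card {i\<in>{y\<in>{1..n}. Suc n \<le> m y}. precedes_in (Suc n) i (cycle_word (Suc n) ?\<sigma>)}
      = later {y\<in>{1..n}. Suc n \<le> m y} x (cycle_word n \<sigma>)"
    by (rule p(2)[of 0]) (use f assms(2) in \<open>auto simp: cycle_word_def\<close>)
  finally show ?thesis unfolding cycle_word_def .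
qed

lemma wt_new:
  assumes "\<sigma> permutes {1..n}"
  shows "wt (Suc n) m \<sigma> = wt n m \<sigma>"
proof -
  have st: "set (cycle_word n \<sigma>) = {1..n}"
    using cyc_form_cycles[OF assms(1)] by (simp only: cycle_word_def cyc_form_def)
  have w: "cycle_word (Suc n) \<sigma> = cycle_word n \<sigma> @ [Suc n]"
    unfolding cycle_word_def cycles_of_new[OF assms] by simp
  have "\<not> precedes_in (Suc n) i (cycle_word (Suc n) \<sigma>)" for i
    unfolding w precedes_in_append precedes_in_Cons using st precedes_in_set[of "Suc n" i "cycle_word n \<sigma>"] by auto
  then show ?thesis
    by (subst wt_Suc[where \<sigma> = \<sigma>]) (auto simp: w precedes_in_append precedes_in_Cons)
qed

lemma finite_hess_perms: "finite (hess_perms n m)"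
  by (rule finite_subset[OF _ finite_permutations[of "{1..n}"]]) (auto simp: hess_perms_def)

text \<open>
  Inserting \<open>Suc n\<close> behind \<open>x\<close> changes the values at \<open>x\<close> and \<open>Suc n\<close> only: \<open>x\<close> is sent to \<open>Suc n\<close>,
  so \<open>x\<close> must be a neighbour, and \<open>Suc n\<close> to an element of \<open>1, \<dots>, n\<close>, which \<open>Suc n \<le> m (Suc n)\<close>
  admits.
\<close>

lemma sum_hess_perms_Suc:
  assumes "Suc n \<le> m (Suc n)"
  shows "(\<Sum>\<sigma>\<in>hess_perms (Suc n) m. f \<sigma>) = (\<Sum>\<sigma>\<in>hess_perms n m.
    f \<sigma> + (\<Sum>x\<in>{y\<in>{1..n}. Suc n \<le> m y}. f (\<sigma> \<circ> Transposition.transpose x (Suc n))))"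
proof -
  let ?X = "insert (Suc n) {y\<in>{1..n}. Suc n \<le> m y}"
  have "(\<Sum>\<sigma>\<in>hess_perms (Suc n) m. f \<sigma>) =
    (\<Sum>(\<sigma>, x)\<in>hess_perms n m \<times> ?X. f (\<sigma> \<circ> Transposition.transpose x (Suc n)))"
  proof (rule sum.reindex_bij_witness[where
        j = "\<lambda>\<sigma>. (\<sigma> \<circ> Transposition.transpose (inv \<sigma> (Suc n)) (Suc n), inv \<sigma> (Suc n))" and
        i = "\<lambda>(\<sigma>, x). \<sigma> \<circ> Transposition.transpose x (Suc n)"])
    fix \<sigma> assume \<sigma>: "\<sigma> \<in> hess_perms (Suc n) m"
    define x where "x = inv \<sigma> (Suc n)"
    have p: "\<sigma> permutes {1..Suc n}" and le: "\<And>i. i \<in> {1..Suc n} \<Longrightarrow> \<sigma> i \<le> m i"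
      using \<sigma> by (auto simp: hess_perms_def)
    note d = permutes_Suc_decompose[OF p, folded x_def]
    have sx: "\<sigma> x = Suc n" unfolding x_def using permutes_inverses(1)[OF p] .
    then have mx: "Suc n \<le> m x" using le[OF d(2)] by simp
    have "(\<sigma> \<circ> Transposition.transpose x (Suc n)) i \<le> m i" if i: "i \<in> {1..n}" for i
    proof (cases "i = x")
      case True
      have "(\<sigma> \<circ> Transposition.transpose x (Suc n)) i \<in> {1..n}" using permutes_in_image[OF d(1)] i by simp
      then show ?thesis using mx True by simp
    next
      case False
      then show ?thesis using i le[of i] by simp
    qed
    then show "(\<sigma> \<circ> Transposition.transpose (inv \<sigma> (Suc n)) (Suc n), inv \<sigma> (Suc n)) \<in> hess_perms n m \<times> ?X"
      unfolding x_def[symmetric] using d mx by (auto simp: hess_perms_def le_Suc_eq)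
    show "(case (\<sigma> \<circ> Transposition.transpose (inv \<sigma> (Suc n)) (Suc n), inv \<sigma> (Suc n)) of
        (\<sigma>, x) \<Rightarrow> \<sigma> \<circ> Transposition.transpose x (Suc n)) = \<sigma>"
      by (simp add: comp_assoc)
    then show "(case (\<sigma> \<circ> Transposition.transpose (inv \<sigma> (Suc n)) (Suc n), inv \<sigma> (Suc n)) of
        (\<sigma>, x) \<Rightarrow> f (\<sigma> \<circ> Transposition.transpose x (Suc n))) = f \<sigma>"
      by (simp add: comp_assoc)
  next
    fix y assume "y \<in> hess_perms n m \<times> ?X"
    then obtain \<tau> x where y: "y = (\<tau>, x)" and \<tau>: "\<tau> permutes {1..n}" and le: "\<And>i. i \<in> {1..n} \<Longrightarrow> \<tau> i \<le> m i"
      and x: "x \<in> ?X" by (auto simp: hess_perms_def)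
    have x': "x \<in> {1..Suc n}" using x by auto
    note c = permutes_Suc_compose[OF \<tau> x']
    show "(case case y of (\<sigma>, x) \<Rightarrow> \<sigma> \<circ> Transposition.transpose x (Suc n) of
        \<sigma> \<Rightarrow> (\<sigma> \<circ> Transposition.transpose (inv \<sigma> (Suc n)) (Suc n), inv \<sigma> (Suc n))) = y"
      unfolding y case_prod_conv c(2) by (simp add: comp_assoc)
    have "(\<tau> \<circ> Transposition.transpose x (Suc n)) i \<le> m i" if i: "i \<in> {1..Suc n}" for i
    proof (cases "i = x \<or> i = Suc n")
      case True
      have "\<tau> x \<in> {1..Suc n}"
        using permutes_in_image[OF permutes_subset[OF \<tau>], of "{1..Suc n}" x] x' by auto
      moreover have "\<tau> (Suc n) = Suc n" by (rule permutes_not_in[OF \<tau>]) simp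
      ultimately show ?thesis using True x assms by auto
    next
      case False
      then show ?thesis using i le[of i] by auto
    qed
    then show "(case y of (\<sigma>, x) \<Rightarrow> \<sigma> \<circ> Transposition.transpose x (Suc n)) \<in> hess_perms (Suc n) m"
      using c(1) by (simp add: y hess_perms_def)
  qed
  also have "\<dots> = (\<Sum>\<sigma>\<in>hess_perms n m. \<Sum>x\<in>?X. f (\<sigma> \<circ> Transposition.transpose x (Suc n)))"
    by (rule sum.cartesian_product[symmetric])
  also have "\<dots> = (\<Sum>\<sigma>\<in>hess_perms n m.
    f \<sigma> + (\<Sum>x\<in>{y\<in>{1..n}. Suc n \<le> m y}. f (\<sigma> \<circ> Transposition.transpose x (Suc n))))"
    by (rule sum.cong[OF refl], subst sum.insert) auto
  finally show ?thesis .
qed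

definition perm_sum :: "'a::comm_ring_1 \<Rightarrow> nat \<Rightarrow> (nat \<Rightarrow> nat) \<Rightarrow> (nat list \<Rightarrow> 'a) \<Rightarrow> 'a" where
  "perm_sum z n m G = (\<Sum>\<sigma>\<in>hess_perms n m. z ^ wt n m \<sigma> * G (colouring (cycles_of n \<sigma>) n))"

lemma perm_sum_Suc:
  assumes "Suc n \<le> m (Suc n)"
  shows "perm_sum z (Suc n) m G = perm_sum z n m (\<lambda>cs. \<Sum>c\<le>ncol cs. step_wt z m cs c * G (c # cs))"
  unfolding perm_sum_def sum_hess_perms_Suc[where m = m, OF assms]
proof (rule sum.cong[OF refl], goal_cases)
  case (1 \<sigma>)
  then have p: "\<sigma> permutes {1..n}" by (simp add: hess_perms_def)
  let ?css = "cycles_of n \<sigma>" and ?N = "{y\<in>{1..n}. Suc n \<le> m y}"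
  let ?cs = "colouring ?css n"
  have f: "distinct (concat ?css)" "set (concat ?css) = {1..n}"
    using cyc_form_cycles[OF p] by (auto simp: cyc_form_def)
  have nc: "ncol ?cs = length ?css" by (rule ncol_colouring[OF cyc_form_cycles[OF p]])
  have N: "?N \<inter> set (concat ?css) = ?N" unfolding f by auto
  have new: "colouring (cycles_of (Suc n) \<sigma>) (Suc n) = length ?css # ?cs"
  proof -
    have "idx (?css @ [[Suc n]]) (Suc n) = length ?css" using f by (subst idx_notin) auto
    moreover have "colouring (?css @ [[Suc n]]) n = ?cs"
      by (rule colouring_cong, rule idx_append) (use f in auto)
    ultimately show ?thesis unfolding cycles_of_new[OF p] by simp
  qed
  have ext: "colouring (cycles_of (Suc n) (\<sigma> \<circ> Transposition.transpose x (Suc n))) (Suc n) = idx ?css x # ?cs"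
    if x: "x \<in> {1..n}" for x
  proof -
    have "idx (map (insert_after (Suc n) x) ?css) (Suc n) = idx ?css x"
      by (rule idx_insert_after_new) (use f x in auto)
    moreover have "colouring (map (insert_after (Suc n) x) ?css) n = ?cs"
      by (rule colouring_cong, rule idx_insert_after) auto
    ultimately show ?thesis unfolding cycles_of_extend[OF p x] by simp
  qed
  have last: "step_wt z m ?cs (length ?css) = 1"
    unfolding step_wt_def nc[symmetric] using ncol_gt[of _ ?cs]
    by (subst (1 2) cnt_eq_0) (auto simp: qnum_1 dest: less_asym)
  have "(\<Sum>x\<in>?N. z ^ wt (Suc n) m (\<sigma> \<circ> Transposition.transpose x (Suc n)) *
      G (colouring (cycles_of (Suc n) (\<sigma> \<circ> Transposition.transpose x (Suc n))) (Suc n)))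
    = z ^ wt n m \<sigma> * (\<Sum>x\<in>?N. z ^ later ?N x (concat ?css) * G (idx ?css x # ?cs))"
    unfolding sum_distrib_left
    by (rule sum.cong[OF refl]) (simp add: wt_extend[OF p] ext power_add mult.assoc del: colouring.simps)
  also have "(\<Sum>x\<in>?N. z ^ later ?N x (concat ?css) * G (idx ?css x # ?cs)) =
    (\<Sum>k<length ?css. step_wt z m ?cs k * G (k # ?cs))"
    using sum_later_concat[OF f(1), of z ?N "\<lambda>k. G (k # ?cs)"] unfolding N
    by (simp add: step_wt_def cnt_colouring nc conj_assoc)
  finally have "(\<Sum>x\<in>?N. z ^ wt (Suc n) m (\<sigma> \<circ> Transposition.transpose x (Suc n)) *
      G (colouring (cycles_of (Suc n) (\<sigma> \<circ> Transposition.transpose x (Suc n))) (Suc n)))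
    = z ^ wt n m \<sigma> * (\<Sum>k<length ?css. step_wt z m ?cs k * G (k # ?cs))" .
  moreover have "(\<Sum>c\<le>ncol ?cs. step_wt z m ?cs c * G (c # ?cs)) =
    (\<Sum>k<length ?css. step_wt z m ?cs k * G (k # ?cs)) + G (length ?css # ?cs)"
    unfolding nc lessThan_Suc_atMost[symmetric] by (simp add: last)
  ultimately show ?case
    unfolding wt_new[OF p] new by (simp add: distrib_left add.commute)
qed

lemma perm_sum_val:
  assumes "\<And>i. 1 \<le> i \<Longrightarrow> i \<le> n + r \<Longrightarrow> i \<le> m i"
  shows "perm_sum z (n + r) m G = perm_sum z n m (\<lambda>cs. val (step_wt z m) G r cs)"
  using assms
proof (induction r arbitrary: n)
  case (Suc r)
  have "perm_sum z (n + Suc r) m G = perm_sum z (Suc n) m (\<lambda>cs. val (step_wt z m) G r cs)"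
    using Suc.IH[of "Suc n"] Suc.prems by simp
  also have "\<dots> = perm_sum z n m (\<lambda>cs. val (step_wt z m) G (Suc r) cs)"
    using Suc.prems[of "Suc n"] by (simp add: perm_sum_Suc)
  finally show ?case .
qed (simp add: perm_sum_def)

text \<open>
  Inserting the letters one after the other; the sum over the positions in a cycle is the step
  weight of its colour.
\<close>

theorem sum_hess_perms_colourings:
  assumes "\<And>i. 1 \<le> i \<Longrightarrow> i \<le> n \<Longrightarrow> i \<le> m i"
  shows "(\<Sum>\<sigma>\<in>hess_perms n m. z ^ wt n m \<sigma> * \<Phi> (map length (cycles_of n \<sigma>))) =
    val (step_wt z m) (\<lambda>cs. \<Phi> (block_sizes cs)) n []"
proof -
  have "(\<Sum>\<sigma>\<in>hess_perms n m. z ^ wt n m \<sigma> * \<Phi> (map length (cycles_of n \<sigma>))) = perm_sum z n m (\<lambda>cs. \<Phi> (block_sizes cs))"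
    unfolding perm_sum_def
    by (rule sum.cong[OF refl], subst block_sizes_colouring[OF cyc_form_cycles])
       (auto simp: hess_perms_def)
  also have "\<dots> = perm_sum z 0 m (\<lambda>cs. val (step_wt z m) (\<lambda>cs. \<Phi> (block_sizes cs)) n cs)"
    using perm_sum_val[of 0 n m] assms by simp
  also have "hess_perms 0 m = {id}" by (auto simp: hess_perms_def)
  then have "perm_sum z 0 m (\<lambda>cs. val (step_wt z m) (\<lambda>cs. \<Phi> (block_sizes cs)) n cs) =
      val (step_wt z m) (\<lambda>cs. \<Phi> (block_sizes cs)) n []"
    by (simp add: perm_sum_def wt_def cycles_of_def)
  finally show ?thesis .
qed

section \<open>The modular law for cycle sums and for the symmetric functions\<close>

lemma hessenbergD:
  assumes "m \<in> hessenberg n" "1 \<le> x" "x \<le> n"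
  shows "x \<le> m x" "m x \<le> n" "x \<le> y \<Longrightarrow> y \<le> n \<Longrightarrow> m x \<le> m y"
  using assms by (auto simp: hessenberg_def PiE_iff mono_on_def)

lemma block_symmetric_block_sizes:
  assumes "\<And>s us vs. mset us = mset vs \<Longrightarrow> \<Phi> (s # us) = \<Phi> (s # vs)"
  shows "block_symmetric (\<lambda>cs. \<Phi> (block_sizes cs))"
  unfolding block_symmetric_def
proof (intro allI impI)
  fix cs ds :: "nat list"
  assume eq: "ncol cs = ncol ds" "count_list cs 0 = count_list ds 0"
    "mset (map (count_list cs) [1..<ncol cs]) = mset (map (count_list ds) [1..<ncol ds])"
  show "\<Phi> (block_sizes cs) = \<Phi> (block_sizes ds)"
  proof (cases "ncol ds")
    case 0
    then show ?thesis using eq(1) by (simp add: block_sizes_def)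
  next
    case (Suc k)
    have "block_sizes es = count_list es 0 # map (count_list es) [1..<ncol es]" if "ncol es = Suc k" for es
      unfolding block_sizes_def that by (subst upt_conv_Cons) auto
    then show ?thesis using eq Suc assms by metis
  qed
qed

lemma ratfun_double_eq_0:
  fixes x :: ratfun
  assumes "x + x = 0"
  shows "x = 0"
proof -
  have "(1 + 1 :: ratfun) \<noteq> 0" by (simp add: One_fract_def Zero_fract_def eq_fract)
  moreover have "(1 + 1) * x = 0" using assms by (simp add: distrib_right)
  ultimately show ?thesis by (metis mult_eq_0_iff)
qed

text \<open>
  After the translation into colourings, the conditions on a modular triple become those of the two
  combinatorial cancellations, with \<open>a = m' i\<close>.
\<close>

theorem cycle_sums_modular:
  fixes \<Phi> :: "nat list \<Rightarrow> ratfun"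
  assumes sym: "\<And>s us vs. mset us = mset vs \<Longrightarrow> \<Phi> (s # us) = \<Phi> (s # vs)"
    and triple: "modular_triple_I n m m' m'' \<or> restricted_modular_triple_II n m m' m''"
  defines "S \<equiv> \<lambda>m. \<Sum>\<sigma>\<in>hess_perms n m. q ^ wt n m \<sigma> * \<Phi> (map length (cycles_of n \<sigma>))"
  shows "(1 + q) * S m' = q * S m + S m''"
proof -
  let ?F = "\<lambda>cs. \<Phi> (block_sizes cs)"
  have H: "m \<in> hessenberg n" "m' \<in> hessenberg n" "m'' \<in> hessenberg n"
    using triple by (auto simp: modular_triple_I_def restricted_modular_triple_II_def)
  have S: "S l = val (step_wt q l) ?F n []" if "l \<in> hessenberg n" for l
    unfolding S_def by (rule sum_hess_perms_colourings) (use hessenbergD[OF that] in auto)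
  have blocks: "block_symmetric ?F" by (rule block_symmetric_block_sizes, rule sym)
  note swap = block_symmetric_swap_invariant[OF blocks]
  have "defect q (step_wt q m) (step_wt q m') (step_wt q m'') ?F n [] = 0"
    using triple
  proof
    assume "modular_triple_I n m m' m''"
    then obtain i where i: "1 \<le> i" "i < n" "m i + 1 = m' i" "m'' i = m' i + 1"
      "(if i = 1 then 0 else m' (i - 1)) < m' i" "m' i < m' (i + 1)"
      and other: "\<forall>j\<in>{1..n} - {i}. m j = m' j \<and> m' j = m'' j" and eq: "m' (m' i) = m' (m' i + 1)"
      by (auto simp: modular_triple_I_def)
    have an: "m' i + 1 \<le> n" using hessenbergD(2)[OF H(3), of i] i by simp
    have ia: "i < m' i" using hessenbergD(1)[OF H(1), of i] i by simp
    show ?thesis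
    proof (rule type_I[where i = i and a = "m' i"])
      show "m' x \<noteq> m' i" if x: "1 \<le> x" "x \<le> n" "x \<noteq> i" for x
      proof (cases "x < i")
        case True
        then have "m' x \<le> m' (i - 1)" by (intro hessenbergD(3)[OF H(2)]) (use x i in auto)
        then show ?thesis using i(5) True x by (auto split: if_splits)
      next
        case False
        then have "m' (i + 1) \<le> m' x" by (intro hessenbergD(3)[OF H(2)]) (use x i in auto)
        then show ?thesis using i(6) by simp
      qed
      have "m' i + 1 \<le> m' (m' i + 1)" by (rule hessenbergD(1)[OF H(2)]) (use an in auto)
      then show "Suc (m' i) \<le> m' (m' i)" using eq by simp
    qed (use i an ia other eq swap in auto)
  next
    assume "restricted_modular_triple_II n m m' m''"
    then obtain i where i: "1 \<le> i" "i < n" "i \<noteq> 1" "m' i + 1 = m' (i + 1)" "m i = m' i" "m'' i = m' i + 1"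
      "m (i + 1) + 1 = m' (i + 1)" "m' (i + 1) = m'' (i + 1)"
      and other: "\<forall>j\<in>{1..n} - {i, i + 1}. m j = m' j \<and> m' j = m'' j"
      and inv: "{j\<in>{1..n}. m' j = i} = {}"
      by (auto simp: restricted_modular_triple_II_def)
    have an: "m' i + 1 \<le> n" using hessenbergD(2)[OF H(2), of "i + 1"] i by simp
    have ni: "m' x \<noteq> i" if "1 \<le> x" "x \<le> n" for x using inv that by auto
    have ia: "i < m' i" using hessenbergD(1)[OF H(2), of i] ni[of i] i by simp
    have mono: "m x \<le> m y" if "1 \<le> x" "x \<le> y" "y \<le> n" for x y
      using hessenbergD(3)[OF H(1), of x y] that by simp
    have i_ge_2: "2 \<le> i" using i by simp
    have beyond: "Suc (m' i) \<le> m x" if "Suc i < x" "x \<le> n" for x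
    proof -
      have "m' (i + 1) \<le> m' x" by (rule hessenbergD(3)[OF H(2)]) (use that i in auto)
      then show ?thesis using other i that by auto
    qed
    have "m' x \<noteq> i" if "1 \<le> x" "x < i" for x using ni[of x] that i by simp
    then interpret type_II q n i "m' i" m m' m'' ?F
      by unfold_locales (use i an ia other swap in auto)
    show ?thesis
    proof (rule reduce_to_new_pair)
      fix cs :: "nat list" assume len: "length cs = i - 1"
      obtain c cs' where "cs = c # cs'" using len i_ge_2 by (cases cs) auto
      then have "0 < ncol cs" by simp
      then interpret type_II_pair q n i "m' i" m m' m'' ?F cs "ncol cs"
        by unfold_locales
          (use len beyond mono blocks ratfun_double_eq_0 hessenbergD(2)[OF H(1)] in auto)
      show "\<delta> (Suc (ncol cs) # ncol cs # cs) = 0" by (rule new_pair_zero)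
    qed
  qed
  then show ?thesis
    unfolding defect_def S[OF H(1)] S[OF H(2)] S[OF H(3)] by (simp add: algebra_simps)
qed

lemma coeff_sf_sum: "coeff_sf (\<Sum>x\<in>A. f x) a = (\<Sum>x\<in>A. coeff_sf (f x) a)"
  by (induction A rule: infinite_finite_induct) (auto simp: zero_symfun.rep_eq plus_symfun.rep_eq)

lemma scale_sf_mult: "c \<odot> (f * g) = f * (c \<odot> g)"
  by transfer (simp add: case_prod_unfold sum_distrib_left mult_ac)

lemma cycles_of_nonempty: "\<sigma> permutes {1..n} \<Longrightarrow> 1 \<le> n \<Longrightarrow> cycles_of n \<sigma> \<noteq> []"
  using cyc_form_cycles[of \<sigma> n] by (auto simp: cyc_form_def)

lemma coeff_g_fun:
  assumes "k < n"
  shows "coeff_sf (g_fun k n m) a = (\<Sum>\<sigma>\<in>hess_perms n m. q ^ wt n m \<sigma> *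
    (case map length (cycles_of n \<sigma>) of [] \<Rightarrow> 0 | s # us \<Rightarrow>
      if n - k \<le> s then (-1) ^ (s + k - n) * coeff_sf (h_sym (s + k - n) * omega (rho_part us)) a else 0))"
  (is "_ = (\<Sum>\<sigma>\<in>_. ?f \<sigma>)")
proof -
  have "coeff_sf (g_fun k n m) a = (\<Sum>\<sigma> | \<sigma> \<in> hess_perms n m \<and> n - k \<le> first_cycle_length n \<sigma>. ?f \<sigma>)"
    unfolding g_fun_def using assms
  proof (simp only: if_True coeff_sf_sum scale_sf.rep_eq, intro sum.cong[OF refl], goal_cases)
    case (1 \<sigma>)
    then have "cycles_of n \<sigma> \<noteq> []" using cycles_of_nonempty by (auto simp: hess_perms_def)
    then obtain c cs where c: "cycles_of n \<sigma> = c # cs" by (cases "cycles_of n \<sigma>") auto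
    with 1 show ?case by (simp add: first_cycle_length_def mult_ac)
  qed
  also have "\<dots> = (\<Sum>\<sigma>\<in>hess_perms n m. ?f \<sigma>)"
  proof (rule sum.mono_neutral_left[OF finite_hess_perms], blast, intro ballI)
    fix \<sigma> assume \<sigma>: "\<sigma> \<in> hess_perms n m - {\<sigma>. \<sigma> \<in> hess_perms n m \<and> n - k \<le> first_cycle_length n \<sigma>}"
    then have "cycles_of n \<sigma> \<noteq> []" using cycles_of_nonempty assms by (auto simp: hess_perms_def)
    then obtain c cs where c: "cycles_of n \<sigma> = c # cs" by (cases "cycles_of n \<sigma>") auto
    with \<sigma> show "?f \<sigma> = 0" by (simp add: first_cycle_length_def)
  qed
  finally show ?thesis .
qed

text \<open>
  Coefficientwise; the restriction on the length of the first cycle in \<open>g_fun\<close> is made part of \<open>\<Phi>\<close>.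
\<close>

theorem g_fun_modular:
  assumes "modular_triple_I n m m' m'' \<or> restricted_modular_triple_II n m m' m''"
  shows "(1 + q) \<odot> g_fun k n m' = q \<odot> g_fun k n m + g_fun k n m''"
proof (rule symfun_eqI)
  fix a
  show "coeff_sf ((1 + q) \<odot> g_fun k n m') a = coeff_sf (q \<odot> g_fun k n m + g_fun k n m'') a"
  proof (cases "k < n")
    case True
    have parts: "rho_part us = rho_part vs" if "mset us = mset vs" for us vs
      unfolding rho_part_def using that by (metis mset_map prod_mset_prod_list)
    define \<Phi> where "\<Phi> sizes = (case sizes of [] \<Rightarrow> 0 | s # us \<Rightarrow> if n - k \<le> s
      then (-1) ^ (s + k - n) * coeff_sf (h_sym (s + k - n) * omega (rho_part us)) a else 0)" for sizes
    have "\<Phi> (s # us) = \<Phi> (s # vs)" if "mset us = mset vs" for s us vs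
      by (simp add: \<Phi>_def parts[OF that])
    from cycle_sums_modular[of \<Phi>, OF this assms] show ?thesis
      unfolding scale_sf.rep_eq plus_symfun.rep_eq coeff_g_fun[OF True] \<Phi>_def .
  next
    case False
    then show ?thesis by (simp add: g_fun_def scale_sf.rep_eq plus_symfun.rep_eq zero_symfun.rep_eq)
  qed
qed

theorem proposition4p4:
  shows "(\<forall>k. restricted_modular_law (g_fun k)) \<and> (\<forall>k\<ge>1. restricted_modular_law (G_fun k))"
proof (intro conjI allI impI)
  show "restricted_modular_law (g_fun k)" for k
    unfolding restricted_modular_law_def using g_fun_modular by blast
  show "restricted_modular_law (G_fun k)" for k
    unfolding restricted_modular_law_def
  proof (intro allI impI)
    fix n m m' m''
    assume t: "modular_triple_I n m m' m'' \<or> restricted_modular_triple_II n m m' m''"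
    show "(1 + q) \<odot> G_fun k n m' = q \<odot> G_fun k n m + G_fun k n m''"
    proof (cases "1 \<le> k \<and> k \<le> n")
      case True
      then show ?thesis
        by (simp add: G_fun_def scale_sf_mult g_fun_modular[OF t] distrib_left)
    next
      case False
      have "c \<odot> (0 :: Lam) = 0" for c by transfer simp
      then show ?thesis using False by (auto simp: G_fun_def)
    qed
  qed
qed

end
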